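(* Let $K$ be a field and let $B$ be a homogeneous simplicial affine semigroup, given as described in the context, with $\dim K[B]=2$ (that is, $d=2$). Then $$\operatorname{reg} K[B]\leq \deg K[B]-\operatorname{codim} K[B].$$
   Context: $\mathbb N=\{0,1,2,\ldots\}$. Setting for $B$: let $d,\alpha,c\geq 1$ be integers and $M_{d,\alpha}=\{(u_1,\ldots,u_d)\in\mathbb N^d\mid \sum_{i=1}^d u_i=\alpha\}$. $B$ is the submonoid of $(\mathbb N^d,+)$ generated by $\{e_1,\ldots,e_d,a_1,\ldots,a_c\}\subseteq M_{d,\alpha}$, where $e_i=(0,\ldots,0,\alpha,0,\ldots,0)$ ($\alpha$ in position $i$), the listed $d+c$ generators being pairwise distinct, and where the coordinates $a_{i[j]}$ ($1\le i\le c$, $1\le j\le d$) of $a_1,\dots,a_c$ are relatively prime (the gcd of all of them is $1$). $K[B]$ is the subring of $K[t_1,\ldots,t_d]$ generated by the monomials $t^b=t_1^{b_1}\cdots t_d^{b_d}$, $b\in B$, graded by $\deg t^b=(\sum_i b_i)/\alpha$. Its Krull dimension is $d$. $\deg K[B]$ denotes its degree (multiplicity, i.e. $(d-1)!$ times the leading coefficient of its Hilbert polynomial), and $\operatorname{codim}K[B]=\dim_K K[B]_1-\dim K[B]=c$. Regularity: for a standard graded polynomial ring $R=K[x_1,\ldots,x_n]$ with homogeneous maximal ideal $R_+$ and a finitely generated graded $R$-module $M$, $\operatorname{reg}M=\max\{i+a(H^i_{R_+}(M))\mid i\geq 0\}$, where $a(H)=\max\{r\mid H_r\neq 0\}$ and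 $a(0)=-\infty$. $\operatorname{reg}K[B]$ is the regularity of $K[B]$ as a graded module over $R=K[x_1,\ldots,x_{d+c}]$ via the surjection $x_i\mapsto t_i^{\alpha}$ ($1\le i\le d$), $x_{d+j}\mapsto t^{a_j}$ ($1\le j\le c$). *)

theory Defs
  imports
    "HOL-Algebra.Module"
    "HOL-Algebra.Ideal"
    "HOL-Algebra.Product_Groups"
    "HOL-Library.Poly_Mapping"
    "HOL-Library.Extended_Real"
    "HOL-Computational_Algebra.Polynomial"
begin

text \<open>
  Multivariate polynomials over \<open>'k\<close> in the variables numbered \<open>0, 1, 2, \<dots>\<close> are finitely supported
  maps from exponent vectors to coefficients, and the exponent vectors are finitely supported maps
  from variables to exponents. Vectors in \<open>\<nat>\<^sup>d\<close> are the exponent vectors supported on \<open>{..<d}\<close>, so all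
  indices are shifted by one against the usual numbering \<open>1, \<dots>, d\<close>.
\<close>

type_synonym 'k mpoly = "(nat \<Rightarrow>\<^sub>0 nat) \<Rightarrow>\<^sub>0 'k"

definition mconst :: "'k::zero \<Rightarrow> 'k mpoly"
  where "mconst c = Poly_Mapping.single 0 c"

definition mmonom :: "(nat \<Rightarrow>\<^sub>0 nat) \<Rightarrow> 'k::zero_neq_one mpoly"
  where "mmonom b = Poly_Mapping.single b 1"

definition mvar :: "nat \<Rightarrow> 'k::zero_neq_one mpoly"
  where "mvar i = mmonom (Poly_Mapping.single i 1)"

definition mscale :: "'k::comm_ring_1 \<Rightarrow> 'k mpoly \<Rightarrow> 'k mpoly"
  where "mscale c p = mconst c * p"

definition subring_of :: "'r::comm_ring_1 set \<Rightarrow> 'r ring"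
  where "subring_of A = \<lparr>carrier = A, monoid.mult = (*), one = 1, zero = 0, add = (+)\<rparr>"

definition mpoly_ring :: "nat \<Rightarrow> 'k::comm_ring_1 mpoly ring"
  where "mpoly_ring n = subring_of {p. \<forall>u\<in>Poly_Mapping.keys p. Poly_Mapping.keys u \<subseteq> {..<n}}"

definition mpoly_eval :: "(nat \<Rightarrow> 'k::comm_ring_1 mpoly) \<Rightarrow> 'k mpoly \<Rightarrow> 'k mpoly"
  where "mpoly_eval g p =
    (\<Sum>u\<in>Poly_Mapping.keys p. mconst (Poly_Mapping.lookup p u) * (\<Prod>i\<in>Poly_Mapping.keys u. g i ^ Poly_Mapping.lookup u i))"

inductive_set subalgebra_generated :: "'k::comm_ring_1 mpoly set \<Rightarrow> 'k mpoly set"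
  for X :: "'k::comm_ring_1 mpoly set"
where
  const: "mconst c \<in> subalgebra_generated X"
| gen: "p \<in> X \<Longrightarrow> p \<in> subalgebra_generated X"
| add: "p \<in> subalgebra_generated X \<Longrightarrow> q \<in> subalgebra_generated X \<Longrightarrow> p + q \<in> subalgebra_generated X"
| mult: "p \<in> subalgebra_generated X \<Longrightarrow> q \<in> subalgebra_generated X \<Longrightarrow> p * q \<in> subalgebra_generated X"


section \<open>Affine semigroups and their semigroup algebras\<close>

inductive_set submonoid_generated :: "'a::monoid_add set \<Rightarrow> 'a set"
  for X :: "'a::monoid_add set"
where
  zero: "0 \<in> submonoid_generated X"
| gen: "u \<in> X \<Longrightarrow> u \<in> submonoid_generated X"
| add: "u \<in> submonoid_generated X \<Longrightarrow> v \<in> submonoid_generated X \<Longrightarrow> u + v \<in> submonoid_generated X"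

definition total_degree :: "(nat \<Rightarrow>\<^sub>0 nat) \<Rightarrow> nat"
  where "total_degree u = (\<Sum>i\<in>Poly_Mapping.keys u. Poly_Mapping.lookup u i)"

definition M_set :: "nat \<Rightarrow> nat \<Rightarrow> (nat \<Rightarrow>\<^sub>0 nat) set"
  where "M_set d \<alpha> = {u. Poly_Mapping.keys u \<subseteq> {..<d} \<and> total_degree u = \<alpha>}"

text \<open>The list \<open>e\<^sub>1, \<dots>, e\<^sub>d, a\<^sub>1, \<dots>, a\<^sub>c\<close> of generators, numbered from \<open>0\<close> to \<open>d + c - 1\<close>.\<close>

definition generator :: "nat \<Rightarrow> nat \<Rightarrow> (nat \<Rightarrow> (nat \<Rightarrow>\<^sub>0 nat)) \<Rightarrow> nat \<Rightarrow> (nat \<Rightarrow>\<^sub>0 nat)"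
  where "generator d \<alpha> a i = (if i < d then Poly_Mapping.single i \<alpha> else a (i - d))"

locale homogeneous_simplicial_semigroup =
  fixes d \<alpha> c :: nat
    and a :: "nat \<Rightarrow> (nat \<Rightarrow>\<^sub>0 nat)"
    and B :: "(nat \<Rightarrow>\<^sub>0 nat) set"
  assumes d_pos: "d \<ge> 1" and \<alpha>_pos: "\<alpha> \<ge> 1" and c_pos: "c \<ge> 1"
    and generator_in_M: "\<And>i. i < d + c \<Longrightarrow> generator d \<alpha> a i \<in> M_set d \<alpha>"
    and generators_distinct: "inj_on (generator d \<alpha> a) {..<d + c}"
    and coprime: "Gcd {Poly_Mapping.lookup (a i) j | i j. i < c \<and> j < d} = 1"
    and B_eq: "B = submonoid_generated (generator d \<alpha> a ` {..<d + c})"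

definition semigroup_algebra :: "(nat \<Rightarrow>\<^sub>0 nat) set \<Rightarrow> 'k::field mpoly set"
  where "semigroup_algebra B = subalgebra_generated (mmonom ` B)"

text \<open>The grading is indexed by \<open>int\<close>, with zero components in negative degrees, since local
  cohomology lives in negative degrees as well.\<close>

definition graded_part :: "nat \<Rightarrow> (nat \<Rightarrow>\<^sub>0 nat) set \<Rightarrow> int \<Rightarrow> 'k::field mpoly set"
  where "graded_part \<alpha> B r =
    {p \<in> semigroup_algebra B. \<forall>b\<in>Poly_Mapping.keys p. real (total_degree b) / real \<alpha> = real_of_int r}"

text \<open>\<open>K[B]\<close> as a module over \<open>K[x\<^sub>0, \<dots>, x\<^bsub>n-1\<^esub>]\<close> via \<open>x\<^sub>i \<mapsto> t\<^bsup>g i\<^esup>\<close>.\<close>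

definition semigroup_module ::
    "(nat \<Rightarrow> (nat \<Rightarrow>\<^sub>0 nat)) \<Rightarrow> (nat \<Rightarrow>\<^sub>0 nat) set \<Rightarrow> ('k::field mpoly, 'k mpoly) module"
  where "semigroup_module g B =
    \<lparr>carrier = semigroup_algebra B, monoid.mult = (*), one = 1, zero = 0, add = (+),
     module.smult = (\<lambda>r f. mpoly_eval (\<lambda>i. mmonom (g i)) r * f)\<rparr>"


section \<open>Dimension, codimension and degree\<close>

definition krull_dim :: "('r, 'm) ring_scheme \<Rightarrow> enat"
  where "krull_dim R =
    Sup {enat l | l. \<exists>P. (\<forall>i\<le>l. primeideal (P i) R) \<and> (\<forall>i<l. P i \<subset> P (Suc i))}"

text \<open>In the following, \<open>G\<close> is the family of graded components of the graded \<open>K\<close>-algebra in question.\<close>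

definition codimension :: "('k::field mpoly, 'm) ring_scheme \<Rightarrow> (int \<Rightarrow> 'k mpoly set) \<Rightarrow> ereal"
  where "codimension R G =
    ereal (real (vector_space.dim mscale (G 1))) - ereal_of_enat (krull_dim R)"

definition hilbert_polynomial :: "(int \<Rightarrow> 'k::field mpoly set) \<Rightarrow> real poly"
  where "hilbert_polynomial G =
    (THE h. \<forall>\<^sub>F r in sequentially. poly h (real r) = real (vector_space.dim mscale (G (int r))))"

definition multiplicity_degree :: "nat \<Rightarrow> (int \<Rightarrow> 'k::field mpoly set) \<Rightarrow> real"
  where "multiplicity_degree d G = fact (d - 1) * lead_coeff (hilbert_polynomial G)"


section \<open>Localization of modules\<close>

text \<open>
  Localization of an \<open>R\<close>-module \<open>M\<close> at the powers of \<open>f\<close>: the pair \<open>(m, k)\<close> represents \<open>m / f\<^sup>k\<close>.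
  The ring operations that the record type carries besides the module structure are irrelevant.
\<close>

definition loc_rel ::
    "('r, 'x) ring_scheme \<Rightarrow> ('r, 'm, 'y) module_scheme \<Rightarrow> 'r \<Rightarrow> (('m \<times> nat) \<times> ('m \<times> nat)) set"
  where "loc_rel R M f = {((m, k), (m', k')) | m k m' k'. m \<in> carrier M \<and> m' \<in> carrier M \<and>
    (\<exists>j::nat. (f [^]\<^bsub>R\<^esub> (j + k')) \<odot>\<^bsub>M\<^esub> m = (f [^]\<^bsub>R\<^esub> (j + k)) \<odot>\<^bsub>M\<^esub> m')}"

definition frac ::
    "('r, 'x) ring_scheme \<Rightarrow> ('r, 'm, 'y) module_scheme \<Rightarrow> 'r \<Rightarrow> 'm \<Rightarrow> nat \<Rightarrow> ('m \<times> nat) set"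
  where "frac R M f m k = loc_rel R M f `` {(m, k)}"

definition localization ::
    "('r, 'x) ring_scheme \<Rightarrow> ('r, 'm, 'y) module_scheme \<Rightarrow> 'r \<Rightarrow> ('r, ('m \<times> nat) set) module"
  where "localization R M f =
    \<lparr>carrier = (carrier M \<times> UNIV) // loc_rel R M f,
     monoid.mult = undefined, one = undefined,
     zero = frac R M f \<zero>\<^bsub>M\<^esub> 0,
     add = (\<lambda>X Y. \<Union>(m, k)\<in>X. \<Union>(m', k')\<in>Y.
       frac R M f (((f [^]\<^bsub>R\<^esub> k') \<odot>\<^bsub>M\<^esub> m) \<oplus>\<^bsub>M\<^esub> ((f [^]\<^bsub>R\<^esub> k) \<odot>\<^bsub>M\<^esub> m')) (k + k')),
     module.smult = (\<lambda>r X. \<Union>(m, k)\<in>X. frac R M f (r \<odot>\<^bsub>M\<^esub> m) k)\<rparr>"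

text \<open>The canonical map \<open>M\<^sub>f \<rightarrow> M\<^sub>h\<close>, \<open>m / f\<^sup>k \<mapsto> g\<^sup>k m / h\<^sup>k\<close>, where \<open>h = f g\<close>.\<close>

definition loc_map ::
    "('r, 'x) ring_scheme \<Rightarrow> ('r, 'm, 'y) module_scheme \<Rightarrow> 'r \<Rightarrow> 'r \<Rightarrow> ('m \<times> nat) set \<Rightarrow> ('m \<times> nat) set"
  where "loc_map R M g h X = (\<Union>(m, k)\<in>X. frac R M h ((g [^]\<^bsub>R\<^esub> k) \<odot>\<^bsub>M\<^esub> m) k)"

text \<open>The component of degree \<open>r\<close> of \<open>M\<^sub>f\<close>, where \<open>f\<close> is homogeneous of degree \<open>e\<close> and \<open>G\<close> is the
  grading of \<open>M\<close>.\<close>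

definition loc_part ::
    "('r, 'x) ring_scheme \<Rightarrow> ('r, 'm, 'y) module_scheme \<Rightarrow> (int \<Rightarrow> 'm set) \<Rightarrow> 'r \<Rightarrow> nat \<Rightarrow> int
      \<Rightarrow> ('m \<times> nat) set set"
  where "loc_part R M G f e r = {frac R M f m k | m k. m \<in> G (r + int k * int e)}"


section \<open>Local cohomology and regularity\<close>

text \<open>
  Local cohomology of a graded \<open>R\<close>-module \<open>M\<close> with grading \<open>G\<close>, supported in the ideal generated by
  the elements \<open>x 0, \<dots>, x (n - 1)\<close> of degree \<open>1\<close>, is the cohomology of the Cech complex
  \<open>0 \<rightarrow> M \<rightarrow> \<Prod>\<^sub>i M\<^bsub>x i\<^esub> \<rightarrow> \<Prod>\<^bsub>i<j\<^esub> M\<^bsub>x i x j\<^esub> \<rightarrow> \<dots> \<rightarrow> M\<^bsub>x 0 \<dots> x (n - 1)\<^esub> \<rightarrow> 0\<close>.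
  The differentials are homogeneous of degree \<open>0\<close>, so the component of degree \<open>r\<close> of the cohomology is
  the cohomology of the component of degree \<open>r\<close> of the complex.
\<close>

definition cech_index :: "nat \<Rightarrow> nat \<Rightarrow> nat set set"
  where "cech_index n p = {S. S \<subseteq> {..<n} \<and> card S = p}"

definition cech_loc ::
    "('r, 'x) ring_scheme \<Rightarrow> ('r, 'm, 'y) module_scheme \<Rightarrow> (nat \<Rightarrow> 'r) \<Rightarrow> nat set
      \<Rightarrow> ('r, ('m \<times> nat) set) module"
  where "cech_loc R M x S = localization R M (finprod R x S)"

definition cech_group ::
    "('r, 'x) ring_scheme \<Rightarrow> ('r, 'm, 'y) module_scheme \<Rightarrow> (nat \<Rightarrow> 'r) \<Rightarrow> nat \<Rightarrow> nat
      \<Rightarrow> (nat set \<Rightarrow> ('m \<times> nat) set) monoid"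
  where "cech_group R M x n p =
    product_group (cech_index n p) (\<lambda>S. add_monoid (cech_loc R M x S))"

definition cech_diff ::
    "('r, 'x) ring_scheme \<Rightarrow> ('r, 'm, 'y) module_scheme \<Rightarrow> (nat \<Rightarrow> 'r) \<Rightarrow> nat \<Rightarrow> nat
      \<Rightarrow> (nat set \<Rightarrow> ('m \<times> nat) set) \<Rightarrow> (nat set \<Rightarrow> ('m \<times> nat) set)"
  where "cech_diff R M x n p \<phi> = (\<lambda>T\<in>cech_index n (Suc p).
    finsum (cech_loc R M x T)
      (\<lambda>i. let y = loc_map R M (x i) (finprod R x T) (\<phi> (T - {i}))
           in if even (card {j\<in>T. j < i}) then y else \<ominus>\<^bsub>cech_loc R M x T\<^esub> y)
      T)"

definition cech_part ::
    "('r, 'x) ring_scheme \<Rightarrow> ('r, 'm, 'y) module_scheme \<Rightarrow> (int \<Rightarrow> 'm set) \<Rightarrow> (nat \<Rightarrow> 'r)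
      \<Rightarrow> nat \<Rightarrow> nat \<Rightarrow> int \<Rightarrow> (nat set \<Rightarrow> ('m \<times> nat) set) set"
  where "cech_part R M G x n p r =
    (\<Pi>\<^sub>E S\<in>cech_index n p. loc_part R M G (finprod R x S) (card S) r)"

definition cech_cocycles ::
    "('r, 'x) ring_scheme \<Rightarrow> ('r, 'm, 'y) module_scheme \<Rightarrow> (int \<Rightarrow> 'm set) \<Rightarrow> (nat \<Rightarrow> 'r)
      \<Rightarrow> nat \<Rightarrow> nat \<Rightarrow> int \<Rightarrow> (nat set \<Rightarrow> ('m \<times> nat) set) set"
  where "cech_cocycles R M G x n p r =
    {\<phi> \<in> cech_part R M G x n p r. cech_diff R M x n p \<phi> = \<one>\<^bsub>cech_group R M x n (Suc p)\<^esub>}"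

definition cech_coboundaries ::
    "('r, 'x) ring_scheme \<Rightarrow> ('r, 'm, 'y) module_scheme \<Rightarrow> (int \<Rightarrow> 'm set) \<Rightarrow> (nat \<Rightarrow> 'r)
      \<Rightarrow> nat \<Rightarrow> nat \<Rightarrow> int \<Rightarrow> (nat set \<Rightarrow> ('m \<times> nat) set) set"
  where "cech_coboundaries R M G x n p r =
    (case p of 0 \<Rightarrow> {\<one>\<^bsub>cech_group R M x n 0\<^esub>}
     | Suc q \<Rightarrow> cech_diff R M x n q ` cech_part R M G x n q r)"

definition local_cohomology ::
    "('r, 'x) ring_scheme \<Rightarrow> ('r, 'm, 'y) module_scheme \<Rightarrow> (int \<Rightarrow> 'm set) \<Rightarrow> (nat \<Rightarrow> 'r)
      \<Rightarrow> nat \<Rightarrow> nat \<Rightarrow> int \<Rightarrow> (nat set \<Rightarrow> ('m \<times> nat) set) set monoid"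
  where "local_cohomology R M G x n p r =
    (cech_group R M x n p)\<lparr>carrier := cech_cocycles R M G x n p r\<rparr>
      Mod cech_coboundaries R M G x n p r"

text \<open>\<open>a(H) = max {r. H\<^sub>r \<noteq> 0}\<close>. As suprema in \<open>ereal\<close>, \<open>a(0) = -\<infinity>\<close>, and a set of
  degrees without upper bound would yield \<open>\<infinity>\<close>. Cohomology groups are written multiplicatively.\<close>

definition a_invariant :: "(int \<Rightarrow> ('h, 'z) monoid_scheme) \<Rightarrow> ereal"
  where "a_invariant H = (SUP r\<in>{r. carrier (H r) \<noteq> {\<one>\<^bsub>H r\<^esub>}}. ereal (real_of_int r))"

text \<open>The regularity of a graded module over \<open>K[x\<^sub>0, \<dots>, x\<^bsub>n-1\<^esub>]\<close>.\<close>

definition regularity :: "nat \<Rightarrow> ('k::field mpoly, 'm, 'y) module_scheme \<Rightarrow> (int \<Rightarrow> 'm set) \<Rightarrow> ereal"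
  where "regularity n M G =
    (SUP i::nat. ereal (real i) + a_invariant (local_cohomology (mpoly_ring n) M G mvar n i))"

end

theory Submission
  imports Defs "HOL-Library.Multiset"
begin

text \<open>
  For \<open>d = 2\<close> the degree of \<open>K[B]\<close> is \<open>\<alpha>\<close> and its codimension is \<open>c\<close>, so the claim is \<open>reg K[B] \<le> \<alpha> - c\<close>.
  All localizations of \<open>K[B]\<close> at products of variables embed into Laurent polynomials, so the Cech
  complex splits over the points \<open>z \<in> \<int>\<^sup>2\<close> whose coordinate sum is divisible by \<open>\<alpha>\<close>. A set \<open>S\<close> of
  variables contributes at \<open>z\<close> iff \<open>z\<close> lies in the localization of \<open>B\<close> at \<open>S\<close>, which is everything
  unless \<open>S\<close> is empty or consists of \<open>e\<^sub>1\<close> or \<open>e\<^sub>2\<close> alone. Hence only \<open>H\<^sup>1\<close> and \<open>H\<^sup>2\<close> can be nonzero: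
  \<open>H\<^sup>1\<close> comes from the points \<open>z \<notin> B\<close> with \<open>z + k e\<^sub>1, z + l e\<^sub>2 \<in> B\<close> for some \<open>k, l\<close>, and \<open>H\<^sup>2\<close> from the
  points for which neither \<open>k\<close> nor \<open>l\<close> exists. Their degrees are at most \<open>\<alpha> - c - 1\<close> and
  \<open>\<alpha> - c - 2\<close>, respectively, because minimal representations of suitable elements of \<open>B\<close> yield many prefix
  sums that are distinct modulo \<open>\<alpha>\<close> and avoid the \<open>c + 1\<close> residues of the generators.
\<close>

section \<open>Holes of sumsets\<close>

text \<open>The constant \<alpha> - c counts residues modulo \<alpha>. The generators occupy c + 1
  of them, as \<open>e\<^sub>1\<close> and \<open>e\<^sub>2\<close> share the residue 0. In a
  minimal representation by n interior generators the n - 1 prefix sums of length at least 2 take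
  new, distinct residues, so n \<le> \<alpha> - c. For \<open>H\<^sup>2\<close> this is enough. The
  obstacle is \<open>H\<^sup>1\<close>: a representation of z + \<open>e\<^sub>1\<close> may spend k
  summands on \<open>e\<^sub>2\<close>, which yield no residues. The k missing ones are taken from a
  representation of z + \<open>e\<^sub>2\<close>, and the part used must not collide with the first
  list. At a point z the contributing sets S are closed under enlargement. Where removing some
  vertex h never leaves the family, it is a cone and its alternating complex is contractible; the
  degree bounds provide h. The bound on holes also gives the degree: in high degrees each residue
  class gains one point per step, so the Hilbert function has slope \<alpha>. The hypothesis fixes
  the Krull dimension and not d: a chain of face primes excludes d \<ge> 3, and distinct generators
  exclude d = 1.\<close>

lemma dvd_diffE:
  fixes m :: "'a::comm_ring_1"
  assumes "m dvd s - x"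
  obtains t where "s = x + m * t"
  using assms by (metis add.commute diff_add_cancel dvdE)

locale interior_points =
  fixes \<alpha> :: int and X :: "int set"
  assumes \<alpha>_pos: "\<alpha> > 0" and X_sub: "X \<subseteq> {0<..<\<alpha>}"
begin

text \<open>Points are given by their degree \<open>r\<close> and first coordinate \<open>u\<close>: \<open>(1, \<alpha>)\<close> is \<open>e\<^sub>1\<close>, \<open>(1, 0)\<close> is \<open>e\<^sub>2\<close>,
  and \<open>(1, x)\<close> for \<open>x \<in> X\<close> are the other generators.\<close>

definition in_sumset :: "int \<Rightarrow> int \<Rightarrow> bool"
  where "in_sumset r u \<longleftrightarrow> (\<exists>M i j. set_mset M \<subseteq> X \<and> i \<ge> 0 \<and> j \<ge> 0 \<and>
    r = int (size M) + i + j \<and> u = \<Sum>\<^sub># M + \<alpha> * i)"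

text \<open>The trades that a minimal representation rules out: a part for corners
  \<open>e\<^sub>1\<close>, \<open>e\<^sub>2\<close> alone, or a part of at least two elements for
  one element of \<open>X\<close> and corners. Parts of size 1 are exempt from the second clause,
  being congruent to themselves.\<close>

definition reduced :: "int multiset \<Rightarrow> bool"
  where "reduced M \<longleftrightarrow> set_mset M \<subseteq> X \<and>
    (\<forall>\<sigma>. \<sigma> \<subseteq># M \<longrightarrow> \<sigma> \<noteq> {#} \<longrightarrow> \<not> \<alpha> dvd \<Sum>\<^sub># \<sigma>) \<and>
    (\<forall>\<sigma> x. \<sigma> \<subseteq># M \<longrightarrow> size \<sigma> \<ge> 2 \<longrightarrow> x \<in> X \<longrightarrow> \<not> \<alpha> dvd (\<Sum>\<^sub># \<sigma> - x))"

lemma finite_X: "finite X"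
  using X_sub finite_subset by blast

lemma card_X_le: "int (card X) \<le> \<alpha> - 1"
proof -
  have "card X \<le> card {0<..<\<alpha>}"
    using X_sub by (intro card_mono) auto
  then show ?thesis
    using \<alpha>_pos by auto
qed

lemma sum_mset_bounds:
  assumes "set_mset M \<subseteq> X"
  shows "int (size M) \<le> \<Sum>\<^sub># M" "\<Sum>\<^sub># M \<le> (\<alpha> - 1) * int (size M)"
proof -
  have "int (size M) \<le> \<Sum>\<^sub># M \<and> \<Sum>\<^sub># M \<le> (\<alpha> - 1) * int (size M)"
    using assms
  proof (induction M)
    case (add x M)
    then have "1 \<le> x" "x \<le> \<alpha> - 1"
      using X_sub by auto
    then show ?case
      using add by (auto simp: algebra_simps)
  qed auto
  then show "int (size M) \<le> \<Sum>\<^sub># M" "\<Sum>\<^sub># M \<le> (\<alpha> - 1) * int (size M)"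
    by auto
qed

text \<open>The degree forces the number of copies of \<open>e\<^sub>2\<close>, so membership comes
  down to the signs of two integers. The hole arguments exploit that one of them must fail.\<close>

lemma in_sumsetI:
  assumes "set_mset M \<subseteq> X" "u = \<Sum>\<^sub># M + \<alpha> * i" "i \<ge> 0" "r - int (size M) - i \<ge> 0"
  shows "in_sumset r u"
  unfolding in_sumset_def using assms
  by (intro exI[of _ M] exI[of _ i] exI[of _ "r - int (size M) - i"]) auto

lemma in_sumset_0: "in_sumset 0 0"
  by (rule in_sumsetI[of "{#}" _ 0]) auto

lemma in_sumset_add:
  assumes "in_sumset r u" "in_sumset r' u'"
  shows "in_sumset (r + r') (u + u')"
proof -
  obtain M i j where 1: "set_mset M \<subseteq> X" "i \<ge> 0" "j \<ge> 0"
    "r = int (size M) + i + j" "u = \<Sum>\<^sub># M + \<alpha> * i"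
    using assms(1) in_sumset_def by auto
  obtain M' i' j' where 2: "set_mset M' \<subseteq> X" "i' \<ge> 0" "j' \<ge> 0"
    "r' = int (size M') + i' + j'" "u' = \<Sum>\<^sub># M' + \<alpha> * i'"
    using assms(2) in_sumset_def by auto
  show ?thesis
    by (rule in_sumsetI[of "M + M'" _ "i + i'"]) (use 1 2 in \<open>auto simp: algebra_simps\<close>)
qed

lemma in_sumset_corner: "i \<ge> 0 \<Longrightarrow> j \<ge> 0 \<Longrightarrow> in_sumset (i + j) (\<alpha> * i)"
  by (rule in_sumsetI[of "{#}" _ i]) auto

lemma in_sumset_shift:
  assumes "in_sumset r u" "i \<ge> 0" "j \<ge> 0"
  shows "in_sumset (r + i + j) (u + \<alpha> * i)"
  using in_sumset_add[OF assms(1) in_sumset_corner[OF assms(2,3)]] by (simp add: add.assoc)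

lemma in_sumset_bounds:
  assumes "in_sumset r u"
  shows "0 \<le> u" "u \<le> \<alpha> * r" "0 \<le> r"
proof -
  obtain M i j where 1: "set_mset M \<subseteq> X" "i \<ge> 0" "j \<ge> 0"
    "r = int (size M) + i + j" "u = \<Sum>\<^sub># M + \<alpha> * i"
    using assms(1) in_sumset_def by auto
  have "0 \<le> \<alpha> * i" "0 \<le> \<alpha> * j"
    using 1 \<alpha>_pos by auto
  with 1 sum_mset_bounds[OF 1(1)] show "0 \<le> u" "u \<le> \<alpha> * r" "0 \<le> r"
    by (auto simp: algebra_simps)
qed

lemma reducedD:
  assumes "reduced M" "\<sigma> \<subseteq># M"
  shows "\<sigma> \<noteq> {#} \<Longrightarrow> \<not> \<alpha> dvd \<Sum>\<^sub># \<sigma>"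
    and "size \<sigma> \<ge> 2 \<Longrightarrow> x \<in> X \<Longrightarrow> \<not> \<alpha> dvd (\<Sum>\<^sub># \<sigma> - x)"
  using assms unfolding reduced_def by blast+

lemma reduced_subset: "reduced M \<Longrightarrow> \<sigma> \<subseteq># M \<Longrightarrow> reduced \<sigma>"
  unfolding reduced_def by (meson order_trans set_mset_mono subset_mset.order_trans)

section \<open>Prefix sums of reduced lists modulo \<alpha>\<close>

definition prefix_residue :: "int list \<Rightarrow> nat \<Rightarrow> int"
  where "prefix_residue xs i = sum_list (take i xs) mod \<alpha>"

lemma mset_take_subset: "mset (take i xs) \<subseteq># mset xs"
  by (metis append_take_drop_id mset_append mset_subset_eq_add_left)

text \<open>Two prefix sums differ by the sum of a nonempty block, which \<alpha> does not
  divide.\<close>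

lemma prefix_residue_inj:
  assumes "reduced (mset xs)"
  shows "inj_on (prefix_residue xs) {..length xs}"
proof (rule linorder_inj_onI)
  fix i k assume ik: "i < k" "i \<in> {..length xs}" "k \<in> {..length xs}"
  define \<sigma> where "\<sigma> = mset (drop i (take k xs))"
  have eq: "take k xs = take i xs @ drop i (take k xs)"
    using ik by (metis append_take_drop_id less_imp_le min.absorb1 take_take)
  have "\<sigma> \<subseteq># mset xs"
    unfolding \<sigma>_def
    by (metis eq mset_append mset_subset_eq_add_right mset_take_subset subset_mset.order_trans)
  moreover have "\<sigma> \<noteq> {#}"
    using ik by (simp add: \<sigma>_def)
  ultimately have "\<not> \<alpha> dvd \<Sum>\<^sub># \<sigma>"
    using assms reducedD(1) by blast
  moreover have "sum_list (take k xs) = sum_list (take i xs) + \<Sum>\<^sub># \<sigma>"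
    using arg_cong[OF eq, of sum_list] by (simp add: \<sigma>_def sum_mset_sum_list)
  ultimately show "prefix_residue xs i \<noteq> prefix_residue xs k"
    unfolding prefix_residue_def by (metis add_diff_cancel_left' mod_eq_dvd_iff)
qed auto

text \<open>A prefix is itself a part of the multiset. Length 1 must be excluded, as that prefix sum
  is an element of \<open>X\<close>.\<close>

lemma prefix_residue_notin:
  assumes "reduced (mset xs)" "2 \<le> i" "i \<le> length xs"
  shows "prefix_residue xs i \<notin> insert 0 X"
proof -
  let ?\<sigma> = "mset (take i xs)"
  have s: "?\<sigma> \<subseteq># mset xs" "size ?\<sigma> = i"
    using assms by (auto simp: mset_take_subset)
  moreover have "?\<sigma> \<noteq> {#}"
    using s(2) assms(2) by auto
  ultimately have "\<not> \<alpha> dvd \<Sum>\<^sub># ?\<sigma>"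
    using reducedD(1)[OF assms(1)] by blast
  then have 1: "prefix_residue xs i \<noteq> 0"
    by (auto simp: prefix_residue_def sum_mset_sum_list)
  have "prefix_residue xs i \<noteq> x" if "x \<in> X" for x
  proof
    assume "prefix_residue xs i = x"
    then have "\<alpha> dvd (sum_list (take i xs) - x)"
      by (auto simp: prefix_residue_def)
    then show False
      using reducedD(2)[OF assms(1) s(1) _ that] s(2) assms(2) by (metis sum_mset_sum_list)
  qed
  with 1 show ?thesis by auto
qed

lemma prefix_residue_range: "prefix_residue xs i \<in> {0..<\<alpha>}"
  using \<alpha>_pos by (simp add: prefix_residue_def)

text \<open>The prefixes of length at least 2 give \<open>size M - 1\<close> residues disjoint from
  the \<open>card X + 1\<close> residues in \<open>insert 0 X\<close>, all within \<alpha>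
  residues.\<close>

lemma reduced_size:
  assumes "reduced M"
  shows "int (size M) \<le> \<alpha> - int (card X)"
proof (cases "size M \<le> 1")
  case True
  then show ?thesis using card_X_le by linarith
next
  case False
  obtain xs where xs: "mset xs = M"
    using ex_mset by blast
  let ?P = "prefix_residue xs ` {2..length xs}"
  have r: "reduced (mset xs)" using assms xs by simp
  have P: "card ?P = length xs - 1"
    using inj_on_subset[OF prefix_residue_inj[OF r], of "{2..length xs}"]
    by (subst card_image) auto
  have "insert 0 X \<union> ?P \<subseteq> {0..<\<alpha>}"
    using X_sub \<alpha>_pos prefix_residue_range by auto
  then have "card (insert 0 X \<union> ?P) \<le> nat \<alpha>"
    by (metis card_atLeastLessThan_int card_mono diff_zero finite_atLeastLessThan_int)
  moreover have "insert 0 X \<inter> ?P = {}"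
    using prefix_residue_notin[OF r] by force
  then have "card (insert 0 X \<union> ?P) = card (insert 0 X) + card ?P"
    by (intro card_Un_disjoint) (auto simp: finite_X)
  moreover have "card (insert 0 X) = card X + 1"
    using X_sub finite_X by (subst card_insert_disjoint) auto
  ultimately show ?thesis
    using P False xs by (auto simp flip: size_mset)
qed

text \<open>If \<open>z = (r, u)\<close> is a hole, \<open>z + e\<^sub>1 = S + k e\<^sub>2\<close> and \<open>z + e\<^sub>2 = T + l e\<^sub>1\<close> with \<open>S\<close>, \<open>T\<close> of least
  size. Two subsums \<open>\<sigma> \<subseteq> S\<close> and \<open>\<tau> \<subseteq> T\<close> which agree modulo \<open>\<alpha>\<close> can be exchanged, so the difference
  \<open>\<tau> - \<sigma> = x e\<^sub>1 + y e\<^sub>2\<close> has either \<open>x \<ge> 0 \<ge> y\<close> or \<open>x < -l\<close> and \<open>y > k\<close>. A pair of the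
  second kind with \<open>\<tau>\<close> minimal makes the prefix sums of \<open>S\<close> (beginning with \<open>\<sigma>\<close>) and of \<open>\<tau>\<close>
  pairwise incongruent.\<close>

lemma corner_hole_degree:
  assumes notin: "\<not> in_sumset r u" and in1: "in_sumset (r + 1) (u + \<alpha>)" and in2: "in_sumset (r + 1) u"
  shows "r + 1 \<le> \<alpha> - int (card X)"
proof -
  \<comment> \<open>In any expression z = N + i \<open>e\<^sub>1\<close> + j
    \<open>e\<^sub>2\<close> one of the integers i, j is negative. All contradictions with
    \<open>notin\<close> go through this fact.\<close>
  have hole: "i < 0 \<or> r - int (size N) - i < 0" if "set_mset N \<subseteq> X" "u = \<Sum>\<^sub># N + \<alpha> * i" for N i
    using in_sumsetI[OF that] notin by force
  \<comment> \<open>Representations of z + \<open>e\<^sub>1\<close> without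
    \<open>e\<^sub>1\<close>; cancelling an \<open>e\<^sub>1\<close> would represent z.
    \<open>T_ok\<close> below is the mirror image for \<open>e\<^sub>2\<close>.\<close>
  define S_ok where "S_ok S \<longleftrightarrow> set_mset S \<subseteq> X \<and> int (size S) \<le> r + 1 \<and> u + \<alpha> = \<Sum>\<^sub># S" for S
  have "\<exists>S. S_ok S"
  proof -
    obtain S i j where 1: "set_mset S \<subseteq> X" "i \<ge> 0" "j \<ge> 0"
      "r + 1 = int (size S) + i + j" "u + \<alpha> = \<Sum>\<^sub># S + \<alpha> * i"
      using in1 in_sumset_def by auto
    have "i - 1 < 0 \<or> r - int (size S) - (i - 1) < 0"
      using 1 by (intro hole) (auto simp: algebra_simps)
    with 1 have "i = 0" by auto
    with 1 show ?thesis unfolding S_ok_def by auto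
  qed
  then obtain S where S: "S_ok S" and S_min: "\<And>S'. S_ok S' \<Longrightarrow> size S \<le> size S'"
    using ex_has_least_nat[of S_ok _ size] by blast
  define k where "k = r + 1 - int (size S)"
  have SX: "set_mset S \<subseteq> X" and k: "k \<ge> 0" and Su: "\<Sum>\<^sub># S = u + \<alpha>"
    using S by (auto simp: S_ok_def k_def)
  define T_ok where "T_ok T \<longleftrightarrow> set_mset T \<subseteq> X \<and>
    int (size T) \<le> r + 1 \<and> u = \<Sum>\<^sub># T + \<alpha> * (r + 1 - int (size T))" for T
  have "\<exists>T. T_ok T"
  proof -
    obtain T i j where 1: "set_mset T \<subseteq> X" "i \<ge> 0" "j \<ge> 0"
      "r + 1 = int (size T) + i + j" "u = \<Sum>\<^sub># T + \<alpha> * i"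
      using in2 in_sumset_def by auto
    have "i < 0 \<or> r - int (size T) - i < 0"
      using 1 by (intro hole) auto
    with 1 have "j = 0" by auto
    with 1 show ?thesis unfolding T_ok_def by auto
  qed
  then obtain T where T: "T_ok T" and T_min: "\<And>T'. T_ok T' \<Longrightarrow> size T \<le> size T'"
    using ex_has_least_nat[of T_ok _ size] by blast
  define l where "l = r + 1 - int (size T)"
  have TX: "set_mset T \<subseteq> X" and l: "l \<ge> 0" and Tu: "\<Sum>\<^sub># T = u - \<alpha> * l"
    using T by (auto simp: T_ok_def l_def)

  have sub_sum: "\<Sum>\<^sub># (M - \<sigma>) = \<Sum>\<^sub># M - \<Sum>\<^sub># \<sigma>" "int (size (M - \<sigma>)) = int (size M) - int (size \<sigma>)"
    "set_mset (M - \<sigma>) \<subseteq> set_mset M" if "\<sigma> \<subseteq># M" for M \<sigma> :: "int multiset"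
    using that by (auto simp: sum_mset_diff size_Diff_submset size_mset_mono of_nat_diff dest: in_diffD)

  \<comment> \<open>Here \<sigma> = t \<open>e\<^sub>1\<close> + (size \<sigma> - t)
    \<open>e\<^sub>2\<close>, and both corners really occur.\<close>
  have zero_sum: "0 < t" "t < int (size \<sigma>)"
    if "set_mset \<sigma> \<subseteq> X" "\<sigma> \<noteq> {#}" "\<Sum>\<^sub># \<sigma> = \<alpha> * t" for \<sigma> t
  proof -
    have sz: "int (size \<sigma>) \<ge> 1"
      using that by (simp add: Suc_le_eq nonempty_has_size)
    have "0 < \<alpha> * t" using sum_mset_bounds[OF that(1)] sz that(3) by linarith
    then show "0 < t" using \<alpha>_pos by (simp add: zero_less_mult_iff)
    have "\<alpha> * t < \<alpha> * int (size \<sigma>)"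
      using sum_mset_bounds[OF that(1)] sz that(3) by (auto simp: algebra_simps)
    then show "t < int (size \<sigma>)" using \<alpha>_pos by simp
  qed
  \<comment> \<open>Here \<sigma> = x + t \<open>e\<^sub>1\<close> + (size \<sigma> - 1 - t)
    \<open>e\<^sub>2\<close> with nonnegative counts.\<close>
  have point_sum: "0 \<le> t" "t < int (size \<sigma>)"
    if "set_mset \<sigma> \<subseteq> X" "size \<sigma> \<ge> 2" "x \<in> X" "\<Sum>\<^sub># \<sigma> = x + \<alpha> * t" for \<sigma> x t
  proof -
    have x: "0 < x" "x < \<alpha>" using that X_sub by auto
    have "0 < x + \<alpha> * t" using sum_mset_bounds[OF that(1)] that(2,4) by linarith
    then have "0 < \<alpha> * (1 + t)" using x by (auto simp: algebra_simps)
    then show "0 \<le> t" using \<alpha>_pos by (simp add: zero_less_mult_iff)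
    have "\<alpha> * t < \<alpha> * int (size \<sigma>)"
      using sum_mset_bounds(2)[OF that(1)] x that(4) unfolding left_diff_distrib by linarith
    then show "t < int (size \<sigma>)" using \<alpha>_pos by simp
  qed

  \<comment> \<open>A trade inside S that produces an \<open>e\<^sub>1\<close> lets it cancel and
    represents z. The only trade producing none has t = 0, and it shortens S.\<close>
  have S_red: "reduced S"
    unfolding reduced_def
  proof (intro conjI allI impI SX notI)
    fix \<sigma> assume \<sigma>: "\<sigma> \<subseteq># S" "\<sigma> \<noteq> {#}" "\<alpha> dvd \<Sum>\<^sub># \<sigma>"
    then obtain t where t: "\<Sum>\<^sub># \<sigma> = \<alpha> * t" by auto
    have \<sigma>X: "set_mset \<sigma> \<subseteq> X" using \<sigma>(1) SX by (meson order_trans set_mset_mono)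
    show False
      using hole[of "S - \<sigma>" "t - 1"] zero_sum[OF \<sigma>X \<sigma>(2) t] sub_sum[OF \<sigma>(1)] SX Su k t
      unfolding k_def by (auto simp: algebra_simps)
  next
    fix \<sigma> x assume \<sigma>: "\<sigma> \<subseteq># S" "2 \<le> size \<sigma>" "x \<in> X" "\<alpha> dvd (\<Sum>\<^sub># \<sigma> - x)"
    obtain t where t: "\<Sum>\<^sub># \<sigma> = x + \<alpha> * t" using dvd_diffE[OF \<sigma>(4)] by blast
    have \<sigma>X: "set_mset \<sigma> \<subseteq> X" using \<sigma>(1) SX by (meson order_trans set_mset_mono)
    note ps = point_sum[OF \<sigma>X \<sigma>(2,3) t]
    let ?N = "add_mset x (S - \<sigma>)"
    have NX: "set_mset ?N \<subseteq> X" using sub_sum(3)[OF \<sigma>(1)] SX \<sigma>(3) by auto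
    show False
    proof (cases "t \<ge> 1")
      case True
      then show False
        using hole[OF NX, of "t - 1"] ps sub_sum[OF \<sigma>(1)] Su k t
        unfolding k_def by (auto simp: algebra_simps)
    next
      case False
      then have "t = 0" using ps by auto
      then have "S_ok ?N"
        using NX sub_sum[OF \<sigma>(1)] t Su k \<sigma>(2) unfolding S_ok_def k_def by auto
      from S_min[OF this] show False
        using sub_sum(2)[OF \<sigma>(1)] \<sigma>(2) by auto
    qed
  qed
  \<comment> \<open>Now the trade must produce an \<open>e\<^sub>2\<close>. It fails to do so only
    for t = size \<sigma> - 1, and then T gets shorter.\<close>
  have T_red: "reduced T"
    unfolding reduced_def
  proof (intro conjI allI impI TX notI)
    fix \<sigma> assume \<sigma>: "\<sigma> \<subseteq># T" "\<sigma> \<noteq> {#}" "\<alpha> dvd \<Sum>\<^sub># \<sigma>"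
    then obtain t where t: "\<Sum>\<^sub># \<sigma> = \<alpha> * t" by auto
    have \<sigma>X: "set_mset \<sigma> \<subseteq> X" using \<sigma>(1) TX by (meson order_trans set_mset_mono)
    show False
      using hole[of "T - \<sigma>" "t + l"] zero_sum[OF \<sigma>X \<sigma>(2) t] sub_sum[OF \<sigma>(1)] TX Tu l t
      unfolding l_def by (auto simp: algebra_simps)
  next
    fix \<sigma> x assume \<sigma>: "\<sigma> \<subseteq># T" "2 \<le> size \<sigma>" "x \<in> X" "\<alpha> dvd (\<Sum>\<^sub># \<sigma> - x)"
    obtain t where t: "\<Sum>\<^sub># \<sigma> = x + \<alpha> * t" using dvd_diffE[OF \<sigma>(4)] by blast
    have \<sigma>X: "set_mset \<sigma> \<subseteq> X" using \<sigma>(1) TX by (meson order_trans set_mset_mono)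
    note ps = point_sum[OF \<sigma>X \<sigma>(2,3) t]
    let ?N = "add_mset x (T - \<sigma>)"
    have NX: "set_mset ?N \<subseteq> X" using sub_sum(3)[OF \<sigma>(1)] TX \<sigma>(3) by auto
    have Nu: "u = \<Sum>\<^sub># ?N + \<alpha> * (t + l)"
      using sub_sum[OF \<sigma>(1)] Tu t by (auto simp: algebra_simps)
    show False
    proof (cases "t \<le> int (size \<sigma>) - 2")
      case True
      then show False
        using hole[OF NX Nu] ps sub_sum[OF \<sigma>(1)] l
        unfolding l_def by auto
    next
      case False
      then have "t + l = r + 1 - int (size ?N)"
        using ps sub_sum[OF \<sigma>(1)] unfolding l_def by auto
      with Nu have "u = \<Sum>\<^sub># ?N + \<alpha> * (r + 1 - int (size ?N))" by (simp only:)
      then have "T_ok ?N"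
        using NX sub_sum[OF \<sigma>(1)] l \<sigma>(2) unfolding T_ok_def l_def by auto
      from T_min[OF this] show False
        using sub_sum(2)[OF \<sigma>(1)] \<sigma>(2) by auto
    qed
  qed

  \<comment> \<open>Put y = size \<tau> - size \<sigma> - x. Replacing \<sigma> by \<tau> in S gives
    z = N + (-x - 1) \<open>e\<^sub>1\<close> + (k - y) \<open>e\<^sub>2\<close>. The first count is
    nonnegative because x < 0, so k - y < 0.\<close>
  have exchange: "int (size \<tau>) - int (size \<sigma>) - x \<ge> k + 1"
    if "\<sigma> \<subseteq># S" "\<tau> \<subseteq># T" "\<Sum>\<^sub># \<tau> = \<Sum>\<^sub># \<sigma> + \<alpha> * x" "x < 0" for \<sigma> \<tau> x
  proof (rule ccontr)
    assume *: "\<not> ?thesis"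
    define N where "N = (S - \<sigma>) + \<tau>"
    have "set_mset N \<subseteq> X"
      unfolding N_def set_mset_union
      using SX TX set_mset_mono[OF that(2)] sub_sum(3)[OF that(1)] by blast
    moreover have Nu: "\<Sum>\<^sub># N = u + \<alpha> + \<alpha> * x"
      and Ns: "int (size N) = int (size S) - int (size \<sigma>) + int (size \<tau>)"
      unfolding N_def sum_mset.union size_union of_nat_add sub_sum(1,2)[OF that(1)] Su that(3) by simp_all
    have "u = \<Sum>\<^sub># N + \<alpha> * (- x - 1)"
      unfolding Nu by (simp add: algebra_simps)
    ultimately have "- x - 1 < 0 \<or> r - int (size N) - (- x - 1) < 0"
      by (rule hole)
    then show False
      using * that(4) Ns unfolding k_def by linarith
  qed

  define far where "far n \<longleftrightarrow> (\<exists>\<sigma> \<tau> x. \<sigma> \<subseteq># S \<and> \<tau> \<subseteq># T \<and> \<Sum>\<^sub># \<tau> = \<Sum>\<^sub># \<sigma> + \<alpha> * x \<and> x < 0 \<and> size \<tau> = n)" for n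
  \<comment> \<open>The pair (S, T) itself qualifies, since the sums differ by -\<alpha> (l +
    1).\<close>
  have "far (size T)"
    unfolding far_def using Su Tu l
    by (intro exI[of _ S] exI[of _ T] exI[of _ "- l - 1"]) (auto simp: algebra_simps)
  then obtain t where t: "far t" and t_min: "\<And>n. far n \<Longrightarrow> t \<le> n"
    by (metis LeastI Least_le)
  obtain \<sigma> \<tau> x where st: "\<sigma> \<subseteq># S" "\<tau> \<subseteq># T" "\<Sum>\<^sub># \<tau> = \<Sum>\<^sub># \<sigma> + \<alpha> * x" "x < 0" "size \<tau> = t"
    using t far_def by auto
  have \<sigma>X: "set_mset \<sigma> \<subseteq> X" and \<tau>X: "set_mset \<tau> \<subseteq> X"
    using st SX TX by (meson order_trans set_mset_mono)+
  have "\<tau> \<noteq> {#}"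
  proof
    assume "\<tau> = {#}"
    then have "\<Sum>\<^sub># \<sigma> = \<alpha> * (- x)" using st(3) by auto
    moreover from this have "\<sigma> \<noteq> {#}" using st(4) \<alpha>_pos by auto
    ultimately show False using reducedD(1)[OF S_red st(1)] by (metis dvd_triv_left)
  qed
  then have "0 < \<Sum>\<^sub># \<tau>"
    using sum_mset_bounds(1)[OF \<tau>X] by (simp add: order_less_le_trans nonempty_has_size)
  moreover have "\<Sum>\<^sub># \<tau> \<le> \<alpha> * (int (size \<sigma>) + x)"
    using st(3) sum_mset_bounds(2)[OF \<sigma>X] by (simp add: algebra_simps)
  ultimately have pos: "int (size \<sigma>) + x \<ge> 1"
    using \<alpha>_pos by (smt (verit) mult_nonneg_nonpos)
  \<comment> \<open>size \<tau> = y + (size \<sigma> + x), where y \<ge> k + 1 by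
    \<open>exchange\<close> and the bracket is at least 1 by \<open>pos\<close>.\<close>
  then have t_ge: "int t \<ge> k + 2"
    using exchange[OF st(1-4)] st(5) by linarith

  obtain xs1 where xs1: "mset xs1 = \<sigma>" using ex_mset by blast
  obtain xs2 where xs2: "mset xs2 = S - \<sigma>" using ex_mset by blast
  obtain ys where ys: "mset ys = \<tau>" using ex_mset by blast
  define xs where "xs = xs1 @ xs2"
  have xs: "mset xs = S" using xs1 xs2 st(1) by (simp add: xs_def)
  have len: "length xs = size S" "length ys = t" "length xs1 = size \<sigma>"
    using xs ys xs1 st(5) by (auto simp flip: size_mset)
  have redx: "reduced (mset xs)" and redy: "reduced (mset ys)"
    using S_red T_red st(2) xs ys reduced_subset by auto
  \<comment> \<open>Minimality of t forces x0 \<ge> 0 for the shorter prefix of ys, so the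
    difference x - x0 of the remainders is still negative. If the prefix of xs lies within \<sigma>,
    the remainders form a \<open>far\<close> pair of size t - j < t. Otherwise it contains \<sigma>,
    and two nonnegative sums would add up to a negative number.\<close>
  have disj: "prefix_residue xs i \<noteq> prefix_residue ys j" if j: "1 \<le> j" "j < t" for i j
  proof
    assume eq: "prefix_residue xs i = prefix_residue ys j"
    let ?\<sigma> = "mset (take i xs)" and ?\<tau> = "mset (take j ys)"
    have sub: "?\<sigma> \<subseteq># S" "?\<tau> \<subseteq># \<tau>" "?\<tau> \<subseteq># T"
      using mset_take_subset[of i xs] mset_take_subset[of j ys] xs ys st(2)
      by (auto intro: subset_mset.order_trans)
    obtain x0 where x0: "\<Sum>\<^sub># ?\<tau> = \<Sum>\<^sub># ?\<sigma> + \<alpha> * x0"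
    proof -
      have "\<alpha> dvd (\<Sum>\<^sub># ?\<tau> - \<Sum>\<^sub># ?\<sigma>)"
        using eq unfolding prefix_residue_def sum_mset_sum_list by (metis mod_eq_dvd_iff)
      then show ?thesis using that by (rule dvd_diffE)
    qed
    have szj: "size ?\<tau> = j" using j len by simp
    have "\<not> far j" using t_min j by force
    then have "x0 \<ge> 0" unfolding far_def using sub x0 szj by (meson not_le)
    then have neg: "x - x0 < 0" using st(4) by linarith
    show False
    proof (cases "i \<le> length xs1")
      case True
      then have sub': "?\<sigma> \<subseteq># \<sigma>"
        using mset_take_subset[of i xs1] xs1 by (simp add: xs_def)
      have "far (t - j)"
        unfolding far_def using sub' sub st szj x0 neg
        by (intro exI[of _ "\<sigma> - ?\<sigma>"] exI[of _ "\<tau> - ?\<tau>"] exI[of _ "x - x0"])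
          (auto simp: sub_sum algebra_simps size_Diff_submset
            intro: subset_mset.order_trans[OF diff_subset_eq_self])
      then show False using t_min[of "t - j"] j by auto
    next
      case False
      then have "\<sigma> \<subseteq># ?\<sigma>" using xs1 by (simp add: xs_def)
      then have e: "\<Sum>\<^sub># (\<tau> - ?\<tau>) + \<Sum>\<^sub># (?\<sigma> - \<sigma>) = \<alpha> * (x - x0)"
        using sub x0 st(3) by (simp add: sub_sum algebra_simps)
      have "set_mset (\<tau> - ?\<tau>) \<subseteq> X" "set_mset (?\<sigma> - \<sigma>) \<subseteq> X"
        using \<tau>X SX sub(1) by (auto dest!: in_diffD dest: mset_subset_eqD)
      from this[THEN sum_mset_bounds(1)] have "\<Sum>\<^sub># (\<tau> - ?\<tau>) \<ge> 0" "\<Sum>\<^sub># (?\<sigma> - \<sigma>) \<ge> 0" by linarith+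
      moreover have "\<alpha> * (x - x0) < 0"
        using neg \<alpha>_pos by (simp add: mult_pos_neg)
      ultimately show False using e by linarith
    qed
  qed

  \<comment> \<open>The full prefix of ys is left out: \<tau> is congruent to \<sigma>, a prefix of
    xs. Length 1 is left out in both lists since it gives an element of \<open>X\<close>.\<close>
  let ?P = "prefix_residue xs ` {2..length xs}" and ?Q = "prefix_residue ys ` {2..<t}"
  have cP: "card ?P = size S - 1"
    using inj_on_subset[OF prefix_residue_inj[OF redx], of "{2..length xs}"] len
    by (subst card_image) auto
  have cQ: "card ?Q = t - 2"
  proof -
    have "inj_on (prefix_residue ys) {2..<t}"
      by (rule inj_on_subset[OF prefix_residue_inj[OF redy]]) (use len in auto)
    then show ?thesis by (simp add: card_image)
  qed
  have "insert 0 X \<union> ?P \<union> ?Q \<subseteq> {0..<\<alpha>}"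
    using X_sub \<alpha>_pos prefix_residue_range by auto
  then have "card (insert 0 X \<union> ?P \<union> ?Q) \<le> nat \<alpha>"
    by (metis card_atLeastLessThan_int card_mono diff_zero finite_atLeastLessThan_int)
  moreover have "(insert 0 X \<union> ?P) \<inter> ?Q = {}"
  proof -
    have "prefix_residue ys j \<notin> insert 0 X \<union> ?P" if "j \<in> {2..<t}" for j
    proof -
      have j: "2 \<le> j" "j \<le> length ys" "1 \<le> j" "j < t" using that len by auto
      show ?thesis
        using prefix_residue_notin[OF redy j(1,2)] disj[OF j(3,4)] by (metis UnE imageE)
    qed
    then show ?thesis by (intro equals0I) (metis IntE imageE)
  qed
  then have "card (insert 0 X \<union> ?P \<union> ?Q) = card (insert 0 X \<union> ?P) + card ?Q"
    by (intro card_Un_disjoint) (auto simp: finite_X)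
  moreover have "insert 0 X \<inter> ?P = {}"
    using prefix_residue_notin[OF redx] by force
  then have "card (insert 0 X \<union> ?P) = card (insert 0 X) + card ?P"
    by (intro card_Un_disjoint) (auto simp: finite_X)
  moreover have "card (insert 0 X) = card X + 1"
    using X_sub finite_X by (subst card_insert_disjoint) auto
  moreover have "size S \<ge> 1"
    using pos st(1,4) size_mset_mono by fastforce
  \<comment> \<open>The three sets have card X + 1, size S - 1 = r - k and t - 2 \<ge> k elements,
    in total at least r + 1 + card X.\<close>
  ultimately show ?thesis
    using cP cQ t_ge k \<alpha>_pos unfolding k_def by linarith
qed

text \<open>As long as z + \<open>e\<^sub>1\<close> or z + \<open>e\<^sub>2\<close> is missing, it
  is again a hole, with smaller k + l and larger degree. The walk ends at a corner hole, whose
  degree bound is inherited downwards.\<close>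

lemma hole_degree:
  assumes "\<not> in_sumset r u" "in_sumset (r + int k) (u + \<alpha> * int k)" "in_sumset (r + int l) u"
  shows "r + 1 \<le> \<alpha> - int (card X)"
  using assms
proof (induction "k + l" arbitrary: k l r u rule: less_induct)
  case less
  have "k \<noteq> 0" "l \<noteq> 0"
    using less.prems by (metis add.right_neutral mult_zero_right of_nat_0)+
  then obtain k' l' where kl: "k = Suc k'" "l = Suc l'"
    by (metis not0_implies_Suc)
  show ?case
  proof (cases "in_sumset (r + 1) (u + \<alpha>)")
    case False
    have "in_sumset ((r + 1) + int l) (u + \<alpha>)"
      using in_sumset_shift[OF less.prems(3), of 1 0] by (simp add: algebra_simps)
    then have "r + 1 + 1 \<le> \<alpha> - int (card X)"
      using less.prems(2) kl by (intro less.hyps[of k' l, OF _ False]) (auto simp: algebra_simps)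
    then show ?thesis by simp
  next
    case True
    show ?thesis
    proof (cases "in_sumset (r + 1) u")
      case False
      have "in_sumset ((r + 1) + int k) (u + \<alpha> * int k)"
        using in_sumset_shift[OF less.prems(2), of 0 1] by (simp add: algebra_simps)
      then have "r + 1 + 1 \<le> \<alpha> - int (card X)"
        using less.prems(3) kl by (intro less.hyps[of k l', OF _ False]) (auto simp: algebra_simps)
      then show ?thesis by simp
    qed (use corner_hole_degree less.prems(1) True in blast)
  qed
qed

text \<open>The residue condition yields points z + x \<open>e\<^sub>1\<close> + y
  \<open>e\<^sub>2\<close> of the sumset. The lexicographically least one is a sum of elements of
  \<open>X\<close> alone and reduced, so \<open>reduced_size\<close> bounds its degree r + x + y; x,
  y \<ge> 1 accounts for the 2.\<close>

lemma outer_hole_degree: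
  assumes residue: "in_sumset r' u'" "\<alpha> dvd (u' - u)"
    and no1: "\<And>k. \<not> in_sumset (r + int k) (u + \<alpha> * int k)" and no2: "\<And>l. \<not> in_sumset (r + int l) u"
  shows "r + 2 \<le> \<alpha> - int (card X)"
proof -
  \<comment> \<open>If x \<le> 0, adding -x copies of \<open>e\<^sub>1\<close> leads to z plus a
    multiple of \<open>e\<^sub>2\<close>, against \<open>no2\<close>; a nonpositive y contradicts
    \<open>no1\<close> likewise.\<close>
  have pos: "x \<ge> 1 \<and> y \<ge> 1" if "in_sumset (r + x + y) (u + \<alpha> * x)" for x y
  proof (rule ccontr)
    assume *: "\<not> ?thesis"
    show False
    proof (cases "x \<ge> 1")
      case True
      then have "in_sumset (r + int (nat x)) (u + \<alpha> * int (nat x))"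
        using in_sumset_shift[OF that, of 0 "- y"] * by auto
      then show False using no1 by blast
    next
      case False
      then have "in_sumset (r + y) u"
        using in_sumset_shift[OF that, of "- x" 0] by auto
      from in_sumset_shift[OF this, of 0 "\<bar>y\<bar> - y"] have "in_sumset (r + int (nat \<bar>y\<bar>)) u"
        by auto
      then show False using no2 by blast
    qed
  qed
  define ok where "ok = (\<lambda>(x, y). in_sumset (r + int x + int y) (u + \<alpha> * int x))"
  obtain p where "ok p"
  proof -
    obtain x where x: "u' = u + \<alpha> * x"
      using residue(2) by (rule dvd_diffE)
    then have "in_sumset (r + x + (r' - r - x)) (u + \<alpha> * x)"
      using residue(1) by simp
    with pos[OF this] have "ok (nat x, nat (r' - r - x))"
      by (auto simp: ok_def)
    then show ?thesis using that by blast
  qed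
  moreover have "wf (less_than <*lex*> less_than)"
    by auto
  ultimately obtain p where p: "ok p"
    and p_min: "\<And>q. (q, p) \<in> less_than <*lex*> less_than \<Longrightarrow> \<not> ok q"
    by (metis (no_types, lifting) mem_Collect_eq wfE_min)
  obtain x y where xy: "p = (x, y)" by fastforce
  have b: "in_sumset (r + int x + int y) (u + \<alpha> * int x)"
    using p xy by (simp add: ok_def)
  \<comment> \<open>Minimality over natural pairs extends to integer pairs, since \<open>pos\<close>
    makes all admissible pairs positive.\<close>
  have least: "int x \<le> x' \<and> (x' = int x \<longrightarrow> int y \<le> y')"
    if "in_sumset (r + x' + y') (u + \<alpha> * x')" for x' y'
    using p_min[of "(nat x', nat y')"] pos[OF that] that
    by (auto simp: ok_def xy intro!: leI; linarith)
  obtain M i j where M: "set_mset M \<subseteq> X" "i \<ge> 0" "j \<ge> 0"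
    "r + int x + int y = int (size M) + i + j" "u + \<alpha> * int x = \<Sum>\<^sub># M + \<alpha> * i"
    using b in_sumset_def by auto
  have least': "int x \<le> x' \<and> (x' = int x \<longrightarrow> int y \<le> int (size N) + i' - r - x')"
    if "set_mset N \<subseteq> X" "i' \<ge> 0" "u + \<alpha> * x' = \<Sum>\<^sub># N + \<alpha> * i'" for N i' x'
  proof (rule least)
    show "in_sumset (r + x' + (int (size N) + i' - r - x')) (u + \<alpha> * x')"
      by (rule in_sumsetI[OF that(1,3,2)]) auto
  qed
  \<comment> \<open>A copy of \<open>e\<^sub>1\<close> in the representation would lower x, and a
    copy of \<open>e\<^sub>2\<close> would lower y.\<close>
  have "i = 0"
    using least'[OF M(1), of 0 "int x - i"] M by (auto simp: algebra_simps)
  have "j = 0"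
    using least'[OF M(1), of 0 "int x"] M \<open>i = 0\<close> by (auto simp: algebra_simps)
  \<comment> \<open>The reason for the lexicographic order: a trade producing t > 0 copies of
    \<open>e\<^sub>1\<close> lowers x whatever becomes of y, and a trade with t = 0 lowers
    y.\<close>
  have "reduced M"
    unfolding reduced_def
  proof (intro conjI allI impI M(1) notI)
    fix \<sigma> assume \<sigma>: "\<sigma> \<subseteq># M" "\<sigma> \<noteq> {#}" "\<alpha> dvd \<Sum>\<^sub># \<sigma>"
    then obtain t where t: "\<Sum>\<^sub># \<sigma> = \<alpha> * t" by auto
    have "set_mset \<sigma> \<subseteq> X" using \<sigma>(1) M(1) by (meson order_trans set_mset_mono)
    from sum_mset_bounds(1)[OF this] have "0 < \<alpha> * t"
      using \<sigma>(2) t by (simp add: order_less_le_trans nonempty_has_size)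
    then have "t > 0" using \<alpha>_pos by (simp add: zero_less_mult_iff)
    moreover have "set_mset (M - \<sigma>) \<subseteq> X" using M(1) by (auto dest: in_diffD)
    ultimately show False
      using least'[of "M - \<sigma>" 0 "int x - t"] t M(5) \<open>i = 0\<close> \<sigma>(1)
      by (auto simp: sum_mset_diff algebra_simps)
  next
    fix \<sigma> a assume \<sigma>: "\<sigma> \<subseteq># M" "2 \<le> size \<sigma>" "a \<in> X" "\<alpha> dvd (\<Sum>\<^sub># \<sigma> - a)"
    obtain t where t: "\<Sum>\<^sub># \<sigma> = a + \<alpha> * t" using dvd_diffE[OF \<sigma>(4)] by blast
    have "set_mset \<sigma> \<subseteq> X" using \<sigma>(1) M(1) by (meson order_trans set_mset_mono)
    from sum_mset_bounds(1)[OF this] have "0 < \<alpha> * (1 + t)"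
      using t \<sigma>(2,3) X_sub by (auto simp: algebra_simps)
    then have t0: "t \<ge> 0" using \<alpha>_pos by (simp add: zero_less_mult_iff)
    have NX: "set_mset (add_mset a (M - \<sigma>)) \<subseteq> X" using M(1) \<sigma>(3) by (auto dest: in_diffD)
    have *: "int x \<le> int x - t \<and> (int x - t = int x \<longrightarrow>
        int y \<le> int (size (add_mset a (M - \<sigma>))) + 0 - r - (int x - t))"
      by (rule least'[OF NX]) (use t M(5) \<open>i = 0\<close> \<sigma>(1) in \<open>auto simp: sum_mset_diff algebra_simps\<close>)
    moreover have "int (size (M - \<sigma>)) = int (size M) - int (size \<sigma>)"
      using \<sigma>(1) by (simp add: size_Diff_submset size_mset_mono of_nat_diff)
    ultimately show False
      using t0 M(4) \<open>i = 0\<close> \<open>j = 0\<close> \<sigma>(2) by auto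
  qed
  from reduced_size[OF this] pos[OF b] show ?thesis
    using M(4) \<open>i = 0\<close> \<open>j = 0\<close> by auto
qed

end

section \<open>Residue classes and the growth of the Hilbert function\<close>

locale coprime_interior_points = interior_points +
  assumes X_coprime: "Gcd (insert \<alpha> X) = 1"
begin

text \<open>The attained residues form a submonoid of a finite cyclic group, hence a subgroup. It
  contains \<open>X\<close>, and so by Bezout the residue 1.\<close>

lemma in_sumset_residue: "\<exists>r' u'. in_sumset r' u' \<and> \<alpha> dvd (u' - u)"
proof -
  define H where "H = {h. \<exists>r u. in_sumset r u \<and> \<alpha> dvd (u - h)}"
  have H_mem: "h \<in> H" if "in_sumset r h" for r h
    unfolding H_def using that by force
  have H_add: "h + h' \<in> H" if h: "h \<in> H" "h' \<in> H" for h h'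
  proof -
    obtain r u where 1: "in_sumset r u" "\<alpha> dvd (u - h)"
      using h(1) by (auto simp: H_def)
    obtain r' u' where 2: "in_sumset r' u'" "\<alpha> dvd (u' - h')"
      using h(2) by (auto simp: H_def)
    from 1 2 have "in_sumset (r + r') (u + u')" "\<alpha> dvd ((u + u') - (h + h'))"
      using in_sumset_add dvd_add[of \<alpha> "u - h" "u' - h'"] by (auto simp: algebra_simps)
    then show ?thesis unfolding H_def by blast
  qed
  have H_cong: "h' \<in> H" if h: "h \<in> H" "\<alpha> dvd (h - h')" for h h'
  proof -
    obtain r u where "in_sumset r u" "\<alpha> dvd (u - h)"
      using h(1) by (auto simp: H_def)
    then show ?thesis
      unfolding H_def using dvd_add[of \<alpha> "u - h" "h - h'"] h(2) by auto
  qed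
  have H_nat: "int n * h \<in> H" if "h \<in> H" for n h
  proof (induction n)
    case 0
    then show ?case using H_mem[OF in_sumset_0] by simp
  next
    case (Suc n)
    then show ?case using H_add[OF that Suc] by (simp add: distrib_right)
  qed
  \<comment> \<open>Negative multiples are reached by reducing the factor modulo \<alpha>.\<close>
  have H_int: "k * h \<in> H" if "h \<in> H" for k h
  proof (rule H_cong)
    show "int (nat (k mod \<alpha>)) * h \<in> H" using H_nat that by blast
    have "\<alpha> dvd (k mod \<alpha> - k)" by (metis mod_eq_dvd_iff mod_mod_trivial)
    then have "\<alpha> dvd (k mod \<alpha> - k) * h" by (rule dvd_mult2)
    then show "\<alpha> dvd int (nat (k mod \<alpha>)) * h - k * h"
      using \<alpha>_pos by (simp add: algebra_simps)
  qed
  have Gcd_H: "finite Y \<Longrightarrow> Y \<subseteq> H \<Longrightarrow> Gcd Y \<in> H" for Y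
  proof (induction Y rule: finite_induct)
    case empty
    then show ?case using H_mem[OF in_sumset_0] by simp
  next
    case (insert y Y)
    obtain p q where "p * y + q * Gcd Y = gcd y (Gcd Y)"
      using bezout_int by blast
    then show ?case
      using H_add[OF H_int[of y p] H_int[of "Gcd Y" q]] insert by auto
  qed
  have "\<alpha> \<in> H"
    using H_mem[OF in_sumset_corner[of 1 0]] by simp
  moreover have "X \<subseteq> H"
  proof
    fix x assume "x \<in> X"
    then have "in_sumset 1 x" by (intro in_sumsetI[of "{#x#}" _ 0]) auto
    then show "x \<in> H" by (rule H_mem)
  qed
  ultimately have "1 \<in> H"
    using Gcd_H[of "insert \<alpha> X"] X_coprime finite_X by simp
  from H_int[OF this, of u] show ?thesis unfolding H_def by simp
qed

lemma finite_sumset: "finite {u. in_sumset r u}"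
proof (rule finite_subset)
  show "{u. in_sumset r u} \<subseteq> {0..\<alpha> * r}"
    using in_sumset_bounds by auto
qed auto

text \<open>For large r a point of degree r + 1 is either an \<open>e\<^sub>1\<close>-translate of a
  point of degree r or the point with the least first coordinate that its residue class ever
  attains. There are \<alpha> points of the second kind.\<close>

lemma card_sumset_step:
  "\<exists>R. \<forall>r\<ge>R. card {u. in_sumset (r + 1) u} = card {u. in_sumset r u} + nat \<alpha>"
proof -
  have "\<exists>n r. in_sumset r (j + \<alpha> * int n)" if "0 \<le> j" "j < \<alpha>" for j
  proof -
    obtain r u where 1: "in_sumset r u" "\<alpha> dvd (u - j)"
      using in_sumset_residue by blast
    from 1(2) obtain t where t: "u = j + \<alpha> * t" by (rule dvd_diffE)
    have "0 < \<alpha> * (1 + t)"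
      using in_sumset_bounds(1)[OF 1(1)] t that by (auto simp: algebra_simps)
    then have "t \<ge> 0" using \<alpha>_pos by (simp add: zero_less_mult_iff)
    then show ?thesis using 1(1) t by (metis nonneg_int_cases)
  qed
  then obtain n0 where n0: "\<And>j. j \<in> {0..<\<alpha>} \<Longrightarrow> \<exists>r. in_sumset r (j + \<alpha> * int (n0 j))"
    by (metis atLeastLessThan_iff)
  define m where "m j = (LEAST n. \<exists>r. in_sumset r (j + \<alpha> * int n))" for j
  have "\<exists>r. in_sumset r (j + \<alpha> * int (m j))" if "j \<in> {0..<\<alpha>}" for j
    unfolding m_def using n0[OF that] by (rule LeastI)
  then obtain \<rho> where m: "\<And>j. j \<in> {0..<\<alpha>} \<Longrightarrow> in_sumset (\<rho> j) (j + \<alpha> * int (m j))"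
    by metis
  have m_min: "m j \<le> n" if "in_sumset r (j + \<alpha> * int n)" for j n r
    unfolding m_def using that by (intro Least_le) blast
  \<comment> \<open>From degree \<alpha> on there are no holes, and from the degrees \<rho> j on the
    least point of every class is present.\<close>
  define R where "R = Max (insert \<alpha> (\<rho> ` {0..<\<alpha>}))"
  have R: "\<alpha> \<le> R" "\<And>j. j \<in> {0..<\<alpha>} \<Longrightarrow> \<rho> j \<le> R"
    unfolding R_def by (auto intro!: Max_ge simp del: Max_insert)
  have "card {u. in_sumset (r + 1) u} = card {u. in_sumset r u} + nat \<alpha>" if r: "r \<ge> R" for r
  proof -
    let ?e = "\<lambda>j. j + \<alpha> * int (m j)"
    have "{u. in_sumset (r + 1) u} = (\<lambda>u. u + \<alpha>) ` {u. in_sumset r u} \<union> ?e ` {0..<\<alpha>}" (is "?L = ?A \<union> ?E")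
    proof (intro equalityI subsetI)
      fix u assume "u \<in> ?A \<union> ?E"
      then show "u \<in> ?L"
      proof
        assume "u \<in> ?A"
        then show ?thesis using in_sumset_shift[of r _ 1 0] by auto
      next
        assume "u \<in> ?E"
        then obtain j where j: "j \<in> {0..<\<alpha>}" "u = ?e j" by auto
        then show ?thesis
          using in_sumset_shift[OF m[OF j(1)], of 0 "r + 1 - \<rho> j"] R(2)[OF j(1)] r by auto
      qed
    next
      fix u assume u: "u \<in> ?L"
      show "u \<in> ?A \<union> ?E"
      proof (cases "in_sumset r (u - \<alpha>)")
        case True
        then show ?thesis by (auto intro!: image_eqI[of _ _ "u - \<alpha>"])
      next
        case False
        define j n where "j = u mod \<alpha>" and "n = nat (u div \<alpha>)"
        have j: "j \<in> {0..<\<alpha>}" using \<alpha>_pos by (simp add: j_def)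
        have "u \<ge> 0" using u in_sumset_bounds by auto
        then have un: "u = j + \<alpha> * int n"
          using \<alpha>_pos by (simp add: j_def n_def pos_imp_zdiv_nonneg_iff)
        have "m j \<le> n" using m_min[of "r + 1" j n] u un by auto
        moreover have "\<not> m j < n"
        proof
          \<comment> \<open>Then (r, u - \<alpha>) is a hole: adding \<open>e\<^sub>1\<close> gives
            the given point, and adding copies of \<open>e\<^sub>2\<close> gives a translate of the
            least point of the class. Its degree is too large.\<close>
          assume less: "m j < n"
          define l where "l = \<rho> j + int n - 1 - int (m j)"
          have l: "l \<ge> 0" using in_sumset_bounds(3)[OF m[OF j]] less by (simp add: l_def)
          \<comment> \<open>The r copies of \<open>e\<^sub>2\<close> serve to write the degree as r
            + l with l \<ge> 0.\<close>
          have "in_sumset (\<rho> j + (int n - 1 - int (m j)) + r) (j + \<alpha> * int (m j) + \<alpha> * (int n - 1 - int (m j)))"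
            by (rule in_sumset_shift[OF m[OF j]]) (use less R(1) r \<alpha>_pos in auto)
          then have "in_sumset (r + int (nat l)) (u - \<alpha>)"
            using l un unfolding l_def by (simp add: algebra_simps)
          moreover have "in_sumset (r + int 1) ((u - \<alpha>) + \<alpha> * int 1)"
            using u by simp
          ultimately have "r + 1 \<le> \<alpha> - int (card X)"
            using hole_degree[OF False] by blast
          then show False using R(1) r by auto
        qed
        ultimately have "u = ?e j" using un by auto
        then show ?thesis using j by blast
      qed
    qed
    moreover have "?A \<inter> ?E = {}"
    proof -
      have False if j: "j \<in> {0..<\<alpha>}" and u: "in_sumset r u" and eq: "?e j = u + \<alpha>" for j u
      proof -
        have "m j \<noteq> 0" using in_sumset_bounds(1)[OF u] eq j by (intro notI) auto
        then have "u = j + \<alpha> * int (m j - 1)"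
          using eq by (cases "m j") (auto simp: algebra_simps)
        then show False using m_min[of r j "m j - 1"] u \<open>m j \<noteq> 0\<close> by auto
      qed
      then show ?thesis by fastforce
    qed
    ultimately have "card {u. in_sumset (r + 1) u} = card ?A + card ?E"
      by (simp add: card_Un_disjoint finite_sumset)
    moreover have "card ?A = card {u. in_sumset r u}"
      by (intro card_image) (auto simp: inj_on_def)
    moreover have "inj_on ?e {0..<\<alpha>}"
      by (rule inj_on_inverseI[of _ "\<lambda>u. u mod \<alpha>"]) auto
    then have "card ?E = nat \<alpha>" by (simp add: card_image)
    ultimately show ?thesis by simp
  qed
  then show ?thesis by blast
qed

lemma card_sumset_eventually_linear:
  "\<exists>q::int. \<forall>\<^sub>F r in sequentially. int (card {u. in_sumset (int r) u}) = \<alpha> * int r + q"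
proof -
  obtain R where R: "\<And>r. r \<ge> R \<Longrightarrow> card {u. in_sumset (r + 1) u} = card {u. in_sumset r u} + nat \<alpha>"
    using card_sumset_step by blast
  define q where "q = int (card {u. in_sumset (int (nat R)) u}) - \<alpha> * int (nat R)"
  have "int (card {u. in_sumset (int r) u}) = \<alpha> * int r + q" if "nat R \<le> r" for r
    using that
  proof (induction r rule: dec_induct)
    case base
    then show ?case by (simp add: q_def)
  next
    case (step r)
    then show ?case
      using R[of "int r"] \<alpha>_pos by (simp add: algebra_simps)
  qed
  then show ?thesis unfolding eventually_sequentially by blast
qed

end

section \<open>The semigroup algebra\<close>

lemma poly_mapping_sum_single:
  "p = (\<Sum>b\<in>Poly_Mapping.keys p. Poly_Mapping.single b (Poly_Mapping.lookup p b))"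
  by (rule poly_mapping_eqI)
    (simp add: lookup_sum lookup_single when_def in_keys_iff)

lemma mconst_times_mmonom: "mconst c * mmonom b = Poly_Mapping.single b (c :: 'k::field)"
  by (simp add: mconst_def mmonom_def mult_single)

lemma mmonom_add: "mmonom (b + b') = mmonom b * (mmonom b' :: 'k::field mpoly)"
  by (simp add: mmonom_def mult_single)

lemma mmonom_0: "mmonom 0 = (1 :: 'k::field mpoly)"
  by (simp add: mmonom_def)

lemma keys_add_nat:
  fixes b b' :: "'a \<Rightarrow>\<^sub>0 nat"
  shows "Poly_Mapping.keys (b + b') = Poly_Mapping.keys b \<union> Poly_Mapping.keys b'"
  by (auto simp: in_keys_iff lookup_add)

lemma semigroup_algebra_eq:
  assumes "0 \<in> B" and add: "\<And>b b'. b \<in> B \<Longrightarrow> b' \<in> B \<Longrightarrow> b + b' \<in> B"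
  shows "semigroup_algebra B = {p :: 'k::field mpoly. Poly_Mapping.keys p \<subseteq> B}"
proof (intro equalityI subsetI)
  fix p :: "'k mpoly" assume "p \<in> semigroup_algebra B"
  then have "p \<in> subalgebra_generated (mmonom ` B)" by (simp add: semigroup_algebra_def)
  then show "p \<in> {p. Poly_Mapping.keys p \<subseteq> B}"
  proof induction
    case (const c)
    then show ?case using assms(1) by (simp add: mconst_def)
  next
    case (gen p)
    then show ?case by (auto simp: mmonom_def)
  next
    case (add p q)
    then show ?case using keys_add[of p q] by auto
  next
    case (mult p q)
    then have "{b + b' |b b'. b \<in> Poly_Mapping.keys p \<and> b' \<in> Poly_Mapping.keys q} \<subseteq> B"
      using add by auto
    then show ?case using keys_mult[of p q] by auto
  qed
next
  fix p :: "'k mpoly" assume "p \<in> {p. Poly_Mapping.keys p \<subseteq> B}"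
  then have p: "Poly_Mapping.keys p \<subseteq> B" by simp
  have "(\<Sum>b\<in>S. Poly_Mapping.single b (Poly_Mapping.lookup p b)) \<in> subalgebra_generated (mmonom ` B)"
    if "finite S" "S \<subseteq> B" for S
    using that
  proof (induction S rule: finite_induct)
    case empty
    then show ?case using subalgebra_generated.const[of 0] by (simp add: mconst_def)
  next
    case (insert b S)
    have "mconst (Poly_Mapping.lookup p b) * mmonom b \<in> subalgebra_generated (mmonom ` B)"
      using insert.prems by (intro subalgebra_generated.intros) auto
    then show ?case
      using insert by (simp add: mconst_times_mmonom subalgebra_generated.add)
  qed
  from this[OF finite_keys p] show "p \<in> semigroup_algebra B"
    by (simp add: semigroup_algebra_def flip: poly_mapping_sum_single)
qed

lemma cring_subring_of:
  assumes "0 \<in> A" "1 \<in> A" "\<And>x y. x \<in> A \<Longrightarrow> y \<in> A \<Longrightarrow> x + y \<in> A"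
    "\<And>x. x \<in> A \<Longrightarrow> - x \<in> A" "\<And>x y. x \<in> A \<Longrightarrow> y \<in> A \<Longrightarrow> x * y \<in> A"
  shows "cring (subring_of A)"
proof (rule cringI)
  show "abelian_group (subring_of A)"
    by (rule abelian_groupI)
      (auto simp: subring_of_def assms algebra_simps intro!: bexI[of _ "- x" for x] assms)
  show "comm_monoid (subring_of A)"
    by (rule comm_monoidI) (auto simp: subring_of_def assms algebra_simps)
qed (auto simp: subring_of_def algebra_simps)

lemma split_keys:
  fixes p :: "'a \<Rightarrow>\<^sub>0 'b::comm_monoid_add"
  obtains p1 p2 where "p = p1 + p2" "Poly_Mapping.keys p1 = Poly_Mapping.keys p \<inter> F"
    "Poly_Mapping.keys p2 = Poly_Mapping.keys p - F"
proof -
  define q where "q S = (\<Sum>b\<in>Poly_Mapping.keys p \<inter> S. Poly_Mapping.single b (Poly_Mapping.lookup p b))" for S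
  have q: "Poly_Mapping.lookup (q S) b = (if b \<in> S then Poly_Mapping.lookup p b else 0)" for b S
    unfolding q_def by (auto simp: lookup_sum lookup_single when_def in_keys_iff)
  have "p = q F + q (- F)"
    by (rule poly_mapping_eqI) (simp add: q lookup_add)
  moreover have "Poly_Mapping.keys (q S) = Poly_Mapping.keys p \<inter> S" for S
    by (auto simp: in_keys_iff q split: if_splits)
  ultimately show ?thesis using that[of "q F" "q (- F)"] by auto
qed

section \<open>Face primes and the Krull dimension\<close>

text \<open>The coordinate face of the orthant on the first \<open>n\<close> axes. A sum lies in it
  only if both summands do, which is what makes the ideals below prime.\<close>

definition face :: "nat \<Rightarrow> (nat \<Rightarrow>\<^sub>0 nat) set"
  where "face n = {b. Poly_Mapping.keys b \<subseteq> {..<n}}"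

lemma add_in_face_iff: "b + b' \<in> face n \<longleftrightarrow> b \<in> face n \<and> b' \<in> face n"
  by (auto simp: face_def keys_add_nat)

text \<open>The face part of a product is the product of the face parts, and it vanishes only if a
  factor does, because polynomials over a field have no zero divisors.\<close>

lemma primeideal_face:
  fixes B :: "(nat \<Rightarrow>\<^sub>0 nat) set"
  assumes B: "0 \<in> B" "\<And>b b'. b \<in> B \<Longrightarrow> b' \<in> B \<Longrightarrow> b + b' \<in> B"
  shows "primeideal {p :: 'k::field mpoly. Poly_Mapping.keys p \<subseteq> B - face n}
    (subring_of {p. Poly_Mapping.keys p \<subseteq> B})" (is "primeideal ?P ?R")
proof -
  have mult: "Poly_Mapping.keys (p * q) \<subseteq> B"
    if "Poly_Mapping.keys p \<subseteq> B" "Poly_Mapping.keys q \<subseteq> B" for p q :: "'k mpoly"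
  proof -
    have "{b + b' |b b'. b \<in> Poly_Mapping.keys p \<and> b' \<in> Poly_Mapping.keys q} \<subseteq> B"
      using B(2) that by auto
    then show ?thesis using keys_mult[of p q] by auto
  qed
  have add: "Poly_Mapping.keys (p + q) \<subseteq> S"
    if "Poly_Mapping.keys p \<subseteq> S" "Poly_Mapping.keys q \<subseteq> S" for p q :: "'k mpoly" and S
    using keys_add[of p q] that by auto
  have uminus: "Poly_Mapping.keys (- p) = Poly_Mapping.keys p" for p :: "'k mpoly"
    by (auto simp: in_keys_iff)
  have outer: "Poly_Mapping.keys (p * q) \<inter> face n = {}" "Poly_Mapping.keys (q * p) \<inter> face n = {}"
    if "Poly_Mapping.keys p \<inter> face n = {}" for p q :: "'k mpoly"
  proof -
    show "Poly_Mapping.keys (p * q) \<inter> face n = {}"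
      using that by (auto simp: add_in_face_iff dest!: subsetD[OF keys_mult])
    then show "Poly_Mapping.keys (q * p) \<inter> face n = {}"
      by (simp add: mult.commute)
  qed
  interpret R: cring ?R
    by (rule cring_subring_of) (use B(1) in \<open>auto simp: mult add uminus dest: mult[THEN subsetD] add[THEN subsetD]\<close>)
  have "ideal ?P ?R"
  proof (rule idealI)
    show "ring ?R" by (rule R.ring_axioms)
    show "subgroup ?P (add_monoid ?R)"
    proof (rule group.subgroupI[OF R.a_group])
      show "?P \<subseteq> carrier (add_monoid ?R)" "?P \<noteq> {}"
        by (auto simp: subring_of_def intro!: exI[of _ 0])
      fix p assume p: "p \<in> ?P"
      have "\<ominus>\<^bsub>?R\<^esub> p = - p"
        using p uminus[of p] by (intro R.minus_equality) (auto simp: subring_of_def)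
      then show "inv\<^bsub>add_monoid ?R\<^esub> p \<in> ?P"
        using p uminus[of p] by (simp add: a_inv_def)
    next
      fix p q assume "p \<in> ?P" "q \<in> ?P"
      then show "p \<otimes>\<^bsub>add_monoid ?R\<^esub> q \<in> ?P"
        using add[of p "B - face n" q] by (simp add: subring_of_def)
    qed
  next
    fix p q :: "'k mpoly" assume "p \<in> ?P" "q \<in> carrier ?R"
    then have "Poly_Mapping.keys (q * p) \<subseteq> B - face n"
      using mult[of q p] outer(2)[of p q] by (auto simp: subring_of_def)
    then show "q \<otimes>\<^bsub>?R\<^esub> p \<in> ?P" "p \<otimes>\<^bsub>?R\<^esub> q \<in> ?P"
      by (auto simp: subring_of_def mult.commute)
  qed
  then show ?thesis
  proof (rule primeidealI[OF _ R.cring_axioms])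
    have "(1 :: 'k mpoly) \<in> carrier ?R" "(1 :: 'k mpoly) \<notin> ?P"
      using B(1) by (auto simp: subring_of_def face_def)
    then show "carrier ?R \<noteq> ?P" by metis
  next
    fix p q :: "'k mpoly"
    assume pq: "p \<in> carrier ?R" "q \<in> carrier ?R" "p \<otimes>\<^bsub>?R\<^esub> q \<in> ?P"
    obtain p1 p2 where p: "p = p1 + p2" "Poly_Mapping.keys p1 = Poly_Mapping.keys p \<inter> face n"
      "Poly_Mapping.keys p2 = Poly_Mapping.keys p - face n"
      by (rule split_keys)
    obtain q1 q2 where q: "q = q1 + q2" "Poly_Mapping.keys q1 = Poly_Mapping.keys q \<inter> face n"
      "Poly_Mapping.keys q2 = Poly_Mapping.keys q - face n"
      by (rule split_keys)
    \<comment> \<open>All terms on the right are supported off the face, whereas p1 and q1, and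
      hence their product, are supported on it.\<close>
    have "p1 * q1 = p * q + (- (p2 * q) - p1 * q2)"
      by (simp add: p(1) q(1) algebra_simps)
    also have "Poly_Mapping.keys \<dots> \<inter> face n = {}"
    proof -
      have "Poly_Mapping.keys (p * q) \<subseteq> - face n"
        using pq(3) by (auto simp: subring_of_def)
      moreover have "Poly_Mapping.keys (- (p2 * q)) \<subseteq> - face n" "Poly_Mapping.keys (- (p1 * q2)) \<subseteq> - face n"
        unfolding uminus using outer(1)[of p2 q] outer(2)[of q2 p1] p(3) q(3) by auto
      ultimately have "Poly_Mapping.keys (p * q + (- (p2 * q) + - (p1 * q2))) \<subseteq> - face n"
        by (intro add)
      then show ?thesis by auto
    qed
    finally have "Poly_Mapping.keys (p1 * q1) \<inter> face n = {}" .
    moreover have "Poly_Mapping.keys (p1 * q1) \<subseteq> face n"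
      using keys_mult[of p1 q1] p(2) q(2) by (auto simp: add_in_face_iff)
    ultimately have "Poly_Mapping.keys (p1 * q1) = {}" by blast
    then have "p1 * q1 = 0" by simp
    then have "p1 = 0 \<or> q1 = 0" by simp
    then have "Poly_Mapping.keys p \<inter> face n = {} \<or> Poly_Mapping.keys q \<inter> face n = {}"
      using p(2) q(2) by auto
    then show "p \<in> ?P \<or> q \<in> ?P"
      using pq(1,2) by (auto simp: subring_of_def)
  qed
qed

context homogeneous_simplicial_semigroup
begin

lemma zero_in_B: "0 \<in> B"
  by (simp add: B_eq submonoid_generated.zero)

lemma add_in_B: "b \<in> B \<Longrightarrow> b' \<in> B \<Longrightarrow> b + b' \<in> B"
  by (simp add: B_eq submonoid_generated.add)

lemma generator_in_B: "i < d + c \<Longrightarrow> generator d \<alpha> a i \<in> B"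
  by (auto simp: B_eq intro!: submonoid_generated.gen)

lemma semigroup_algebra_B: "semigroup_algebra B = {p :: 'k::field mpoly. Poly_Mapping.keys p \<subseteq> B}"
  by (rule semigroup_algebra_eq[OF zero_in_B add_in_B])

text \<open>The faces with 3, 2, 1, 0 axes give a strict chain of four primes; the generator on axis
  \<open>2 - l\<close> separates neighbours.\<close>

lemma krull_dim_ge_3:
  assumes "d \<ge> 3"
  shows "krull_dim (subring_of (semigroup_algebra B :: 'k::field mpoly set)) \<ge> 3"
proof -
  define P where "P l = {p :: 'k mpoly. Poly_Mapping.keys p \<subseteq> B - face (3 - l)}" for l
  have "primeideal (P l) (subring_of (semigroup_algebra B))" for l
    unfolding P_def semigroup_algebra_B by (rule primeideal_face[OF zero_in_B add_in_B])
  moreover have "P l \<subset> P (Suc l)" if "l < 3" for l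
  proof
    have "face (3 - Suc l) \<subseteq> face (3 - l)" by (auto simp: face_def)
    then show "P l \<subseteq> P (Suc l)" by (auto simp: P_def)
    let ?g = "Poly_Mapping.single (2 - l) \<alpha>"
    have "?g \<in> B"
    proof -
      have "2 - l < d" using assms by linarith
      then show ?thesis using generator_in_B[of "2 - l"] by (simp add: generator_def)
    qed
    moreover have "?g \<in> face (3 - l)" "?g \<notin> face (3 - Suc l)"
      using that \<alpha>_pos by (auto simp: face_def)
    ultimately have "mmonom ?g \<in> P (Suc l)" "mmonom ?g \<notin> P l"
      by (auto simp: P_def mmonom_def)
    then show "P l \<noteq> P (Suc l)" by blast
  qed
  ultimately have "enat 3 \<in> {enat l | l. \<exists>P. (\<forall>i\<le>l. primeideal (P i) (subring_of (semigroup_algebra B :: 'k mpoly set)))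
      \<and> (\<forall>i<l. P i \<subset> P (Suc i))}"
    by blast
  then have "enat 3 \<le> krull_dim (subring_of (semigroup_algebra B :: 'k mpoly set))"
    unfolding krull_dim_def by (rule Sup_upper)
  then show ?thesis by (simp add: numeral_eq_enat)
qed

text \<open>For d = 1 the set \<open>M_set 1 \<alpha>\<close> has a single element, but c \<ge> 1
  asks for two distinct generators.\<close>

lemma dim_eq_2:
  assumes "krull_dim (subring_of (semigroup_algebra B :: 'k::field mpoly set)) = 2"
  shows "d = 2"
proof -
  have "d < 3"
  proof (rule ccontr)
    assume "\<not> d < 3"
    then have "d \<ge> 3" by simp
    from krull_dim_ge_3[OF this, where ?'k = 'k] show False
      unfolding assms by simp
  qed
  moreover have "d \<noteq> 1"
  proof
    assume "d = 1"
    have *: "v = Poly_Mapping.single 0 \<alpha>" if "v \<in> M_set 1 \<alpha>" for v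
    proof -
      have v: "Poly_Mapping.keys v \<subseteq> {0}" "total_degree v = \<alpha>"
        using that by (auto simp: M_set_def)
      then have "total_degree v = Poly_Mapping.lookup v 0"
        unfolding total_degree_def
        by (subst sum.mono_neutral_left[of "{0}"]) (auto simp: in_keys_iff)
      then show ?thesis
        using v by (intro poly_mapping_eqI) (auto simp: lookup_single when_def in_keys_iff)
    qed
    have "generator d \<alpha> a 0 = generator d \<alpha> a 1"
      using *[of "generator d \<alpha> a 0"] *[of "generator d \<alpha> a 1"] generator_in_M[of 0]
        generator_in_M[of 1] c_pos \<open>d = 1\<close> by simp
    then show False
      using inj_onD[OF generators_distinct, of 0 1] c_pos d_pos by simp
  qed
  ultimately show ?thesis using d_pos by linarith
qed

end

section \<open>Dimensions of spaces of monomials and the Hilbert polynomial\<close>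

lemma vector_space_mscale: "vector_space (mscale :: 'k::field \<Rightarrow> 'k mpoly \<Rightarrow> 'k mpoly)"
  by unfold_locales
    (simp_all add: mscale_def mconst_def algebra_simps single_add mult_single flip: mult.assoc)

lemma lookup_mscale: "Poly_Mapping.lookup (mscale c p) b = c * Poly_Mapping.lookup p b"
  unfolding mscale_def mconst_def mult_map_scale_conv_mult[symmetric]
  by (simp add: Poly_Mapping.map.rep_eq when_def)

lemma dim_monomials:
  assumes "finite S"
  shows "vector_space.dim mscale {p :: 'k::field mpoly. Poly_Mapping.keys p \<subseteq> S} = card S"
proof -
  interpret vector_space "mscale :: 'k \<Rightarrow> 'k mpoly \<Rightarrow> 'k mpoly"
    by (rule vector_space_mscale)
  have inj: "inj (mmonom :: _ \<Rightarrow> 'k mpoly)"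
    unfolding mmonom_def by (metis (no_types, lifting) injI keys_single singleton_insert_inj_eq zero_neq_one)
  show ?thesis
  proof (rule dim_unique[of "mmonom ` S"])
    show "mmonom ` S \<subseteq> {p :: 'k mpoly. Poly_Mapping.keys p \<subseteq> S}"
      by (auto simp: mmonom_def)
    show "{p :: 'k mpoly. Poly_Mapping.keys p \<subseteq> S} \<subseteq> span (mmonom ` S)"
    proof
      fix p :: "'k mpoly" assume "p \<in> {p. Poly_Mapping.keys p \<subseteq> S}"
      then have "(\<Sum>b\<in>Poly_Mapping.keys p. mscale (Poly_Mapping.lookup p b) (mmonom b)) \<in> span (mmonom ` S)"
        by (intro span_sum span_scale span_base) auto
      then show "p \<in> span (mmonom ` S)"
        using poly_mapping_sum_single[of p] by (simp add: mscale_def mconst_times_mmonom)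
    qed
    show "independent (mmonom ` S :: 'k mpoly set)"
    proof (rule independent_if_scalars_zero)
      fix f :: "'k mpoly \<Rightarrow> 'k" and m :: "'k mpoly"
      assume 0: "(\<Sum>x\<in>mmonom ` S. mscale (f x) x) = 0" and "m \<in> mmonom ` S"
      then obtain b where b: "b \<in> S" "m = mmonom b" by auto
      have "(\<Sum>b\<in>S. mscale (f (mmonom b)) (mmonom b)) = 0"
        using 0 inj by (simp add: sum.reindex inj_on_subset)
      then have "0 = Poly_Mapping.lookup (\<Sum>b\<in>S. mscale (f (mmonom b)) (mmonom b)) b"
        by simp
      also have "\<dots> = f m"
        using b assms by (simp add: lookup_sum lookup_mscale mmonom_def lookup_single when_def if_distrib cong: if_cong)
      finally show "f m = 0" by simp
    qed (use assms in auto)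
    show "card (mmonom ` S :: 'k mpoly set) = card S"
      using inj by (simp add: card_image inj_on_subset)
  qed
qed

text \<open>Two candidates agree at infinitely many integers, so the definite description has a
  unique witness.\<close>

lemma hilbert_polynomial_eqI:
  assumes "\<forall>\<^sub>F r in sequentially. poly h (real r) = real (vector_space.dim mscale (G (int r)))"
  shows "hilbert_polynomial G = h"
  unfolding hilbert_polynomial_def
proof (rule the_equality)
  fix h' assume "\<forall>\<^sub>F r in sequentially. poly h' (real r) = real (vector_space.dim mscale (G (int r)))"
  with assms have "\<forall>\<^sub>F r in sequentially. poly (h' - h) (real r) = 0"
    by eventually_elim simp
  then obtain N where N: "\<And>r. r \<ge> N \<Longrightarrow> poly (h' - h) (real r) = 0"
    by (auto simp: eventually_sequentially)
  then have "real ` {N..} \<subseteq> {x. poly (h' - h) x = 0}" by auto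
  moreover have "infinite (real ` {N..})"
    by (subst finite_image_iff) (auto simp: infinite_Ici)
  ultimately have "infinite {x. poly (h' - h) x = 0}"
    using finite_subset by blast
  then have "h' - h = 0" using poly_roots_finite by blast
  then show "h' = h" by simp
qed (rule assms)

section \<open>Plane semigroups\<close>

locale plane_semigroup = homogeneous_simplicial_semigroup 2 \<alpha> c a B for \<alpha> c a B
begin

text \<open>A point of \<open>B\<close> is determined by its degree and its first coordinate.\<close>

definition dg :: "(nat \<Rightarrow>\<^sub>0 nat) \<Rightarrow> int"
  where "dg b = int (total_degree b) div int \<alpha>"

definition fc :: "(nat \<Rightarrow>\<^sub>0 nat) \<Rightarrow> int"
  where "fc b = int (Poly_Mapping.lookup b 0)"

text \<open>Inverse of \<open>dg\<close> and \<open>fc\<close> on the cone 0 \<le> u \<le> \<alpha>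
  r. Outside the cone \<open>nat\<close> truncates, which is why bounds accompany it
  throughout.\<close>

definition point :: "int \<Rightarrow> int \<Rightarrow> (nat \<Rightarrow>\<^sub>0 nat)"
  where "point r u = Poly_Mapping.single 0 (nat u) + Poly_Mapping.single 1 (nat (int \<alpha> * r - u))"

definition X :: "int set"
  where "X = (\<lambda>i. fc (a i)) ` {..<c}"

lemma total_degree_plane:
  assumes "Poly_Mapping.keys b \<subseteq> {..<2}"
  shows "total_degree b = Poly_Mapping.lookup b 0 + Poly_Mapping.lookup b 1"
proof -
  have "total_degree b = (\<Sum>i\<in>{0,1}. Poly_Mapping.lookup b i)"
    unfolding total_degree_def using assms
    by (intro sum.mono_neutral_left) (auto simp: in_keys_iff)
  then show ?thesis by simp
qed

lemma keys_point: "Poly_Mapping.keys (point r u) \<subseteq> {..<2}"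
  by (auto simp: point_def keys_add_nat)

lemma lookup_point: "Poly_Mapping.lookup (point r u) 0 = nat u"
  "Poly_Mapping.lookup (point r u) 1 = nat (int \<alpha> * r - u)"
  by (auto simp: point_def lookup_add lookup_single)

lemma dg_point: "0 \<le> u \<Longrightarrow> u \<le> int \<alpha> * r \<Longrightarrow> dg (point r u) = r"
  using \<alpha>_pos by (simp add: dg_def total_degree_plane[OF keys_point] lookup_point del: One_nat_def)

lemma fc_point: "0 \<le> u \<Longrightarrow> fc (point r u) = u"
  by (simp add: fc_def lookup_point)

lemma point_eq:
  assumes "Poly_Mapping.keys b \<subseteq> {..<2}" "\<alpha> dvd total_degree b"
  shows "point (dg b) (fc b) = b" "0 \<le> fc b" "fc b \<le> int \<alpha> * dg b"
proof -
  have d: "int \<alpha> * dg b = int (Poly_Mapping.lookup b 0) + int (Poly_Mapping.lookup b 1)"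
  proof -
    have "int \<alpha> * dg b = int (total_degree b)" using assms(2) by (auto simp: dg_def)
    then show ?thesis using total_degree_plane[OF assms(1)] by simp
  qed
  show "point (dg b) (fc b) = b"
  proof (rule poly_mapping_eqI)
    fix i
    show "Poly_Mapping.lookup (point (dg b) (fc b)) i = Poly_Mapping.lookup b i"
    proof (cases "i < 2")
      case True
      then have "i = 0 \<or> i = 1" by auto
      then show ?thesis using d by (auto simp: lookup_point fc_def simp del: One_nat_def)
    next
      case False
      then have "i \<notin> Poly_Mapping.keys b" "i \<notin> Poly_Mapping.keys (point (dg b) (fc b))"
        using assms(1) keys_point[of "dg b" "fc b"] by auto
      then show ?thesis by (simp add: in_keys_iff)
    qed
  qed
  show "0 \<le> fc b" "fc b \<le> int \<alpha> * dg b" using d by (auto simp: fc_def)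
qed

lemma point_add:
  assumes "0 \<le> u" "u \<le> int \<alpha> * r" "0 \<le> u'" "u' \<le> int \<alpha> * r'"
  shows "point (r + r') (u + u') = point r u + point r' u'"
proof -
  have "nat (int \<alpha> * (r + r') - (u + u')) = nat (int \<alpha> * r - u) + nat (int \<alpha> * r' - u')"
    using assms by (simp add: algebra_simps flip: nat_add_distrib)
  then show ?thesis
    using assms by (simp add: point_def nat_add_distrib single_add add_ac)
qed

lemma generator_facts:
  assumes "i < 2 + c"
  shows "Poly_Mapping.keys (generator 2 \<alpha> a i) \<subseteq> {..<2}" "total_degree (generator 2 \<alpha> a i) = \<alpha>"
    "dg (generator 2 \<alpha> a i) = 1"
  using generator_in_M[OF assms] \<alpha>_pos by (auto simp: M_set_def dg_def)

lemma fc_generator: "fc (generator 2 \<alpha> a 0) = int \<alpha>" "fc (generator 2 \<alpha> a 1) = 0"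
  "fc (generator 2 \<alpha> a (2 + i)) = fc (a i)" "fc (generator 2 \<alpha> a (Suc (Suc i))) = fc (a i)"
  by (auto simp: generator_def fc_def lookup_single)

lemma generator_eq_point: "i < 2 + c \<Longrightarrow> generator 2 \<alpha> a i = point 1 (fc (generator 2 \<alpha> a i))"
  using point_eq(1)[of "generator 2 \<alpha> a i"] generator_facts by fastforce

lemma inj_fc: "inj_on (\<lambda>i. fc (generator 2 \<alpha> a i)) {..<2 + c}"
  using generators_distinct generator_eq_point by (metis (no_types, lifting) inj_on_def lessThan_iff)

lemma X_interior: "X \<subseteq> {0<..<int \<alpha>}"
proof
  fix x assume "x \<in> X"
  then obtain i where i: "i < c" "x = fc (generator 2 \<alpha> a (2 + i))"
    by (auto simp: X_def fc_generator)
  have "0 \<le> x" "x \<le> int \<alpha>"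
    using point_eq(2,3)[of "generator 2 \<alpha> a (2 + i)"] generator_facts[of "2 + i"] i by auto
  moreover have "x \<noteq> 0"
    using inj_onD[OF inj_fc, of "2 + i" 1] i fc_generator by auto
  moreover have "x \<noteq> int \<alpha>"
    using inj_onD[OF inj_fc, of "2 + i" 0] i fc_generator by auto
  ultimately show "x \<in> {0<..<int \<alpha>}" by auto
qed

lemma card_X: "card X = c"
proof -
  have "inj_on (\<lambda>i. fc (a i)) {..<c}"
  proof (rule inj_onI)
    fix i j assume "i \<in> {..<c}" "j \<in> {..<c}" "fc (a i) = fc (a j)"
    then show "i = j"
      using inj_onD[OF inj_fc, of "2 + i" "2 + j"] by (simp only: fc_generator) auto
  qed
  then show ?thesis by (simp add: X_def card_image)
qed

text \<open>The coprimality assumption involves both coordinates. The second ones are \<alpha> minus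
  the first ones, so a common divisor of \<alpha> and \<open>X\<close> divides all of them.\<close>

lemma X_coprime: "Gcd (insert (int \<alpha>) X) = 1"
proof -
  let ?g = "Gcd (insert (int \<alpha>) X)"
  have "nat ?g dvd n" if n: "n \<in> {Poly_Mapping.lookup (a i) j | i j. i < c \<and> j < 2}" for n
  proof -
    obtain i j where ij: "i < c" "j < 2" "n = Poly_Mapping.lookup (a i) j" using n by auto
    have g: "?g dvd int \<alpha>" "?g dvd fc (a i)"
      using ij(1) by (auto simp: X_def intro!: Gcd_dvd simp del: Gcd_insert)
    have "Poly_Mapping.keys (a i) \<subseteq> {..<2}" "total_degree (a i) = \<alpha>"
      using generator_facts(1,2)[of "2 + i"] ij(1) by (auto simp: generator_def)
    then have "int (Poly_Mapping.lookup (a i) 1) = int \<alpha> - fc (a i)"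
      using total_degree_plane[of "a i"] by (simp add: fc_def)
    then have "?g dvd int (Poly_Mapping.lookup (a i) 1)"
      using g by simp
    moreover have "j = 0 \<or> j = 1" using ij(2) by auto
    ultimately have "?g dvd int n" using g(2) ij(3) by (auto simp: fc_def)
    then show ?thesis by (simp add: nat_dvd_iff)
  qed
  then have "nat ?g dvd Gcd {Poly_Mapping.lookup (a i) j | i j. i < c \<and> j < 2}"
    by (rule Gcd_greatest)
  then have "nat ?g = 1" using coprime by simp
  then show ?thesis by simp
qed

sublocale coprime_interior_points "int \<alpha>" X
  by unfold_locales (use \<alpha>_pos X_interior X_coprime in auto)

lemma fc_generator_range:
  assumes "i < 2 + c"
  shows "in_sumset 1 (fc (generator 2 \<alpha> a i))"
proof -
  consider "i = 0" | "i = 1" | j where "j < c" "i = 2 + j"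
    using assms by (metis One_nat_def Suc_1 add_less_cancel_left less_2_cases_iff less_iff_Suc_add nat_le_iff_add not_less)
  then show ?thesis
  proof cases
    case 1
    then show ?thesis using in_sumset_corner[of 1 0] fc_generator by simp
  next
    case 2
    then show ?thesis using in_sumset_corner[of 0 1] fc_generator by simp
  next
    case 3
    then have "fc (generator 2 \<alpha> a i) \<in> X" by (auto simp: fc_generator X_def)
    then show ?thesis by (intro in_sumsetI[of "{#fc (generator 2 \<alpha> a i)#}" _ 0]) auto
  qed
qed

lemma B_facts:
  assumes "b \<in> B"
  shows "Poly_Mapping.keys b \<subseteq> {..<2} \<and> \<alpha> dvd total_degree b \<and> in_sumset (dg b) (fc b)"
proof -
  have "b \<in> submonoid_generated (generator 2 \<alpha> a ` {..<2 + c})" using assms B_eq by simp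
  then show ?thesis
  proof induction
    case zero
    then show ?case using in_sumset_0 by (simp add: dg_def fc_def total_degree_def)
  next
    case (gen b)
    then obtain i where i: "i < 2 + c" "b = generator 2 \<alpha> a i" by auto
    show ?case
      using generator_facts[OF i(1)] fc_generator_range[OF i(1)] i(2) by auto
  next
    case (add b b')
    then have k: "Poly_Mapping.keys (b + b') \<subseteq> {..<2}" by (auto simp: keys_add_nat)
    have t: "total_degree (b + b') = total_degree b + total_degree b'"
      using add total_degree_plane k by (simp add: lookup_add)
    then have "dg (b + b') = dg b + dg b'"
      using add by (auto simp: dg_def div_plus_div_distrib_dvd_left)
    moreover have "fc (b + b') = fc b + fc b'" by (simp add: fc_def lookup_add)
    ultimately show ?case using add k t in_sumset_add by auto
  qed
qed

lemma B_point: "b \<in> B \<Longrightarrow> point (dg b) (fc b) = b"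
  using B_facts point_eq by blast

lemma B_sumset: "b \<in> B \<Longrightarrow> in_sumset (dg b) (fc b)"
  using B_facts by blast

lemma dg_add: "b \<in> B \<Longrightarrow> b' \<in> B \<Longrightarrow> dg (b + b') = dg b + dg b'"
proof -
  assume b: "b \<in> B" "b' \<in> B"
  have "total_degree (b + b') = total_degree b + total_degree b'"
    using b[THEN B_facts] add_in_B[OF b, THEN B_facts] by (simp add: total_degree_plane lookup_add)
  then show ?thesis
    using b[THEN B_facts] by (auto simp: dg_def div_plus_div_distrib_dvd_left)
qed

lemma fc_add: "fc (b + b') = fc b + fc b'"
  by (simp add: fc_def lookup_add)

text \<open>Converse of \<open>B_facts\<close>. Sumset membership is carried through the inductions
  because additivity of \<open>point\<close> needs the bounds that it implies.\<close>

lemma point_in_B: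
  assumes "in_sumset r u"
  shows "point r u \<in> B"
proof -
  have step: "in_sumset (r + r') (u + u') \<and> point (r + r') (u + u') \<in> B"
    if "in_sumset r u \<and> point r u \<in> B" "in_sumset r' u' \<and> point r' u' \<in> B" for r u r' u'
    using that in_sumset_add add_in_B
    by (auto simp: point_add in_sumset_bounds)
  have gen: "in_sumset 1 (fc (generator 2 \<alpha> a i)) \<and> point 1 (fc (generator 2 \<alpha> a i)) \<in> B"
    if "i < 2 + c" for i
    using fc_generator_range[OF that] generator_in_B[OF that] generator_eq_point[OF that] by simp
  have zero: "in_sumset 0 0 \<and> point 0 0 \<in> B"
    using in_sumset_0 zero_in_B by (simp add: point_def)
  obtain M i j where M: "set_mset M \<subseteq> X" "i \<ge> 0" "j \<ge> 0"
    "r = int (size M) + i + j" "u = \<Sum>\<^sub># M + int \<alpha> * i"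
    using assms in_sumset_def by auto
  have 1: "in_sumset (int (size M)) (\<Sum>\<^sub># M) \<and> point (int (size M)) (\<Sum>\<^sub># M) \<in> B"
    using M(1)
  proof (induction M)
    case empty
    then show ?case using zero by simp
  next
    case (add x M)
    then obtain k where "k < c" "x = fc (generator 2 \<alpha> a (2 + k))" by (auto simp: X_def fc_generator)
    then have "in_sumset 1 x \<and> point 1 x \<in> B" using gen[of "2 + k"] by simp
    from step[OF this, of "int (size M)" "\<Sum>\<^sub># M"] add show ?case by (simp add: add.commute)
  qed
  have 2: "in_sumset (int k) (int \<alpha> * int k) \<and> point (int k) (int \<alpha> * int k) \<in> B" for k
  proof (induction k)
    case 0
    then show ?case using zero by simp
  next
    case (Suc k)
    from step[OF gen[of 0] this] show ?case
      unfolding fc_generator by (simp add: algebra_simps)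
  qed
  have 3: "in_sumset (int k) 0 \<and> point (int k) 0 \<in> B" for k
  proof (induction k)
    case 0
    then show ?case using zero by simp
  next
    case (Suc k)
    from step[OF gen[of 1] this] show ?case
      unfolding fc_generator by simp
  qed
  from step[OF step[OF 1 2[of "nat i"]] 3[of "nat j"]] show ?thesis
    using M by simp
qed

lemma dg_fc_point:
  assumes "in_sumset r u"
  shows "dg (point r u) = r" "fc (point r u) = u"
  using in_sumset_bounds[OF assms] dg_point fc_point by auto

lemma graded_part_eq:
  "graded_part \<alpha> B r = {p :: 'k::field mpoly. Poly_Mapping.keys p \<subseteq> {b \<in> B. dg b = r}}"
proof -
  have "real (total_degree b) / real \<alpha> = real_of_int r \<longleftrightarrow> dg b = r" if "b \<in> B" for b
  proof -
    have "real (total_degree b) = real \<alpha> * real_of_int (dg b)"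
    proof -
      have "int (total_degree b) = int \<alpha> * dg b" using B_facts[OF that] by (auto simp: dg_def)
      then show ?thesis by (metis of_int_mult of_int_of_nat_eq)
    qed
    then show ?thesis using \<alpha>_pos by simp
  qed
  then show ?thesis by (auto simp: graded_part_def semigroup_algebra_B)
qed

lemma card_graded: "card {b \<in> B. dg b = r} = card {u. in_sumset r u}"
  and finite_graded: "finite {b \<in> B. dg b = r}"
proof -
  have eq: "{b \<in> B. dg b = r} = point r ` {u. in_sumset r u}"
    using B_sumset B_point point_in_B dg_fc_point by (force simp: image_iff)
  have "inj_on (point r) {u. in_sumset r u}"
    by (rule inj_on_inverseI[of _ fc]) (simp add: dg_fc_point)
  then show "card {b \<in> B. dg b = r} = card {u. in_sumset r u}"
    by (simp add: eq card_image)
  show "finite {b \<in> B. dg b = r}" by (simp add: eq finite_sumset)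
qed

lemma dim_graded_part:
  "vector_space.dim mscale (graded_part \<alpha> B r :: 'k::field mpoly set) = card {u. in_sumset r u}"
  by (simp add: graded_part_eq dim_monomials finite_graded card_graded)

text \<open>The Hilbert polynomial is linear with slope \<alpha>, and the factorial is 1.\<close>

lemma multiplicity_degree_eq: "multiplicity_degree 2 (graded_part \<alpha> B :: int \<Rightarrow> 'k::field mpoly set) = real \<alpha>"
proof -
  obtain q where q: "\<forall>\<^sub>F r in sequentially. int (card {u. in_sumset (int r) u}) = int \<alpha> * int r + q"
    using card_sumset_eventually_linear by blast
  have "hilbert_polynomial (graded_part \<alpha> B :: int \<Rightarrow> 'k mpoly set) = [:real_of_int q, real \<alpha>:]"
  proof (rule hilbert_polynomial_eqI)
    show "\<forall>\<^sub>F r in sequentially. poly [:real_of_int q, real \<alpha>:] (real r)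
        = real (vector_space.dim mscale (graded_part \<alpha> B (int r) :: 'k mpoly set))"
      using q
    proof eventually_elim
      case (elim r)
      then have "real (card {u. in_sumset (int r) u}) = real \<alpha> * real r + real_of_int q"
        by (metis of_int_add of_int_mult of_int_of_nat_eq)
      then show ?case by (simp add: dim_graded_part)
    qed
  qed
  then show ?thesis using \<alpha>_pos by (simp add: multiplicity_degree_def)
qed

lemma sumset_1: "{u. in_sumset 1 u} = insert 0 (insert (int \<alpha>) X)"
proof (intro equalityI subsetI)
  fix u assume "u \<in> {u. in_sumset 1 u}"
  then obtain M i j where M: "set_mset M \<subseteq> X" "i \<ge> 0" "j \<ge> 0"
    "1 = int (size M) + i + j" "u = \<Sum>\<^sub># M + int \<alpha> * i"
    using in_sumset_def by auto
  then consider "M = {#}" "i = 1" | "M = {#}" "i = 0" | "size M = 1" "i = 0"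
    by (cases "size M = 0") (auto, linarith+)
  then show "u \<in> insert 0 (insert (int \<alpha>) X)"
  proof cases
    case 3
    obtain x where "M = {#x#}" using size_1_singleton_mset[OF 3(1)] by blast
    then show ?thesis using M 3 by simp
  qed (use M in auto)
next
  fix u assume "u \<in> insert 0 (insert (int \<alpha>) X)"
  then show "u \<in> {u. in_sumset 1 u}"
    using in_sumset_corner[of 1 0] in_sumset_corner[of 0 1]
    by (auto intro!: in_sumsetI[of "{#u#}" _ 0])
qed

lemma codimension_eq:
  assumes "krull_dim R = 2"
  shows "codimension R (graded_part \<alpha> B :: int \<Rightarrow> 'k::field mpoly set) = ereal (real c)"
proof -
  have "card {u. in_sumset 1 u} = c + 2"
    unfolding sumset_1 using X_interior \<alpha>_pos finite_X card_X
    by (subst card_insert_disjoint) (auto simp: card_insert_if)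
  then show ?thesis
    by (simp add: codimension_def dim_graded_part assms numeral_eq_enat)
qed

end

section \<open>Localizations as spaces of Laurent polynomials\<close>

lemma lookup_mmonom_times:
  "Poly_Mapping.lookup (mmonom b * m) (b + x) = Poly_Mapping.lookup (m :: 'k::field mpoly) x"
proof -
  have "Poly_Mapping.lookup (mmonom b * m) (b + x)
      = Sum_any (\<lambda>l. (1 when b = l) * Sum_any (\<lambda>q. Poly_Mapping.lookup m q when b + x = l + q))"
    by (simp add: mmonom_def lookup_mult lookup_single)
  also have "\<dots> = Sum_any (\<lambda>q. Poly_Mapping.lookup m q when b + x = b + q)"
    by (simp add: when_mult)
  finally show ?thesis by simp
qed

lemma carrier_subring_of [simp]: "carrier (subring_of A) = A"
  and mult_subring_of [simp]: "x \<otimes>\<^bsub>subring_of A\<^esub> y = x * y"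
  and one_subring_of [simp]: "\<one>\<^bsub>subring_of A\<^esub> = 1"
  by (simp_all add: subring_of_def)

lemma cring_mpoly_ring: "cring (mpoly_ring n :: 'k::field mpoly ring)"
  unfolding mpoly_ring_def
proof (rule cring_subring_of)
  fix p q :: "'k mpoly"
  assume p: "p \<in> {p. \<forall>u\<in>Poly_Mapping.keys p. Poly_Mapping.keys u \<subseteq> {..<n}}"
    and q: "q \<in> {p. \<forall>u\<in>Poly_Mapping.keys p. Poly_Mapping.keys u \<subseteq> {..<n}}"
  show "p + q \<in> {p. \<forall>u\<in>Poly_Mapping.keys p. Poly_Mapping.keys u \<subseteq> {..<n}}"
    using p q by (auto dest!: subsetD[OF keys_add])
  show "p * q \<in> {p. \<forall>u\<in>Poly_Mapping.keys p. Poly_Mapping.keys u \<subseteq> {..<n}}"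
    using p q by (auto simp: keys_add_nat subset_iff dest!: subsetD[OF keys_mult])
  show "- p \<in> {p. \<forall>u\<in>Poly_Mapping.keys p. Poly_Mapping.keys u \<subseteq> {..<n}}"
    using p by (auto simp: in_keys_iff)
qed auto

lemma mult_mpoly_ring [simp]: "x \<otimes>\<^bsub>mpoly_ring n\<^esub> y = x * y"
  and one_mpoly_ring [simp]: "\<one>\<^bsub>mpoly_ring n\<^esub> = 1"
  by (simp_all add: mpoly_ring_def)

lemma pow_mpoly_ring: "f [^]\<^bsub>mpoly_ring n\<^esub> (k::nat) = (f :: 'k::field mpoly) ^ k"
  by (induction k) (simp_all add: nat_pow_def mult.commute)

lemma finprod_mvar:
  assumes "S \<subseteq> {..<n}"
  shows "finprod (mpoly_ring n) mvar S = (\<Prod>i\<in>S. mvar i :: 'k::field mpoly)"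
proof -
  interpret cring "mpoly_ring n :: 'k mpoly ring" by (rule cring_mpoly_ring)
  have "finite S" using assms finite_subset by blast
  then show ?thesis
    using assms
  proof (induction S rule: finite_induct)
    case (insert i S)
    have "mvar j \<in> carrier (mpoly_ring n :: 'k mpoly ring)" if "j < n" for j
      using that by (auto simp: mpoly_ring_def mvar_def mmonom_def)
    then show ?case using insert
      by (subst finprod_insert) auto
  qed simp
qed

lemma prod_mvar_pow:
  assumes "finite S"
  shows "(\<Prod>i\<in>S. mvar i :: 'k::field mpoly) ^ k = mmonom (\<Sum>i\<in>S. Poly_Mapping.single i k)"
  using assms
proof (induction S rule: finite_induct)
  case (insert i S)
  have "(mvar i :: 'k mpoly) ^ k = mmonom (Poly_Mapping.single i k)"
  proof (induction k)
    case 0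
    then show ?case by (simp add: mmonom_0)
  next
    case (Suc k)
    have "Poly_Mapping.single i (Suc k) = Poly_Mapping.single i 1 + Poly_Mapping.single i k"
      by (simp flip: single_add)
    with Suc show ?case by (simp add: mvar_def mmonom_add)
  qed
  with insert show ?case by (simp add: power_mult_distrib mmonom_add)
qed (simp add: mmonom_0)

lemma mpoly_eval_prod_mvar_pow:
  assumes "finite S"
  shows "mpoly_eval g ((\<Prod>i\<in>S. mvar i :: 'k::field mpoly) ^ k) = (\<Prod>i\<in>S. g i ^ k)"
proof -
  define v where "v = (\<Sum>i\<in>S. Poly_Mapping.single i k)"
  have v: "Poly_Mapping.lookup v i = (if i \<in> S then k else 0)" for i
    using assms by (simp add: v_def lookup_sum lookup_single when_def)
  have "mpoly_eval g (mmonom v) = (\<Prod>i\<in>Poly_Mapping.keys v. g i ^ Poly_Mapping.lookup v i)"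
    by (simp add: mpoly_eval_def mmonom_def mconst_def)
  also have "\<dots> = (\<Prod>i\<in>S. g i ^ Poly_Mapping.lookup v i)"
    using assms by (intro prod.mono_neutral_left) (auto simp: in_keys_iff v split: if_splits)
  also have "\<dots> = (\<Prod>i\<in>S. g i ^ k)"
    by (intro prod.cong) (auto simp: v)
  finally show ?thesis by (simp add: v_def prod_mvar_pow[OF assms])
qed

context plane_semigroup
begin

abbreviation algebra :: "'k::field mpoly set"
  where "algebra \<equiv> {p. Poly_Mapping.keys p \<subseteq> B}"

abbreviation MB :: "('k::field mpoly, 'k mpoly) module"
  where "MB \<equiv> semigroup_module (generator 2 \<alpha> a) B"

definition nv :: nat
  where "nv = 2 + c"

abbreviation Rn :: "'k::field mpoly ring"
  where "Rn \<equiv> mpoly_ring nv"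

text \<open>The guard prevents aliasing: outside the cone, truncation in \<open>point\<close> would
  pick up the coefficient of an unrelated monomial.\<close>

definition cf :: "'k::field mpoly \<Rightarrow> int \<Rightarrow> int \<Rightarrow> 'k"
  where "cf m r u = (if 0 \<le> u \<and> u \<le> int \<alpha> * r then Poly_Mapping.lookup m (point r u) else 0)"

lemma cf_support:
  assumes "m \<in> algebra" "cf m r u \<noteq> 0"
  shows "in_sumset r u" "point r u \<in> Poly_Mapping.keys m"
proof -
  have *: "0 \<le> u" "u \<le> int \<alpha> * r" "point r u \<in> Poly_Mapping.keys m"
    using assms(2) by (auto simp: cf_def in_keys_iff split: if_splits)
  then show "point r u \<in> Poly_Mapping.keys m" by simp
  have "point r u \<in> B" using * assms(1) by auto
  from B_sumset[OF this] show "in_sumset r u" using * dg_point fc_point by simp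
qed

lemma lookup_eq_cf: "b \<in> B \<Longrightarrow> Poly_Mapping.lookup m b = cf m (dg b) (fc b)"
  using B_point in_sumset_bounds[OF B_sumset] by (simp add: cf_def)

lemma cf_inj:
  assumes "m \<in> algebra" "m' \<in> algebra" "cf m = cf m'"
  shows "m = m'"
proof (rule poly_mapping_eqI)
  fix b
  show "Poly_Mapping.lookup m b = Poly_Mapping.lookup m' b"
  proof (cases "b \<in> B")
    case True
    then show ?thesis using assms(3) by (simp add: lookup_eq_cf)
  next
    case False
    then have "b \<notin> Poly_Mapping.keys m" "b \<notin> Poly_Mapping.keys m'" using assms by auto
    then show ?thesis by (simp add: in_keys_iff)
  qed
qed

lemma cf_simps [simp]: "cf 0 r u = 0" "cf (m + m') r u = cf m r u + cf m' r u" "cf (- m) r u = - cf m r u"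
  by (auto simp: cf_def lookup_add)

lemma mult_in_algebra: "p \<in> algebra \<Longrightarrow> q \<in> algebra \<Longrightarrow> p * q \<in> algebra"
  using add_in_B by (auto dest!: subsetD[OF keys_mult])

lemma add_in_algebra: "p \<in> algebra \<Longrightarrow> q \<in> algebra \<Longrightarrow> p + q \<in> algebra"
  by (auto dest!: subsetD[OF keys_add])

lemma uminus_in_algebra: "p \<in> algebra \<Longrightarrow> - p \<in> algebra"
  by (auto simp: in_keys_iff)

text \<open>On coefficients a monomial acts as a shift of the plane. This is checked at points of b
  + \<open>B\<close>; a nonzero coefficient elsewhere, on either side, would lead back to such a
  point.\<close>

lemma cf_mmonom_times:
  assumes "b \<in> B" "m \<in> algebra"
  shows "cf (mmonom b * m) r u = cf m (r - dg b) (u - fc b)"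
proof -
  have mm: "mmonom b * m \<in> algebra"
    by (rule mult_in_algebra) (use assms in \<open>auto simp: mmonom_def\<close>)
  have shift: "cf (mmonom b * m) (dg b + dg x) (fc b + fc x) = cf m (dg x) (fc x)" if "x \<in> B" for x
    using lookup_eq_cf[OF that] lookup_eq_cf[OF add_in_B[OF assms(1) that]] lookup_mmonom_times
    by (metis assms(1) dg_add fc_add that)
  show ?thesis
  proof (cases "cf m (r - dg b) (u - fc b) = 0")
    case False
    let ?x = "point (r - dg b) (u - fc b)"
    have "in_sumset (r - dg b) (u - fc b)" using cf_support(1)[OF assms(2) False] .
    from shift[OF point_in_B[OF this]] show ?thesis
      by (simp add: dg_fc_point[OF \<open>in_sumset (r - dg b) (u - fc b)\<close>])
  next
    case True
    show ?thesis
    proof (rule ccontr)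
      assume "\<not> ?thesis"
      then have nz: "cf (mmonom b * m) r u \<noteq> 0" using True by simp
      note ru = cf_support[OF mm nz]
      obtain x where x: "x \<in> Poly_Mapping.keys m" "point r u = b + x"
        using ru(2) by (auto simp: mmonom_def dest!: subsetD[OF keys_mult])
      have xB: "x \<in> B" using x(1) assms(2) by auto
      have "r = dg b + dg x" "u = fc b + fc x"
        using dg_fc_point[OF ru(1)] x(2) dg_add[OF assms(1) xB] fc_add by auto
      then show False
        using True x(1) lookup_eq_cf[OF xB, of m] by (simp add: in_keys_iff)
    qed
  qed
qed

text \<open>With the degree \<open>card S\<close> this gives the exponent of the monomial that is
  inverted when localizing at \<open>S\<close>.\<close>

definition gs :: "nat set \<Rightarrow> int"
  where "gs S = (\<Sum>i\<in>S. fc (generator 2 \<alpha> a i))"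

definition act :: "nat set \<Rightarrow> nat \<Rightarrow> 'k::field mpoly \<Rightarrow> 'k mpoly"
  where "act S k m = (\<Prod>i\<in>S. mmonom (generator 2 \<alpha> a i) ^ k) * m"

lemma act_smult:
  assumes "S \<subseteq> {..<nv}"
  shows "((finprod Rn mvar S) [^]\<^bsub>Rn\<^esub> k) \<odot>\<^bsub>MB\<^esub> m = act S k m"
proof -
  have "finite S" using assms finite_subset by blast
  then show ?thesis
    by (simp add: finprod_mvar[OF assms] pow_mpoly_ring semigroup_module_def
        mpoly_eval_prod_mvar_pow act_def)
qed

lemma act_in_algebra_cf:
  fixes m :: "'k::field mpoly"
  assumes "S \<subseteq> {..<nv}" "m \<in> algebra"
  shows "act S k m \<in> algebra \<and>
    cf (act S k m) r u = cf m (r - int k * int (card S)) (u - int k * gs S)"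
proof -
  have one: "mmonom b ^ k * m \<in> algebra \<and> cf (mmonom b ^ k * m) r u = cf m (r - int k * dg b) (u - int k * fc b)"
    if "b \<in> B" "m \<in> algebra" for b and m :: "'k mpoly" and r u
    using that(2)
  proof (induction k arbitrary: r u)
    case (Suc k)
    have "mmonom b * (mmonom b ^ k * m) \<in> algebra"
      by (rule mult_in_algebra) (use Suc that in \<open>auto simp: mmonom_def\<close>)
    moreover have "cf (mmonom b * (mmonom b ^ k * m)) r u = cf m (r - int (Suc k) * dg b) (u - int (Suc k) * fc b)"
    proof -
      have "mmonom b ^ k * m \<in> algebra" using Suc by blast
      then have "cf (mmonom b * (mmonom b ^ k * m)) r u = cf (mmonom b ^ k * m) (r - dg b) (u - fc b)"
        by (rule cf_mmonom_times[OF that(1)])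
      also have "\<dots> = cf m (r - dg b - int k * dg b) (u - fc b - int k * fc b)"
        using Suc by blast
      finally show ?thesis by (simp add: distrib_right diff_diff_eq)
    qed
    ultimately show ?case by (simp add: mult.assoc)
  qed simp
  have "finite S" using assms(1) finite_subset by blast
  then show ?thesis
    using assms
  proof (induction S arbitrary: r u rule: finite_induct)
    case empty
    then show ?case by (simp add: act_def gs_def)
  next
    case (insert i S)
    have i: "generator 2 \<alpha> a i \<in> B" "dg (generator 2 \<alpha> a i) = 1"
      using insert.prems generator_in_B[of i] generator_facts[of i] by (auto simp: nv_def)
    have IH: "act S k m \<in> algebra"
      "\<And>r u. cf (act S k m) r u = cf m (r - int k * int (card S)) (u - int k * gs S)"
      using insert by auto
    have "act (insert i S) k m = mmonom (generator 2 \<alpha> a i) ^ k * act S k m"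
      using insert by (simp add: act_def mult.assoc)
    then show ?case
      using one[OF i(1) IH(1)] IH(2) i(2) insert.hyps by (simp add: gs_def algebra_simps)
  qed
qed

lemma act_in_algebra: "S \<subseteq> {..<nv} \<Longrightarrow> m \<in> algebra \<Longrightarrow> act S k m \<in> algebra"
  and cf_act: "S \<subseteq> {..<nv} \<Longrightarrow> m \<in> algebra \<Longrightarrow>
    cf (act S k m) r u = cf m (r - int k * int (card S)) (u - int k * gs S)"
  using act_in_algebra_cf by blast+

text \<open>The coefficient of the fraction \<open>m / x\<^sub>S\<^sup>k\<close> at the Laurent monomial of degree \<open>r\<close> and first
  coordinate \<open>u\<close>.\<close>

definition val :: "nat set \<Rightarrow> 'k::field mpoly \<times> nat \<Rightarrow> int \<Rightarrow> int \<Rightarrow> 'k"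
  where "val S p r u = cf (fst p) (r + int (snd p) * int (card S)) (u + int (snd p) * gs S)"

definition Loc :: "nat set \<Rightarrow> ('k::field mpoly, ('k mpoly \<times> nat) set) module"
  where "Loc S = cech_loc Rn MB mvar S"

definition fr :: "nat set \<Rightarrow> 'k::field mpoly \<Rightarrow> nat \<Rightarrow> ('k mpoly \<times> nat) set"
  where "fr S m k = frac Rn MB (finprod Rn mvar S) m k"

text \<open>The choice of a representative is harmless, as \<open>val\<close> is constant on each
  fraction.\<close>

definition coeff :: "nat set \<Rightarrow> ('k::field mpoly \<times> nat) set \<Rightarrow> int \<Rightarrow> int \<Rightarrow> 'k"
  where "coeff S Y = val S (SOME p. p \<in> Y)"

lemma carrier_MB: "carrier (MB :: ('k::field mpoly, 'k mpoly) module) = algebra"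
  by (simp add: semigroup_module_def semigroup_algebra_B)

lemma add_MB: "m \<oplus>\<^bsub>MB\<^esub> m' = m + m'"
  by (simp add: semigroup_module_def)

text \<open>Monomials act as injective shifts, so there is no torsion: the cross-multiplied equation
  holds for one \<open>j\<close> iff it holds for all, and it says that the Laurent expansions
  agree.\<close>

lemma loc_rel_iff:
  assumes "S \<subseteq> {..<nv}"
  shows "(p, q) \<in> loc_rel Rn MB (finprod Rn mvar S) \<longleftrightarrow>
    fst p \<in> algebra \<and> fst q \<in> algebra \<and> val S p = val S (q :: 'k::field mpoly \<times> nat)"
proof -
  obtain m k m' k' where pq: "p = (m, k)" "q = (m', k')" by fastforce
  have "act S (j + k') m = act S (j + k) m' \<longleftrightarrow> val S (m, k) = val S (m', k')"
    if m: "m \<in> algebra" "m' \<in> algebra" for j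
  proof
    assume eq: "act S (j + k') m = act S (j + k) m'"
    show "val S (m, k) = val S (m', k')"
    proof (intro ext)
      fix r u
      have "cf (act S (j + k') m) (r + int (j + k + k') * int (card S)) (u + int (j + k + k') * gs S)
          = cf (act S (j + k) m') (r + int (j + k + k') * int (card S)) (u + int (j + k + k') * gs S)"
        by (simp add: eq)
      then show "val S (m, k) r u = val S (m', k') r u"
        using m by (simp add: cf_act[OF assms] val_def algebra_simps)
    qed
  next
    assume eq: "val S (m, k) = val S (m', k')"
    show "act S (j + k') m = act S (j + k) m'"
    proof (rule cf_inj[OF act_in_algebra[OF assms m(1)] act_in_algebra[OF assms m(2)]], intro ext)
      fix r u
      have "val S (m, k) (r - int (j + k + k') * int (card S)) (u - int (j + k + k') * gs S)
          = val S (m', k') (r - int (j + k + k') * int (card S)) (u - int (j + k + k') * gs S)"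
        by (simp add: eq)
      then show "cf (act S (j + k') m) r u = cf (act S (j + k) m') r u"
        using m by (simp add: cf_act[OF assms] val_def algebra_simps)
    qed
  qed
  then show ?thesis
    unfolding loc_rel_def carrier_MB act_smult[OF assms] pq by auto
qed

lemma fr_eq:
  assumes "S \<subseteq> {..<nv}" "m \<in> algebra"
  shows "fr S m k = {q. fst q \<in> algebra \<and> val S q = val S (m, k)}"
  using assms(2) by (auto simp: fr_def frac_def loc_rel_iff[OF assms(1)])

lemma coeff_fr:
  assumes "S \<subseteq> {..<nv}" "m \<in> algebra"
  shows "coeff S (fr S m k) = val S (m, k)"
proof -
  have "(m, k) \<in> fr S m k" using assms by (simp add: fr_eq)
  then have "(SOME p. p \<in> fr S m k) \<in> fr S m k" by (rule someI)
  then show ?thesis using assms by (simp add: fr_eq coeff_def)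
qed

lemma carrier_Loc:
  assumes "S \<subseteq> {..<nv}"
  shows "carrier (Loc S) = {fr S m k | m k. m \<in> algebra}"
  by (auto simp: Loc_def cech_loc_def localization_def quotient_def fr_def frac_def carrier_MB)

text \<open>The embedding into functions on the plane; identities in localizations are henceforth
  verified on coefficients.\<close>

lemma coeff_inj:
  assumes "S \<subseteq> {..<nv}" "Y \<in> carrier (Loc S)" "Z \<in> carrier (Loc S)" "coeff S Y = coeff S Z"
  shows "Y = Z"
proof -
  obtain m k m' k' where m: "m \<in> algebra" "Y = fr S m k" and m': "m' \<in> algebra" "Z = fr S m' k'"
    using assms(2,3) by (auto simp: carrier_Loc[OF assms(1)])
  then have "val S (m, k) = val S (m', k')"
    using assms(4) coeff_fr[OF assms(1) m(1)] coeff_fr[OF assms(1) m'(1)] by simp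
  then show ?thesis
    unfolding m(2) m'(2) fr_eq[OF assms(1) m(1)] fr_eq[OF assms(1) m'(1)] by simp
qed

lemma Loc_zero:
  fixes L :: "('k::field mpoly, ('k mpoly \<times> nat) set) module"
  assumes "S \<subseteq> {..<nv}"
  defines "L \<equiv> Loc S"
  shows "\<zero>\<^bsub>L\<^esub> \<in> carrier L" "coeff S \<zero>\<^bsub>L\<^esub> = (\<lambda>r u. 0)"
proof -
  have z: "\<zero>\<^bsub>L\<^esub> = fr S 0 0"
    by (simp add: L_def Loc_def cech_loc_def localization_def fr_def semigroup_module_def)
  have 0: "(0 :: 'k mpoly) \<in> algebra" by simp
  show "\<zero>\<^bsub>L\<^esub> \<in> carrier L"
    unfolding z unfolding L_def carrier_Loc[OF assms(1)] using 0 by blast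
  show "coeff S \<zero>\<^bsub>L\<^esub> = (\<lambda>r u. 0)"
    unfolding z coeff_fr[OF assms(1) 0] by (simp add: val_def fun_eq_iff)
qed

lemma UNION_const: "Y \<noteq> {} \<Longrightarrow> (\<And>y. y \<in> Y \<Longrightarrow> f y = C) \<Longrightarrow> (\<Union>y\<in>Y. f y) = C"
  by auto

text \<open>Addition in \<open>localization\<close> is a union over all pairs of representatives.
  Every pair yields the same class, so the union collapses.\<close>

lemma Loc_add_fr:
  fixes m m' :: "'k::field mpoly"
  assumes S: "S \<subseteq> {..<nv}" and m: "m \<in> algebra" "m' \<in> algebra"
  shows "fr S m k \<oplus>\<^bsub>Loc S\<^esub> fr S m' k' = fr S (act S k' m + act S k m') (k + k')"
    and "act S k' m + act S k m' \<in> algebra"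
    and "val S (act S k' m + act S k m', k + k') = (\<lambda>r u. val S (m, k) r u + val S (m', k') r u)"
proof -
  have mem: "act S k' m + act S k m' \<in> algebra" if "m \<in> algebra" "m' \<in> algebra"
    for m m' :: "'k mpoly" and k k'
    by (intro add_in_algebra act_in_algebra[OF S] that)
  have v: "val S (act S k' m + act S k m', k + k') = (\<lambda>r u. val S (m, k) r u + val S (m', k') r u)"
    if "m \<in> algebra" "m' \<in> algebra" for m m' :: "'k mpoly" and k k'
    using that by (simp add: fun_eq_iff val_def cf_act[OF S] algebra_simps)
  show "act S k' m + act S k m' \<in> algebra" by (rule mem[OF m])
  show "val S (act S k' m + act S k m', k + k') = (\<lambda>r u. val S (m, k) r u + val S (m', k') r u)"
    by (rule v[OF m])
  have ne: "fr S m k \<noteq> {}" "fr S m' k' \<noteq> {}"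
    using m by (auto simp: fr_eq[OF S])
  have "fr S m k \<oplus>\<^bsub>Loc S\<^esub> fr S m' k' =
      (\<Union>(n, l)\<in>fr S m k. \<Union>(n', l')\<in>fr S m' k'. fr S (act S l' n + act S l n') (l + l'))"
    unfolding Loc_def cech_loc_def localization_def fr_def
    by (simp only: ring.select_convs act_smult[OF S] add_MB)
  also have "\<dots> = fr S (act S k' m + act S k m') (k + k')"
  proof (intro UNION_const ne)
    fix p assume p: "p \<in> fr S m k"
    obtain n l where nl: "p = (n, l)" by fastforce
    show "(case p of (n, l) \<Rightarrow> \<Union>(n', l')\<in>fr S m' k'. fr S (act S l' n + act S l n') (l + l')) =
        fr S (act S k' m + act S k m') (k + k')"
      unfolding nl prod.case
    proof (intro UNION_const ne)
      fix q assume q: "q \<in> fr S m' k'"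
      obtain n' l' where nl': "q = (n', l')" by fastforce
      have "n \<in> algebra" "n' \<in> algebra" "val S (n, l) = val S (m, k)" "val S (n', l') = val S (m', k')"
        using p q nl nl' m by (auto simp: fr_eq[OF S])
      then show "(case q of (n', l') \<Rightarrow> fr S (act S l' n + act S l n') (l + l')) =
          fr S (act S k' m + act S k m') (k + k')"
        using m by (simp add: nl' fr_eq[OF S mem] v)
    qed
  qed
  finally show "fr S m k \<oplus>\<^bsub>Loc S\<^esub> fr S m' k' = fr S (act S k' m + act S k m') (k + k')" .
qed

lemma Loc_add:
  assumes S: "S \<subseteq> {..<nv}" and YZ: "Y \<in> carrier (Loc S)" "Z \<in> carrier (Loc S)"
  shows "Y \<oplus>\<^bsub>Loc S\<^esub> Z \<in> carrier (Loc S)"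
    and "coeff S (Y \<oplus>\<^bsub>Loc S\<^esub> Z) = (\<lambda>r u. coeff S Y r u + coeff S Z r u)"
proof -
  obtain m k m' k' where m: "m \<in> algebra" "m' \<in> algebra" "Y = fr S m k" "Z = fr S m' k'"
    using YZ by (auto simp: carrier_Loc[OF S])
  note a = Loc_add_fr[OF S m(1,2), where k = k and k' = k']
  show "Y \<oplus>\<^bsub>Loc S\<^esub> Z \<in> carrier (Loc S)"
    unfolding m a(1) carrier_Loc[OF S] using a(2) by blast
  show "coeff S (Y \<oplus>\<^bsub>Loc S\<^esub> Z) = (\<lambda>r u. coeff S Y r u + coeff S Z r u)"
    unfolding m a(1) coeff_fr[OF S a(2)] coeff_fr[OF S m(1)] coeff_fr[OF S m(2)] a(3) ..
qed

lemma Loc_uminus: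
  assumes S: "S \<subseteq> {..<nv}" and Y: "Y \<in> carrier (Loc S)"
  shows "\<exists>Z\<in>carrier (Loc S). coeff S Z = (\<lambda>r u. - coeff S Y r u)"
proof -
  obtain m k where m: "m \<in> algebra" "Y = fr S m k"
    using Y by (auto simp: carrier_Loc[OF S])
  show ?thesis
  proof
    show "fr S (- m) k \<in> carrier (Loc S)"
      unfolding carrier_Loc[OF S] using uminus_in_algebra[OF m(1)] by blast
    show "coeff S (fr S (- m) k) = (\<lambda>r u. - coeff S Y r u)"
      unfolding m(2) coeff_fr[OF S m(1)] coeff_fr[OF S uminus_in_algebra[OF m(1)]]
      by (simp add: val_def fun_eq_iff)
  qed
qed

lemma abelian_group_Loc:
  assumes S: "S \<subseteq> {..<nv}"
  shows "abelian_group (Loc S :: ('k::field mpoly, ('k mpoly \<times> nat) set) module)"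
proof (rule abelian_groupI)
  note simps = Loc_add[OF S] Loc_zero[OF S]
  fix x y z :: "('k mpoly \<times> nat) set"
  assume c: "x \<in> carrier (Loc S)" "y \<in> carrier (Loc S)" "z \<in> carrier (Loc S)"
  show "x \<oplus>\<^bsub>Loc S\<^esub> y \<oplus>\<^bsub>Loc S\<^esub> z = x \<oplus>\<^bsub>Loc S\<^esub> (y \<oplus>\<^bsub>Loc S\<^esub> z)"
    by (rule coeff_inj[OF S]) (use c in \<open>simp_all add: simps add.assoc\<close>)
next
  fix x y :: "('k mpoly \<times> nat) set"
  assume c: "x \<in> carrier (Loc S)" "y \<in> carrier (Loc S)"
  show "x \<oplus>\<^bsub>Loc S\<^esub> y = y \<oplus>\<^bsub>Loc S\<^esub> x"
    by (rule coeff_inj[OF S]) (use c in \<open>simp_all add: Loc_add[OF S] add.commute\<close>)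
next
  fix x :: "('k mpoly \<times> nat) set" assume c: "x \<in> carrier (Loc S)"
  show "\<zero>\<^bsub>Loc S\<^esub> \<oplus>\<^bsub>Loc S\<^esub> x = x"
    by (rule coeff_inj[OF S]) (use c in \<open>simp_all add: Loc_add[OF S] Loc_zero[OF S]\<close>)
  obtain y where y: "y \<in> carrier (Loc S)" "coeff S y = (\<lambda>r u. - coeff S x r u)"
    using Loc_uminus[OF S c] by blast
  have "y \<oplus>\<^bsub>Loc S\<^esub> x = \<zero>\<^bsub>Loc S\<^esub>"
    by (rule coeff_inj[OF S]) (use c y in \<open>simp_all add: Loc_add[OF S] Loc_zero[OF S]\<close>)
  then show "\<exists>y\<in>carrier (Loc S). y \<oplus>\<^bsub>Loc S\<^esub> x = \<zero>\<^bsub>Loc S\<^esub>" using y(1) by blast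
qed (use Loc_add[OF S] Loc_zero[OF S] in auto)

lemma Loc_a_inv:
  assumes S: "S \<subseteq> {..<nv}" and Y: "Y \<in> carrier (Loc S)"
  shows "\<ominus>\<^bsub>Loc S\<^esub> Y \<in> carrier (Loc S)" "coeff S (\<ominus>\<^bsub>Loc S\<^esub> Y) = (\<lambda>r u. - coeff S Y r u)"
proof -
  interpret abelian_group "Loc S" by (rule abelian_group_Loc[OF S])
  show m: "\<ominus>\<^bsub>Loc S\<^esub> Y \<in> carrier (Loc S)" using Y by simp
  have "coeff S (Y \<oplus>\<^bsub>Loc S\<^esub> \<ominus>\<^bsub>Loc S\<^esub> Y) = (\<lambda>r u. 0)"
    using r_neg[OF Y] Loc_zero(2)[OF S] by simp
  then show "coeff S (\<ominus>\<^bsub>Loc S\<^esub> Y) = (\<lambda>r u. - coeff S Y r u)"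
    unfolding Loc_add(2)[OF S Y m] by (simp add: fun_eq_iff add_eq_0_iff)
qed

lemma Loc_finsum:
  assumes S: "S \<subseteq> {..<nv}" and "finite I" "F \<in> I \<rightarrow> carrier (Loc S)"
  shows "finsum (Loc S) F I \<in> carrier (Loc S)"
    and "coeff S (finsum (Loc S) F I) = (\<lambda>r u. \<Sum>i\<in>I. coeff S (F i) r u)"
proof -
  interpret abelian_group "Loc S" by (rule abelian_group_Loc[OF S])
  have "finsum (Loc S) F I \<in> carrier (Loc S) \<and>
      coeff S (finsum (Loc S) F I) = (\<lambda>r u. \<Sum>i\<in>I. coeff S (F i) r u)"
    using assms(2,3)
  proof (induction I rule: finite_induct)
    case empty
    then show ?case using Loc_zero[OF S] by simp
  next
    case (insert i I)
    then have F: "F i \<in> carrier (Loc S)" "F \<in> I \<rightarrow> carrier (Loc S)" by auto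
    have "finsum (Loc S) F (insert i I) = F i \<oplus>\<^bsub>Loc S\<^esub> finsum (Loc S) F I"
      by (rule finsum_insert[OF insert(1,2) F(2,1)])
    then show ?case
      using insert F by (simp add: Loc_add[OF S])
  qed
  then show "finsum (Loc S) F I \<in> carrier (Loc S)"
    "coeff S (finsum (Loc S) F I) = (\<lambda>r u. \<Sum>i\<in>I. coeff S (F i) r u)" by auto
qed

text \<open>The localization maps become inclusions: numerator and denominator are multiplied by the
  same power of the variable, which leaves the Laurent expansion unchanged.\<close>

lemma Loc_map:
  assumes T: "T \<subseteq> {..<nv}" "i \<in> T" and Y: "Y \<in> carrier (Loc (T - {i}))"
  shows "loc_map Rn MB (mvar i) (finprod Rn mvar T) Y \<in> carrier (Loc T)"
    and "coeff T (loc_map Rn MB (mvar i) (finprod Rn mvar T) Y) = coeff (T - {i}) Y"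
proof -
  have S: "T - {i} \<subseteq> {..<nv}" and i: "{i} \<subseteq> {..<nv}" using T by auto
  have fT: "finite T" using T(1) finite_subset by blast
  obtain m k where m: "m \<in> algebra" "Y = fr (T - {i}) m k"
    using Y by (auto simp: carrier_Loc[OF S])
  have x: "(mvar i [^]\<^bsub>Rn\<^esub> l) \<odot>\<^bsub>MB\<^esub> n = act {i} l n" for l n
    by (simp add: finprod_mvar[OF i] flip: act_smult[OF i])
  have v: "val T (act {i} l n, l) = val (T - {i}) (n, l)" if "n \<in> algebra" for n l
  proof -
    have "int (card T) = int (card (T - {i})) + 1" "gs T = gs (T - {i}) + gs {i}"
      using card.remove[OF fT T(2)] by (simp_all add: gs_def sum.remove[OF fT T(2)])
    then show ?thesis
      using that by (simp add: fun_eq_iff val_def cf_act[OF i] algebra_simps)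
  qed
  have "loc_map Rn MB (mvar i) (finprod Rn mvar T) Y = (\<Union>(n, l)\<in>Y. fr T (act {i} l n) l)"
    by (simp add: loc_map_def x fr_def)
  also have "\<dots> = fr T (act {i} k m) k"
  proof (rule UNION_const)
    show "Y \<noteq> {}" using m by (auto simp: fr_eq[OF S])
    fix p assume "p \<in> Y"
    moreover obtain n l where "p = (n, l)" by fastforce
    ultimately show "(case p of (n, l) \<Rightarrow> fr T (act {i} l n) l) = fr T (act {i} k m) k"
      using m by (simp add: fr_eq[OF S] fr_eq[OF T(1) act_in_algebra[OF i]] v)
  qed
  finally have eq: "loc_map Rn MB (mvar i) (finprod Rn mvar T) Y = fr T (act {i} k m) k" .
  have mem: "act {i} k m \<in> algebra" by (rule act_in_algebra[OF i m(1)])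
  show "loc_map Rn MB (mvar i) (finprod Rn mvar T) Y \<in> carrier (Loc T)"
    unfolding eq carrier_Loc[OF T(1)] using mem by blast
  show "coeff T (loc_map Rn MB (mvar i) (finprod Rn mvar T) Y) = coeff (T - {i}) Y"
    using coeff_fr[OF T(1) mem, of k] coeff_fr[OF S m(1), of k] v[OF m(1), of k] eq m(2) by simp
qed

end

section \<open>The Cech complex\<close>

definition eps :: "nat set \<Rightarrow> nat \<Rightarrow> 'k::field"
  where "eps S i = (if even (card {j\<in>S. j < i}) then 1 else - 1)"

lemma eps_sq: "eps S i * eps S i = (1 :: 'k::field)"
  by (simp add: eps_def)

lemma eps_insert:
  assumes "finite S" "h \<notin> S"
  shows "eps (insert h S) i = (if h < i then - eps S i else eps S i :: 'k::field)"
proof (cases "h < i")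
  case True
  then have "{j \<in> insert h S. j < i} = insert h {j\<in>S. j < i}" by auto
  then show ?thesis using assms True by (simp add: eps_def)
next
  case False
  then have "{j \<in> insert h S. j < i} = {j\<in>S. j < i}" by auto
  then show ?thesis using False by (simp add: eps_def)
qed

text \<open>The cone over the vertex \<open>h\<close> contracts the complex of alternating cochains.\<close>

lemma cone_contraction:
  fixes Z :: "nat set \<Rightarrow> 'k::field"
  assumes T: "finite T"
    and cocycle: "h \<notin> T \<Longrightarrow> (\<Sum>i\<in>insert h T. eps (insert h T) i * Z (insert h T - {i})) = 0"
    and H: "\<And>i. i \<in> T \<Longrightarrow> H (T - {i}) =
      (if h \<in> T - {i} then 0 else eps (insert h (T - {i})) h * Z (insert h (T - {i})))"
  shows "(\<Sum>i\<in>T. eps T i * H (T - {i})) = Z T"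
proof (cases "h \<in> T")
  case True
  \<comment> \<open>Only the removal of h leaves a set avoiding h, where H can be nonzero.\<close>
  have "(\<Sum>i\<in>T. eps T i * H (T - {i})) = (\<Sum>i\<in>T. if i = h then Z T else 0)"
  proof (rule sum.cong[OF refl])
    fix i assume i: "i \<in> T"
    show "eps T i * H (T - {i}) = (if i = h then Z T else 0)"
      using True H[OF i] by (simp add: insert_absorb eps_sq flip: mult.assoc)
  qed
  then show ?thesis using True T by simp
next
  case False
  let ?T = "insert h T"
  have "(\<Sum>i\<in>T. eps T i * H (T - {i})) = (\<Sum>i\<in>T. - eps ?T h * (eps ?T i * Z (?T - {i})))"
  proof (rule sum.cong[OF refl])
    fix i assume i: "i \<in> T"
    \<comment> \<open>With both h and i removed the signs become comparable: the smaller of the two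
      shifts the position of the other by one, whence the sign -1.\<close>
    define T0 where "T0 = T - {i}"
    have T0: "T = insert i T0" "i \<notin> T0" "h \<notin> T0" "finite T0" "i \<noteq> h"
      using i False T by (auto simp: T0_def)
    have "eps ?T h = (eps T h :: 'k)" using eps_insert[OF T False, of h] by simp
    also have "\<dots> = (if i < h then - eps T0 h else eps T0 h)"
      unfolding T0(1) by (rule eps_insert[OF T0(4,2)])
    finally have e: "eps (insert h T0) h = (eps T0 h :: 'k)"
      "eps ?T h = (if i < h then - eps T0 h else eps T0 h :: 'k)"
      "eps ?T i = (if h < i then - eps T i else eps T i :: 'k)"
      using eps_insert[OF T0(4,3), of h] eps_insert[OF T False, of i] by simp_all
    have "?T - {i} = insert h T0" using i False by (auto simp: T0_def)
    moreover have "H (T - {i}) = eps (insert h T0) h * Z (insert h T0)"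
      using H[OF i] False by (simp add: T0_def)
    ultimately show "eps T i * H (T - {i}) = - eps ?T h * (eps ?T i * Z (?T - {i}))"
      using T0(5) by (simp add: e)
  qed
  also have "\<dots> = - eps ?T h * (\<Sum>i\<in>T. eps ?T i * Z (?T - {i}))"
    by (simp only: sum_distrib_left)
  also have "(\<Sum>i\<in>T. eps ?T i * Z (?T - {i})) = - (eps ?T h * Z T)"
    using cocycle[OF False] T False by (simp add: eq_neg_iff_add_eq_0 add.commute)
  finally show ?thesis
    by (simp add: eps_sq flip: mult.assoc)
qed

text \<open>Each coset of C by an element of Z is C itself: closure gives one inclusion and
  solvability the other. A nonempty Z provides a coset at all.\<close>

lemma FactGroup_trivial:
  assumes ne: "Z \<noteq> {}" and sub: "Z \<subseteq> C"
    and closed: "\<And>x y. x \<in> C \<Longrightarrow> y \<in> C \<Longrightarrow> x \<otimes>\<^bsub>G\<^esub> y \<in> C"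
    and solve: "\<And>x y. x \<in> C \<Longrightarrow> y \<in> C \<Longrightarrow> \<exists>h\<in>C. h \<otimes>\<^bsub>G\<^esub> y = x"
  shows "carrier (G\<lparr>carrier := Z\<rparr> Mod C) = {\<one>\<^bsub>G\<lparr>carrier := Z\<rparr> Mod C\<^esub>}"
proof -
  have "C #>\<^bsub>G\<lparr>carrier := Z\<rparr>\<^esub> y = C" if "y \<in> Z" for y
    using closed solve that sub by (fastforce simp: r_coset_def)
  then show ?thesis using ne by (auto simp: carrier_FactGroup)
qed

context plane_semigroup
begin

section \<open>Graded pieces of the localizations\<close>

text \<open>The degree r part of the semigroup obtained from \<open>B\<close> by inverting the sum
  of the generators in S.\<close>

definition deg_set :: "nat set \<Rightarrow> int \<Rightarrow> int set"
  where "deg_set S r = {u. \<exists>k. in_sumset (r + int k * int (card S)) (u + int k * gs S)}"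

text \<open>The image of \<open>LP S r\<close> under \<open>coeff S\<close>, as
  \<open>LP_coeff\<close> and \<open>LP_ex\<close> show.\<close>

definition coeff_space :: "nat set \<Rightarrow> int \<Rightarrow> (int \<Rightarrow> int \<Rightarrow> 'k::field) set"
  where "coeff_space S r = {h. finite {u. h r u \<noteq> 0} \<and> (\<forall>r' u. h r' u \<noteq> 0 \<longrightarrow> r' = r \<and> u \<in> deg_set S r)}"

abbreviation LP :: "nat set \<Rightarrow> int \<Rightarrow> ('k::field mpoly \<times> nat) set set"
  where "LP S r \<equiv> loc_part Rn MB (graded_part \<alpha> B) (finprod Rn mvar S) (card S) r"

lemma LP_coeff:
  assumes S: "S \<subseteq> {..<nv}" and Y: "Y \<in> LP S r"
  shows "Y \<in> carrier (Loc S)" "coeff S Y \<in> coeff_space S r"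
proof -
  obtain m k where m: "m \<in> graded_part \<alpha> B (r + int k * int (card S))" "Y = fr S m k"
    using Y by (auto simp: loc_part_def fr_def)
  let ?R = "r + int k * int (card S)"
  have mk: "Poly_Mapping.keys m \<subseteq> {b \<in> B. dg b = ?R}" using m(1) by (simp add: graded_part_eq)
  then have mA: "m \<in> algebra" by auto
  show "Y \<in> carrier (Loc S)" unfolding carrier_Loc[OF S] m(2) using mA by blast
  have supp: "r' = r \<and> in_sumset ?R (u + int k * gs S)" if "val S (m, k) r' u \<noteq> 0" for r' u
  proof -
    have *: "cf m (r' + int k * int (card S)) (u + int k * gs S) \<noteq> 0"
      using that by (simp add: val_def)
    have "dg (point (r' + int k * int (card S)) (u + int k * gs S)) = ?R"
      using cf_support(2)[OF mA *] mk by auto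
    then have "r' + int k * int (card S) = ?R"
      using dg_fc_point(1)[OF cf_support(1)[OF mA *]] by simp
    then show ?thesis using cf_support(1)[OF mA *] by simp
  qed
  have "finite {u. val S (m, k) r u \<noteq> 0}"
  proof (rule finite_subset)
    show "{u. val S (m, k) r u \<noteq> 0} \<subseteq> (\<lambda>u. u - int k * gs S) ` {u. in_sumset ?R u}"
    proof
      fix u assume "u \<in> {u. val S (m, k) r u \<noteq> 0}"
      then have "in_sumset ?R (u + int k * gs S)" using supp by blast
      then show "u \<in> (\<lambda>u. u - int k * gs S) ` {u. in_sumset ?R u}"
        by (intro image_eqI[of _ _ "u + int k * gs S"]) auto
    qed
  qed (simp add: finite_sumset)
  then show "coeff S Y \<in> coeff_space S r"
    unfolding m(2) coeff_fr[OF S mA] coeff_space_def deg_set_def using supp by blast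
qed

lemma gs_in_sumset: "S \<subseteq> {..<nv} \<Longrightarrow> in_sumset (int (card S)) (gs S)"
proof -
  assume S: "S \<subseteq> {..<nv}"
  then have "finite S" using finite_subset by blast
  then show ?thesis
    using S
  proof (induction S rule: finite_induct)
    case empty
    then show ?case using in_sumset_0 by (simp add: gs_def)
  next
    case (insert i S)
    then have "in_sumset (1 + int (card S)) (fc (generator 2 \<alpha> a i) + gs S)"
      by (intro in_sumset_add fc_generator_range) (auto simp: nv_def)
    then show ?case using insert by (simp add: gs_def)
  qed
qed

lemma in_sumset_mult: "in_sumset r u \<Longrightarrow> in_sumset (int n * r) (int n * u)"
proof (induction n)
  case 0
  then show ?case using in_sumset_0 by simp
next
  case (Suc n)
  then show ?case using in_sumset_add[of r u "int n * r" "int n * u"] by (simp add: distrib_right)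
qed

lemma LP_ex:
  fixes h :: "int \<Rightarrow> int \<Rightarrow> 'k::field"
  assumes S: "S \<subseteq> {..<nv}" and h: "h \<in> coeff_space S r"
  shows "\<exists>Y\<in>LP S r. coeff S Y = h"
proof -
  define F where "F = {u. h r u \<noteq> 0}"
  have F: "finite F" and supp: "\<And>r' u. h r' u \<noteq> 0 \<Longrightarrow> r' = r \<and> u \<in> deg_set S r"
    using h by (auto simp: F_def coeff_space_def)
  have "\<forall>u\<in>F. \<exists>k. in_sumset (r + int k * int (card S)) (u + int k * gs S)"
  proof
    fix u assume "u \<in> F"
    then have "u \<in> deg_set S r" using supp[of r u] by (simp add: F_def)
    then show "\<exists>k. in_sumset (r + int k * int (card S)) (u + int k * gs S)" by (simp add: deg_set_def)
  qed
  then obtain \<kappa> where \<kappa>: "\<And>u. u \<in> F \<Longrightarrow> in_sumset (r + int (\<kappa> u) * int (card S)) (u + int (\<kappa> u) * gs S)"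
    by metis
  \<comment> \<open>A common denominator for the finite support. Raising an exponent \<kappa> u to K
    stays in the sumset, which contains the inverted element.\<close>
  define K where "K = Max (insert 0 (\<kappa> ` F))"
  define R where "R = r + int K * int (card S)"
  define w where "w u = u + int K * gs S" for u
  have in_R: "in_sumset R (w u)" if "u \<in> F" for u
  proof -
    have "\<kappa> u \<le> K" unfolding K_def using F that by (intro Max_ge) auto
    then obtain n where n: "K = \<kappa> u + n" using le_Suc_ex by blast
    have "in_sumset (int n * int (card S)) (int n * gs S)"
      by (rule in_sumset_mult[OF gs_in_sumset[OF S]])
    from in_sumset_add[OF \<kappa>[OF that] this] show ?thesis
      by (simp add: R_def w_def n algebra_simps)
  qed
  define m where "m = (\<Sum>u\<in>F. Poly_Mapping.single (point R (w u)) (h r u))"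
  have lookup_m: "Poly_Mapping.lookup m b = (\<Sum>u\<in>F. if point R (w u) = b then h r u else 0)" for b
    by (simp add: m_def lookup_sum lookup_single when_def)
  have point_inj: "u = u'" if "u \<in> F" "u' \<in> F" "point R (w u) = point R (w u')" for u u'
  proof -
    have "fc (point R (w u)) = fc (point R (w u'))" using that(3) by (rule arg_cong)
    then have "w u = w u'"
      unfolding dg_fc_point(2)[OF in_R[OF that(1)]] dg_fc_point(2)[OF in_R[OF that(2)]] .
    then show ?thesis by (simp add: w_def)
  qed
  have keys_m: "\<exists>u\<in>F. b = point R (w u)" if "b \<in> Poly_Mapping.keys m" for b
  proof (rule ccontr)
    assume "\<not> ?thesis"
    then have "Poly_Mapping.lookup m b = 0" unfolding lookup_m by (intro sum.neutral) auto
    then show False using that by (simp add: in_keys_iff)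
  qed
  have mg: "m \<in> graded_part \<alpha> B R"
    unfolding graded_part_eq using keys_m in_R point_in_B dg_fc_point(1) by blast
  then have mA: "m \<in> algebra" by (auto simp: graded_part_eq)
  have "val S (m, K) = h"
  proof (intro ext)
    fix r' u
    show "val S (m, K) r' u = h r' u"
    proof (cases "r' = r \<and> u \<in> F")
      case True
      have "val S (m, K) r u = cf m R (w u)" by (simp add: val_def R_def w_def)
      also have "\<dots> = Poly_Mapping.lookup m (point R (w u))"
        using in_sumset_bounds[OF in_R] True by (simp add: cf_def)
      also have "\<dots> = (\<Sum>u'\<in>F. if u' = u then h r u' else 0)"
        unfolding lookup_m using point_inj True by (intro sum.cong) auto
      also have "\<dots> = h r u" using F True by simp
      finally show ?thesis using True by simp
    next
      case False
      have "val S (m, K) r' u = 0"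
      proof (rule ccontr)
        assume "val S (m, K) r' u \<noteq> 0"
        then have nz: "cf m (r' + int K * int (card S)) (w u) \<noteq> 0" by (simp add: val_def w_def)
        note s = cf_support[OF mA nz]
        obtain u' where u': "u' \<in> F" "point (r' + int K * int (card S)) (w u) = point R (w u')"
          using keys_m[OF s(2)] by blast
        have "r' + int K * int (card S) = R" "w u = w u'"
          using dg_fc_point[OF s(1)] dg_fc_point[OF in_R[OF u'(1)]] u'(2) by auto
        then show False using False u'(1) by (simp add: R_def w_def)
      qed
      moreover have "h r' u = 0" using False supp F_def by blast
      ultimately show ?thesis by simp
    qed
  qed
  then have "coeff S (fr S m K) = h" using coeff_fr[OF S mA] by simp
  moreover have "fr S m K \<in> LP S r"
    unfolding loc_part_def fr_def using mg R_def by blast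
  ultimately show ?thesis by blast
qed

text \<open>Index 0 stands for \<open>e\<^sub>1\<close> and index 1 for
  \<open>e\<^sub>2\<close>.\<close>

lemma deg_set_simps:
  "u \<in> deg_set {} r \<longleftrightarrow> in_sumset r u"
  "u \<in> deg_set {0} r \<longleftrightarrow> (\<exists>k. in_sumset (r + int k) (u + int \<alpha> * int k))"
  "u \<in> deg_set {Suc 0} r \<longleftrightarrow> (\<exists>k. in_sumset (r + int k) u)"
  using fc_generator by (auto simp: deg_set_def gs_def mult.commute)

text \<open>The sum g of the generators in S is interior to the cone: \<alpha> g = gs S
  \<open>e\<^sub>1\<close> + (\<alpha> card S - gs S) \<open>e\<^sub>2\<close> with positive
  coefficients. Hence multiples of \<alpha> g absorb the corner combination by which the given point
  differs from a sumset point of its class.\<close>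

lemma deg_set_full:
  assumes S: "S \<subseteq> {..<nv}" "S \<noteq> {}" "S \<noteq> {0}" "S \<noteq> {Suc 0}"
  shows "u \<in> deg_set S r"
proof -
  have fS: "finite S" using S(1) finite_subset by blast
  have bounds: "0 \<le> fc (generator 2 \<alpha> a i)" "fc (generator 2 \<alpha> a i) \<le> int \<alpha>" if "i \<in> S" for i
    using in_sumset_bounds[OF fc_generator_range, of i] that S(1) by (auto simp: nv_def)
  obtain i where i: "i \<in> S" "i \<noteq> 1" using S by auto
  obtain j where j: "j \<in> S" "j \<noteq> 0" using S by auto
  have "fc (generator 2 \<alpha> a i) \<noteq> 0"
    using inj_onD[OF inj_fc, of i 1] i S(1) fc_generator(2) by (auto simp: nv_def)
  then have "fc (generator 2 \<alpha> a i) > 0" using bounds(1)[OF i(1)] by simp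
  then have pos: "gs S > 0"
    unfolding gs_def by (rule sum_pos2[OF fS i(1)]) (rule bounds)
  have "fc (generator 2 \<alpha> a j) \<noteq> int \<alpha>"
    using inj_onD[OF inj_fc, of j 0] j S(1) fc_generator(1) by (auto simp: nv_def)
  then have "int \<alpha> - fc (generator 2 \<alpha> a j) > 0" using bounds(2)[OF j(1)] by simp
  then have "(\<Sum>i\<in>S. int \<alpha> - fc (generator 2 \<alpha> a i)) > 0"
    by (rule sum_pos2[OF fS j(1)]) (simp add: bounds)
  then have less: "int \<alpha> * int (card S) - gs S > 0"
    by (simp add: gs_def sum_subtractf mult.commute)
  obtain r' u' where r'u': "in_sumset r' u'" "int \<alpha> dvd (u' - u)"
    using in_sumset_residue by blast
  from r'u'(2) obtain x where x: "u' = u + int \<alpha> * x" by (rule dvd_diffE)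
  define y where "y = r' - r - x"
  define n where "n = \<bar>x\<bar> + \<bar>y\<bar>"
  have "n * 1 \<le> n * gs S" "n * 1 \<le> n * (int \<alpha> * int (card S) - gs S)"
    by (rule mult_left_mono; use pos less in \<open>simp add: n_def\<close>)+
  moreover have "x \<le> n" "y \<le> n" by (simp_all add: n_def)
  ultimately have ge: "n * gs S - x \<ge> 0" "n * (int \<alpha> * int (card S) - gs S) - y \<ge> 0"
    by linarith+
  have "in_sumset (r' + (n * gs S - x) + (n * (int \<alpha> * int (card S) - gs S) - y)) (u' + int \<alpha> * (n * gs S - x))"
    by (rule in_sumset_shift[OF r'u'(1) ge])
  moreover have "r' + (n * gs S - x) + (n * (int \<alpha> * int (card S) - gs S) - y) = r + (int \<alpha> * n) * int (card S)"
    by (simp add: y_def algebra_simps)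
  moreover have "u' + int \<alpha> * (n * gs S - x) = u + (int \<alpha> * n) * gs S"
    by (simp add: x algebra_simps)
  ultimately have "in_sumset (r + (int \<alpha> * n) * int (card S)) (u + (int \<alpha> * n) * gs S)" by simp
  moreover have "int \<alpha> * n = int (nat (int \<alpha> * n))" by (simp add: n_def)
  ultimately show ?thesis unfolding deg_set_def by (metis (mono_tags, lifting) mem_Collect_eq)
qed

text \<open>The cone vertex has to be \<open>e\<^sub>2\<close> for points reached by adding \<open>e\<^sub>1\<close> only, and \<open>e\<^sub>1\<close> for points reached
  by adding \<open>e\<^sub>2\<close> only; elsewhere the choice is irrelevant.\<close>

definition apex :: "int \<Rightarrow> int \<Rightarrow> nat"
  where "apex r u = (if u \<in> deg_set {0} r then 1 else 0)"

text \<open>The cone property of the contributing sets. For S empty a failure is a hole between both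
  directions, and for S consisting of \<open>e\<^sub>2\<close> alone an outer hole; the bound with
  \<open>Suc (card S)\<close> equal to 1 or 2 excludes them. For S consisting of
  \<open>e\<^sub>1\<close> alone the choice of \<open>apex\<close> settles it.\<close>

lemma deg_set_apex:
  assumes bound: "int \<alpha> - int c < int (Suc (card S)) + r"
    and S: "S \<subseteq> {..<nv}" "apex r u \<notin> S" "u \<in> deg_set (insert (apex r u) S) r"
  shows "u \<in> deg_set S r"
proof -
  consider "S = {}" | "S = {0}" | "S = {Suc 0}" | "S \<noteq> {}" "S \<noteq> {0}" "S \<noteq> {Suc 0}" by blast
  then show ?thesis
  proof cases
    case 1
    then have ap: "apex r u = Suc 0" using S(3) by (auto simp: apex_def split: if_splits)
    then have "u \<in> deg_set {0} r" by (auto simp: apex_def split: if_splits)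
    then obtain k where k: "in_sumset (r + int k) (u + int \<alpha> * int k)"
      by (auto simp: deg_set_simps)
    obtain l where l: "in_sumset (r + int l) u"
      using S(3) ap 1 by (auto simp: deg_set_simps)
    have "in_sumset r u"
      using hole_degree[OF _ k l] bound 1 card_X by auto
    then show ?thesis using 1 by (simp add: deg_set_simps)
  next
    case 2
    then show ?thesis using S(2) by (auto simp: apex_def split: if_splits)
  next
    case 3
    then have no: "u \<notin> deg_set {0} r" using S(2) by (auto simp: apex_def)
    show ?thesis
    proof (rule ccontr)
      assume "\<not> ?thesis"
      moreover obtain r' u' where "in_sumset r' u'" "int \<alpha> dvd (u' - u)"
        using in_sumset_residue by blast
      ultimately have "r + 2 \<le> int \<alpha> - int (card X)"
        using no 3 by (intro outer_hole_degree) (auto simp: deg_set_simps)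
      then show False using bound 3 card_X by simp
    qed
  next
    case 4
    then show ?thesis by (intro deg_set_full S(1))
  qed
qed

section \<open>Cochains through their coefficients, and the vanishing of cohomology\<close>

abbreviation CG :: "nat \<Rightarrow> (nat set \<Rightarrow> ('k::field mpoly \<times> nat) set) monoid"
  where "CG p \<equiv> cech_group Rn MB mvar nv p"

abbreviation CP :: "nat \<Rightarrow> int \<Rightarrow> (nat set \<Rightarrow> ('k::field mpoly \<times> nat) set) set"
  where "CP p r \<equiv> cech_part Rn MB (graded_part \<alpha> B) mvar nv p r"

abbreviation CD :: "nat \<Rightarrow> (nat set \<Rightarrow> ('k::field mpoly \<times> nat) set) \<Rightarrow> nat set \<Rightarrow> ('k mpoly \<times> nat) set"
  where "CD p \<equiv> cech_diff Rn MB mvar nv p"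

lemma cech_indexD: "S \<in> cech_index nv p \<Longrightarrow> S \<subseteq> {..<nv} \<and> card S = p \<and> finite S"
  using finite_subset by (auto simp: cech_index_def)

lemma CG_one: "\<one>\<^bsub>CG p\<^esub> = (\<lambda>S\<in>cech_index nv p. \<zero>\<^bsub>Loc S\<^esub>)"
  by (simp add: cech_group_def Loc_def)

lemma CG_mult: "\<phi> \<otimes>\<^bsub>CG p\<^esub> \<psi> = (\<lambda>S\<in>cech_index nv p. \<phi> S \<oplus>\<^bsub>Loc S\<^esub> \<psi> S)"
  by (simp add: cech_group_def Loc_def)

lemma Loc_eq_zero:
  assumes "S \<subseteq> {..<nv}" "Y \<in> carrier (Loc S)" "coeff S Y = (\<lambda>r u. 0)"
  shows "Y = \<zero>\<^bsub>Loc S\<^esub>"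
  by (rule coeff_inj[OF assms(1,2)]) (simp_all add: Loc_zero[OF assms(1)] assms(3))

lemma CP_coeff:
  assumes "\<phi> \<in> CP p r" "S \<in> cech_index nv p"
  shows "\<phi> S \<in> carrier (Loc S)" "coeff S (\<phi> S) \<in> coeff_space S r"
proof -
  have "\<phi> S \<in> LP S r" using assms by (auto simp: cech_part_def)
  then show "\<phi> S \<in> carrier (Loc S)" "coeff S (\<phi> S) \<in> coeff_space S r"
    using LP_coeff cech_indexD[OF assms(2)] by blast+
qed

lemma CP_ex:
  fixes h :: "nat set \<Rightarrow> int \<Rightarrow> int \<Rightarrow> 'k::field"
  assumes "\<And>S. S \<in> cech_index nv p \<Longrightarrow> h S \<in> coeff_space S r"
  obtains \<phi> where "\<phi> \<in> CP p r" "\<And>S. S \<in> cech_index nv p \<Longrightarrow> coeff S (\<phi> S) = h S"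
proof -
  have "\<forall>S\<in>cech_index nv p. \<exists>Y\<in>LP S r. coeff S Y = h S"
  proof
    fix S assume S: "S \<in> cech_index nv p"
    show "\<exists>Y\<in>LP S r. coeff S Y = h S"
      by (rule LP_ex[OF _ assms[OF S]]) (use cech_indexD[OF S] in blast)
  qed
  then obtain f where f: "\<And>S. S \<in> cech_index nv p \<Longrightarrow> f S \<in> LP S r \<and> coeff S (f S) = h S"
    by metis
  show ?thesis
  proof (rule that)
    show "restrict f (cech_index nv p) \<in> CP p r" using f by (auto simp: cech_part_def)
    show "coeff S (restrict f (cech_index nv p) S) = h S" if "S \<in> cech_index nv p" for S
      using f that by simp
  qed
qed

lemma CD_coeff:
  assumes \<phi>: "\<And>S. S \<in> cech_index nv p \<Longrightarrow> \<phi> S \<in> carrier (Loc S)" and T: "T \<in> cech_index nv (Suc p)"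
  shows "CD p \<phi> T \<in> carrier (Loc T)"
    and "coeff T (CD p \<phi> T) = (\<lambda>r u. \<Sum>i\<in>T. eps T i * coeff (T - {i}) (\<phi> (T - {i})) r u)"
proof -
  note T' = cech_indexD[OF T]
  define y where "y i = loc_map Rn MB (mvar i) (finprod Rn mvar T) (\<phi> (T - {i}))" for i
  define z where "z i = (if even (card {j\<in>T. j < i}) then y i else \<ominus>\<^bsub>Loc T\<^esub> y i)" for i
  have y: "y i \<in> carrier (Loc T)" "coeff T (y i) = coeff (T - {i}) (\<phi> (T - {i}))" if i: "i \<in> T" for i
  proof -
    have "T - {i} \<in> cech_index nv p" using T' i by (auto simp: cech_index_def)
    then show "y i \<in> carrier (Loc T)" "coeff T (y i) = coeff (T - {i}) (\<phi> (T - {i}))"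
      unfolding y_def using Loc_map T' i \<phi> by blast+
  qed
  have z: "z i \<in> carrier (Loc T)" "coeff T (z i) = (\<lambda>r u. eps T i * coeff (T - {i}) (\<phi> (T - {i})) r u)"
    if i: "i \<in> T" for i
    using y[OF i] Loc_a_inv[OF conjunct1[OF T'] y(1)[OF i]] by (auto simp: z_def eps_def)
  have eq: "CD p \<phi> T = finsum (Loc T) z T"
    unfolding cech_diff_def Let_def Loc_def y_def z_def[abs_def] using T by simp
  have zT: "z \<in> T \<rightarrow> carrier (Loc T)" using z(1) by auto
  show "CD p \<phi> T \<in> carrier (Loc T)"
    unfolding eq using Loc_finsum(1)[OF _ _ zT] T' by blast
  have "coeff T (CD p \<phi> T) = (\<lambda>r u. \<Sum>i\<in>T. coeff T (z i) r u)"
    unfolding eq using Loc_finsum(2)[OF _ _ zT] T' by blast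
  also have "\<dots> = (\<lambda>r u. \<Sum>i\<in>T. eps T i * coeff (T - {i}) (\<phi> (T - {i})) r u)"
    using z(2) by (auto intro!: ext sum.cong)
  finally show "coeff T (CD p \<phi> T) = (\<lambda>r u. \<Sum>i\<in>T. eps T i * coeff (T - {i}) (\<phi> (T - {i})) r u)" .
qed

lemma CD_eqI:
  assumes "\<And>S. S \<in> cech_index nv p \<Longrightarrow> \<phi> S \<in> carrier (Loc S)"
    and "\<psi> \<in> extensional (cech_index nv (Suc p))"
    and "\<And>T. T \<in> cech_index nv (Suc p) \<Longrightarrow> \<psi> T \<in> carrier (Loc T)"
    and "\<And>T r u. T \<in> cech_index nv (Suc p) \<Longrightarrow>
      coeff T (\<psi> T) r u = (\<Sum>i\<in>T. eps T i * coeff (T - {i}) (\<phi> (T - {i})) r u)"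
  shows "CD p \<phi> = \<psi>"
proof (rule extensionalityI[OF _ assms(2)])
  show "CD p \<phi> \<in> extensional (cech_index nv (Suc p))"
    by (simp add: cech_diff_def)
  fix T assume T: "T \<in> cech_index nv (Suc p)"
  show "CD p \<phi> T = \<psi> T"
  proof (rule coeff_inj)
    show "T \<subseteq> {..<nv}" using cech_indexD[OF T] by blast
    show "CD p \<phi> T \<in> carrier (Loc T)" by (rule CD_coeff(1)[OF assms(1) T])
    show "\<psi> T \<in> carrier (Loc T)" by (rule assms(3)[OF T])
    have "coeff T (CD p \<phi> T) = (\<lambda>r u. \<Sum>i\<in>T. eps T i * coeff (T - {i}) (\<phi> (T - {i})) r u)"
      by (rule CD_coeff(2)[OF assms(1) T])
    then show "coeff T (CD p \<phi> T) = coeff T (\<psi> T)"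
      by (simp add: assms(4)[OF T] fun_eq_iff)
  qed
qed

lemma CD_CP_coeff:
  assumes "\<phi> \<in> CP p r" "T \<in> cech_index nv (Suc p)"
  shows "CD p \<phi> T \<in> carrier (Loc T)"
    and "coeff T (CD p \<phi> T) = (\<lambda>r u. \<Sum>i\<in>T. eps T i * coeff (T - {i}) (\<phi> (T - {i})) r u)"
proof -
  have \<phi>: "\<phi> S \<in> carrier (Loc S)" if "S \<in> cech_index nv p" for S
    by (rule CP_coeff(1)[OF assms(1) that])
  show "CD p \<phi> T \<in> carrier (Loc T)" by (rule CD_coeff(1)[OF \<phi> assms(2)])
  show "coeff T (CD p \<phi> T) = (\<lambda>r u. \<Sum>i\<in>T. eps T i * coeff (T - {i}) (\<phi> (T - {i})) r u)"
    by (rule CD_coeff(2)[OF \<phi> assms(2)])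
qed

lemma CP_extensional: "\<phi> \<in> CP p r \<Longrightarrow> \<phi> \<in> extensional (cech_index nv p)"
  by (simp add: cech_part_def PiE_iff)

lemma coeff_space_closed:
  fixes h h' :: "int \<Rightarrow> int \<Rightarrow> 'k::field"
  assumes "h \<in> coeff_space S r" "h' \<in> coeff_space S r"
  shows "(\<lambda>r u. h r u + s * h' r u) \<in> coeff_space S r"
proof -
  have "{u. h r u + s * h' r u \<noteq> 0} \<subseteq> {u. h r u \<noteq> 0} \<union> {u. h' r u \<noteq> 0}" by auto
  moreover have "finite ({u. h r u \<noteq> 0} \<union> {u. h' r u \<noteq> 0})"
    using assms by (simp add: coeff_space_def)
  ultimately have "finite {u. h r u + s * h' r u \<noteq> 0}" by (rule finite_subset)
  moreover have "r' = r \<and> u \<in> deg_set S r" if "h r' u + s * h' r' u \<noteq> 0" for r' u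
  proof -
    have "h r' u \<noteq> 0 \<or> h' r' u \<noteq> 0" using that by auto
    then show ?thesis using assms unfolding coeff_space_def by blast
  qed
  ultimately show ?thesis unfolding coeff_space_def by blast
qed

text \<open>Taken with s = 1 for closure of the coboundaries and s = -1 for solvability.\<close>

lemma coboundary_comb:
  fixes s :: "'k::field"
  assumes "\<phi> \<in> CP p r" "\<psi> \<in> CP p r"
  obtains \<chi> where "\<chi> \<in> CP p r"
    "\<And>T r u. T \<in> cech_index nv (Suc p) \<Longrightarrow>
      coeff T (CD p \<chi> T) r u = coeff T (CD p \<phi> T) r u + s * coeff T (CD p \<psi> T) r u"
proof -
  obtain \<chi> where \<chi>: "\<chi> \<in> CP p r" "\<And>S. S \<in> cech_index nv p \<Longrightarrow>
      coeff S (\<chi> S) = (\<lambda>r u. coeff S (\<phi> S) r u + s * coeff S (\<psi> S) r u)"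
    using CP_ex[of p "\<lambda>S r u. coeff S (\<phi> S) r u + s * coeff S (\<psi> S) r u" r]
      coeff_space_closed CP_coeff(2) assms by blast
  show ?thesis
  proof (rule that[OF \<chi>(1)])
    fix T r' u assume T: "T \<in> cech_index nv (Suc p)"
    have sub: "T - {i} \<in> cech_index nv p" if "i \<in> T" for i
      using cech_indexD[OF T] that by (auto simp: cech_index_def)
    note c = CD_CP_coeff(2)[OF _ T]
    show "coeff T (CD p \<chi> T) r' u = coeff T (CD p \<phi> T) r' u + s * coeff T (CD p \<psi> T) r' u"
      unfolding c[OF \<chi>(1)] c[OF assms(1)] c[OF assms(2)]
      by (simp add: \<chi>(2) sub sum_distrib_left algebra_simps flip: sum.distrib)
  qed
qed

text \<open>The complex splits over the points (r, u), and at each of them the cone contraction with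
  vertex \<open>apex r u\<close> gives a preimage. These are assembled coefficientwise, since the
  vertex varies with u.\<close>

lemma cocycles_subset_coboundaries:
  assumes bound: "int \<alpha> - int c < int p + r"
  shows "cech_cocycles Rn MB (graded_part \<alpha> B) mvar nv p r
    \<subseteq> (cech_coboundaries Rn MB (graded_part \<alpha> B) mvar nv p r
        :: (nat set \<Rightarrow> ('k::field mpoly \<times> nat) set) set)"
proof
  fix \<phi> :: "nat set \<Rightarrow> ('k mpoly \<times> nat) set"
  assume "\<phi> \<in> cech_cocycles Rn MB (graded_part \<alpha> B) mvar nv p r"
  then have \<phi>: "\<phi> \<in> CP p r" and "CD p \<phi> = \<one>\<^bsub>CG (Suc p)\<^esub>"
    by (auto simp: cech_cocycles_def)
  then have cocycle: "(\<Sum>i\<in>T. eps T i * coeff (T - {i}) (\<phi> (T - {i})) r' u) = 0"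
    if "T \<in> cech_index nv (Suc p)" for T r' u
  proof -
    have "CD p \<phi> T = \<zero>\<^bsub>Loc T\<^esub>" using \<open>CD p \<phi> = \<one>\<^bsub>CG (Suc p)\<^esub>\<close> that by (simp add: CG_one)
    then have "coeff T (CD p \<phi> T) r' u = 0" using cech_indexD[OF that] by (simp add: Loc_zero(2))
    then show ?thesis by (simp add: CD_CP_coeff(2)[OF \<phi> that])
  qed
  have ext: "\<phi> \<in> extensional (cech_index nv p)" by (rule CP_extensional[OF \<phi>])
  show "\<phi> \<in> cech_coboundaries Rn MB (graded_part \<alpha> B) mvar nv p r"
  proof (cases p)
    case 0
    have idx: "cech_index nv 0 = {{}}"
      by (auto simp: cech_index_def card_eq_0_iff dest: finite_subset[OF _ finite_lessThan])
    \<comment> \<open>At {0} the differential is the inclusion of the algebra into its localization,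
      so the cocycle vanishes.\<close>
    have "{0} \<in> cech_index nv (Suc p)" using 0 by (simp add: cech_index_def nv_def)
    from cocycle[OF this] have "coeff {} (\<phi> {}) = (\<lambda>r u. 0)"
      by (simp add: eps_def fun_eq_iff)
    then have "\<phi> {} = \<zero>\<^bsub>Loc {}\<^esub>"
      using CP_coeff(1)[OF \<phi>, of "{}"] 0 idx by (intro Loc_eq_zero) simp_all
    then have "\<phi> = \<one>\<^bsub>CG 0\<^esub>"
      using ext unfolding CG_one 0 idx by (intro extensionalityI[of _ "{{}}"]) auto
    then show ?thesis by (simp add: cech_coboundaries_def 0)
  next
    case (Suc q)
    define Z where "Z S u = coeff S (\<phi> S) r u" for S u
    \<comment> \<open>The contracting cochain. Requiring u in \<open>deg_set S r\<close> makes H S a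
      legitimate element of the localization at S.\<close>
    define H where "H S r' u = (if r' = r \<and> u \<in> deg_set S r \<and> apex r u \<notin> S
      then eps (insert (apex r u) S) (apex r u) * Z (insert (apex r u) S) u else 0)" for S r' u
    have apex: "apex r u < nv" for u by (simp add: apex_def nv_def)
    have ins: "insert (apex r u) S \<in> cech_index nv p" if "S \<in> cech_index nv q" "apex r u \<notin> S" for S u
      using cech_indexD[OF that(1)] that(2) apex[of u] Suc by (simp add: cech_index_def)
    have fin: "finite {u. Z S u \<noteq> 0}" and supp: "\<And>u. Z S u \<noteq> 0 \<Longrightarrow> u \<in> deg_set S r"
      if "S \<in> cech_index nv p" for S
      using CP_coeff(2)[OF \<phi> that] unfolding coeff_space_def Z_def by blast+
    have "H S \<in> coeff_space S r" if S: "S \<in> cech_index nv q" for S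
    proof -
      \<comment> \<open>The apex takes only two values, so two finite supports cover the support of
        H S. The intersection drops insertions that leave S unchanged.\<close>
      have "{u. H S r u \<noteq> 0} \<subseteq> (\<Union>T\<in>{insert 0 S, insert 1 S} \<inter> cech_index nv p. {u. Z T u \<noteq> 0})"
      proof
        fix u assume "u \<in> {u. H S r u \<noteq> 0}"
        then have "apex r u \<notin> S" "Z (insert (apex r u) S) u \<noteq> 0"
          by (auto simp: H_def split: if_splits)
        moreover have "apex r u = 0 \<or> apex r u = 1" by (simp add: apex_def)
        ultimately show "u \<in> (\<Union>T\<in>{insert 0 S, insert 1 S} \<inter> cech_index nv p. {u. Z T u \<noteq> 0})"
          using ins[OF S, of u] by auto
      qed
      moreover have "finite (\<Union>T\<in>{insert 0 S, insert 1 S} \<inter> cech_index nv p. {u. Z T u \<noteq> 0})"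
        using fin by auto
      ultimately have "finite {u. H S r u \<noteq> 0}" by (rule finite_subset)
      then show ?thesis by (auto simp: coeff_space_def H_def split: if_splits)
    qed
    then obtain \<psi> where \<psi>: "\<psi> \<in> CP q r" "\<And>S. S \<in> cech_index nv q \<Longrightarrow> coeff S (\<psi> S) = H S"
      using CP_ex[of q H r] by blast
    have "CD q \<psi> = \<phi>"
    proof (rule CD_eqI)
      show "\<psi> S \<in> carrier (Loc S)" if "S \<in> cech_index nv q" for S
        by (rule CP_coeff(1)[OF \<psi>(1) that])
      show "\<phi> \<in> extensional (cech_index nv (Suc q))" using ext Suc by simp
      show "\<phi> T \<in> carrier (Loc T)" if "T \<in> cech_index nv (Suc q)" for T
        using CP_coeff(1)[OF \<phi>] that Suc by simp
      fix T r' u assume T: "T \<in> cech_index nv (Suc q)"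
      note T' = cech_indexD[OF T]
      have sub: "T - {i} \<in> cech_index nv q" if "i \<in> T" for i
        using T' that by (auto simp: cech_index_def)
      have "(\<Sum>i\<in>T. eps T i * coeff (T - {i}) (\<psi> (T - {i})) r' u) = (\<Sum>i\<in>T. eps T i * H (T - {i}) r' u)"
        by (simp add: \<psi>(2) sub)
      also have "\<dots> = coeff T (\<phi> T) r' u"
      proof (cases "r' = r")
        case False
        then have "coeff T (\<phi> T) r' u = 0"
          using CP_coeff(2)[OF \<phi>, of T] T Suc by (auto simp: coeff_space_def)
        then show ?thesis using False by (simp add: H_def)
      next
        case True
        have "(\<Sum>i\<in>T. eps T i * H (T - {i}) r u) = Z T u"
        proof (rule cone_contraction[where h = "apex r u" and Z = "\<lambda>S. Z S u" and H = "\<lambda>S. H S r u"])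
          show "finite T" using T' by blast
          assume "apex r u \<notin> T"
          then have "insert (apex r u) T \<in> cech_index nv (Suc p)"
            using T' apex Suc by (auto simp: cech_index_def)
          from cocycle[OF this] show "(\<Sum>i\<in>insert (apex r u) T. eps (insert (apex r u) T) i *
              Z (insert (apex r u) T - {i}) u) = 0"
            unfolding Z_def .
        next
          fix i assume i: "i \<in> T"
          note S = sub[OF i]
          show "H (T - {i}) r u = (if apex r u \<in> T - {i} then 0
            else eps (insert (apex r u) (T - {i})) (apex r u) * Z (insert (apex r u) (T - {i})) u)"
          proof (cases "apex r u \<in> T - {i}")
            case False
            \<comment> \<open>The degree bound enters here: where Z is nonzero, the restriction
              built into H is automatic.\<close>
            have "u \<in> deg_set (T - {i}) r" if "Z (insert (apex r u) (T - {i})) u \<noteq> 0"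
              using cech_indexD[OF S] bound Suc
              by (intro deg_set_apex[OF _ _ False] supp[OF ins[OF S False] that]) auto
            then show ?thesis using False by (auto simp: H_def)
          qed (simp add: H_def)
        qed
        then show ?thesis using True by (simp add: Z_def)
      qed
      finally show "coeff T (\<phi> T) r' u = (\<Sum>i\<in>T. eps T i * coeff (T - {i}) (\<psi> (T - {i})) r' u)" ..
    qed
    then show ?thesis using \<psi>(1) Suc by (auto simp: cech_coboundaries_def)
  qed
qed

lemma one_in_cocycles:
  "\<one>\<^bsub>CG p\<^esub> \<in> cech_cocycles Rn MB (graded_part \<alpha> B) mvar nv p r"
proof -
  have 0: "(\<lambda>r u. 0) \<in> coeff_space S r" for S by (simp add: coeff_space_def)
  obtain \<phi> :: "nat set \<Rightarrow> ('a mpoly \<times> nat) set" where \<phi>: "\<phi> \<in> CP p r"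
    "\<And>S. S \<in> cech_index nv p \<Longrightarrow> coeff S (\<phi> S) = (\<lambda>r u. 0)"
    using CP_ex[of p "\<lambda>S r u. 0" r] 0 by blast
  have "\<phi> = \<one>\<^bsub>CG p\<^esub>"
  proof (rule extensionalityI[of _ "cech_index nv p"])
    show "\<phi> \<in> extensional (cech_index nv p)" by (rule CP_extensional[OF \<phi>(1)])
    fix S assume S: "S \<in> cech_index nv p"
    show "\<phi> S = \<one>\<^bsub>CG p\<^esub> S"
      using Loc_eq_zero[OF _ CP_coeff(1)[OF \<phi>(1) S] \<phi>(2)[OF S]] cech_indexD[OF S] S
      by (simp add: CG_one)
  qed (simp add: CG_one)
  moreover have "CD p \<phi> = \<one>\<^bsub>CG (Suc p)\<^esub>"
  proof (rule CD_eqI)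
    show "\<phi> S \<in> carrier (Loc S)" if "S \<in> cech_index nv p" for S
      by (rule CP_coeff(1)[OF \<phi>(1) that])
    fix T assume T: "T \<in> cech_index nv (Suc p)"
    show "\<one>\<^bsub>CG (Suc p)\<^esub> T \<in> carrier (Loc T)"
      using T Loc_zero(1)[of T] cech_indexD[OF T] by (simp add: CG_one)
    fix r' u
    have "T - {i} \<in> cech_index nv p" if "i \<in> T" for i
      using cech_indexD[OF T] that by (auto simp: cech_index_def)
    then show "coeff T (\<one>\<^bsub>CG (Suc p)\<^esub> T) r' u = (\<Sum>i\<in>T. eps T i * coeff (T - {i}) (\<phi> (T - {i})) r' u)"
      using T cech_indexD[OF T] by (simp add: CG_one \<phi>(2) Loc_zero(2))
  qed (simp add: CG_one)
  ultimately show ?thesis using \<phi>(1) by (simp add: cech_cocycles_def)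
qed

lemma local_cohomology_trivial:
  assumes "int \<alpha> - int c < int p + r"
  defines "L \<equiv> (local_cohomology Rn MB (graded_part \<alpha> B) mvar nv p r
    :: (nat set \<Rightarrow> ('k::field mpoly \<times> nat) set) set monoid)"
  shows "carrier L = {\<one>\<^bsub>L\<^esub>}"
  unfolding L_def local_cohomology_def
proof (rule FactGroup_trivial)
  let ?C = "cech_coboundaries Rn MB (graded_part \<alpha> B) mvar nv p r :: (nat set \<Rightarrow> ('k mpoly \<times> nat) set) set"
  show "cech_cocycles Rn MB (graded_part \<alpha> B) mvar nv p r \<noteq> ({} :: (nat set \<Rightarrow> ('k mpoly \<times> nat) set) set)"
    using one_in_cocycles by blast
  show "cech_cocycles Rn MB (graded_part \<alpha> B) mvar nv p r \<subseteq> ?C"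
    by (rule cocycles_subset_coboundaries[OF assms(1)])
  have one: "\<one>\<^bsub>CG p\<^esub> \<otimes>\<^bsub>CG p\<^esub> \<one>\<^bsub>CG p\<^esub> = (\<one>\<^bsub>CG p\<^esub> :: nat set \<Rightarrow> ('k mpoly \<times> nat) set)"
  proof -
    have "\<zero>\<^bsub>Loc S\<^esub> \<oplus>\<^bsub>Loc S\<^esub> \<zero>\<^bsub>Loc S\<^esub> = (\<zero>\<^bsub>Loc S\<^esub> :: ('k mpoly \<times> nat) set)" if "S \<in> cech_index nv p" for S
    proof -
      interpret abelian_group "Loc S :: ('k mpoly, ('k mpoly \<times> nat) set) module"
        using abelian_group_Loc cech_indexD[OF that] by blast
      show ?thesis by simp
    qed
    then show ?thesis unfolding CG_mult CG_one by (intro ext) simp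
  qed
  fix x y :: "nat set \<Rightarrow> ('k mpoly \<times> nat) set"
  assume xy: "x \<in> ?C" "y \<in> ?C"
  \<comment> \<open>Coset arithmetic is reduced to linear combinations of coefficients: x + y for
    closure, x - y as the solution of h + y = x.\<close>
  have comb: "\<exists>z\<in>?C. \<forall>T\<in>cech_index nv p. z T \<in> carrier (Loc T) \<and> x T \<in> carrier (Loc T) \<and> y T \<in> carrier (Loc T) \<and>
      coeff T (z T) = (\<lambda>r u. coeff T (x T) r u + s * coeff T (y T) r u)"
    and ext: "?C \<subseteq> extensional (cech_index nv p)" if p: "p = Suc q" for s q
  proof -
    obtain \<phi> \<psi> where \<phi>: "\<phi> \<in> CP q r" "x = CD q \<phi>" and \<psi>: "\<psi> \<in> CP q r" "y = CD q \<psi>"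
      using xy by (auto simp: cech_coboundaries_def p)
    obtain \<chi> where \<chi>: "\<chi> \<in> CP q r"
      "\<And>T r u. T \<in> cech_index nv (Suc q) \<Longrightarrow>
      coeff T (CD q \<chi> T) r u = coeff T (CD q \<phi> T) r u + s * coeff T (CD q \<psi> T) r u"
      using coboundary_comb[OF \<phi>(1) \<psi>(1)] by blast
    show "\<exists>z\<in>?C. \<forall>T\<in>cech_index nv p. z T \<in> carrier (Loc T) \<and> x T \<in> carrier (Loc T) \<and> y T \<in> carrier (Loc T) \<and>
      coeff T (z T) = (\<lambda>r u. coeff T (x T) r u + s * coeff T (y T) r u)"
    proof (rule bexI[of _ "CD q \<chi>"])
      show "CD q \<chi> \<in> ?C" using \<chi>(1) by (auto simp: cech_coboundaries_def p)
    qed (use \<chi> \<phi> \<psi> CD_CP_coeff(1) in \<open>auto simp: p fun_eq_iff\<close>)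
    show "?C \<subseteq> extensional (cech_index nv p)"
      by (auto simp: cech_coboundaries_def p cech_diff_def)
  qed
  show "x \<otimes>\<^bsub>CG p\<^esub> y \<in> ?C"
  proof (cases p)
    case 0
    then show ?thesis using xy one by (simp add: cech_coboundaries_def)
  next
    case (Suc q)
    obtain z where z: "z \<in> ?C" "\<And>T. T \<in> cech_index nv p \<Longrightarrow> z T \<in> carrier (Loc T) \<and>
      x T \<in> carrier (Loc T) \<and> y T \<in> carrier (Loc T) \<and>
      coeff T (z T) = (\<lambda>r u. coeff T (x T) r u + 1 * coeff T (y T) r u)"
      using comb[OF Suc, of 1] by blast
    have "x \<otimes>\<^bsub>CG p\<^esub> y = z"
    proof (rule extensionalityI[of _ "cech_index nv p"])
      show "z \<in> extensional (cech_index nv p)" using ext[OF Suc] z(1) by blast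
      fix T assume T: "T \<in> cech_index nv p"
      have T': "T \<subseteq> {..<nv}" using cech_indexD[OF T] by blast
      have "x T \<oplus>\<^bsub>Loc T\<^esub> y T = z T"
        by (rule coeff_inj[OF T']) (use z(2)[OF T] in \<open>simp_all add: Loc_add[OF T']\<close>)
      then show "(x \<otimes>\<^bsub>CG p\<^esub> y) T = z T" using T by (simp add: CG_mult)
    qed (simp add: CG_mult)
    then show ?thesis using z(1) by simp
  qed
  show "\<exists>h\<in>?C. h \<otimes>\<^bsub>CG p\<^esub> y = x"
  proof (cases p)
    case 0
    then show ?thesis using xy one by (simp add: cech_coboundaries_def)
  next
    case (Suc q)
    obtain z where z: "z \<in> ?C" "\<And>T. T \<in> cech_index nv p \<Longrightarrow> z T \<in> carrier (Loc T) \<and>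
      x T \<in> carrier (Loc T) \<and> y T \<in> carrier (Loc T) \<and>
      coeff T (z T) = (\<lambda>r u. coeff T (x T) r u + (- 1) * coeff T (y T) r u)"
      using comb[OF Suc, of "- 1"] by blast
    have "z \<otimes>\<^bsub>CG p\<^esub> y = x"
    proof (rule extensionalityI[of _ "cech_index nv p"])
      show "x \<in> extensional (cech_index nv p)" using ext[OF Suc] xy(1) by blast
      fix T assume T: "T \<in> cech_index nv p"
      have T': "T \<subseteq> {..<nv}" using cech_indexD[OF T] by blast
      have "z T \<oplus>\<^bsub>Loc T\<^esub> y T = x T"
        by (rule coeff_inj[OF T']) (use z(2)[OF T] in \<open>simp_all add: Loc_add[OF T']\<close>)
      then show "(z \<otimes>\<^bsub>CG p\<^esub> y) T = x T" using T by (simp add: CG_mult)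
    qed (simp add: CG_mult)
    then show ?thesis using z(1) by blast
  qed
qed

text \<open>A nonzero component in degree r of the i-th cohomology forces i + r \<le> \<alpha> - c,
  uniformly in i.\<close>

lemma regularity_bound:
  "regularity nv (MB :: ('k::field mpoly, 'k mpoly) module) (graded_part \<alpha> B) \<le> ereal (real \<alpha> - real c)"
  unfolding regularity_def
proof (rule SUP_least)
  fix i :: nat
  let ?H = "local_cohomology Rn (MB :: ('k mpoly, 'k mpoly) module) (graded_part \<alpha> B) mvar nv i"
  have "a_invariant ?H \<le> ereal (real \<alpha> - real c - real i)"
    unfolding a_invariant_def
  proof (rule SUP_least)
    fix r assume "r \<in> {r. carrier (?H r) \<noteq> {\<one>\<^bsub>?H r\<^esub>}}"
    then have "\<not> int \<alpha> - int c < int i + r"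
      using local_cohomology_trivial by blast
    then show "ereal (real_of_int r) \<le> ereal (real \<alpha> - real c - real i)" by simp
  qed
  then have "ereal (real i) + a_invariant ?H \<le> ereal (real i) + ereal (real \<alpha> - real c - real i)"
    by (rule add_left_mono)
  then show "ereal (real i) + a_invariant ?H \<le> ereal (real \<alpha> - real c)" by simp
qed

end

theorem theorem4p10:
  fixes d \<alpha> c :: nat
    and a :: "nat \<Rightarrow> (nat \<Rightarrow>\<^sub>0 nat)"
    and B :: "(nat \<Rightarrow>\<^sub>0 nat) set"
    and KB :: "'k::field mpoly ring"
    and KB_grading :: "int \<Rightarrow> 'k mpoly set"
  assumes "homogeneous_simplicial_semigroup d \<alpha> c a B"
    and "KB = subring_of (semigroup_algebra B)"
    and "KB_grading = graded_part \<alpha> B"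
    and "krull_dim KB = 2"
  shows "regularity (d + c) (semigroup_module (generator d \<alpha> a) B) KB_grading
    \<le> ereal (multiplicity_degree d KB_grading) - codimension KB KB_grading"
proof -
  \<comment> \<open>The number of coordinates has to be recovered from the Krull dimension before
    the plane theory applies.\<close>
  have d: "d = 2"
    using homogeneous_simplicial_semigroup.dim_eq_2[OF assms(1)] assms(2,4) by blast
  interpret plane_semigroup \<alpha> c a B
    using assms(1) unfolding d plane_semigroup_def .
  show ?thesis
    using regularity_bound[where ?'k = 'k]
    unfolding d assms(3) multiplicity_degree_eq codimension_eq[OF assms(4)] nv_def by simp
qed

end
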